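(* Let $r\in\{0,1\}$ and let $G$ be a connected three-dimensional Lie group with a left-invariant pseudo-Riemannian metric $g$ of signature $(r,3-r)$ and its $G$-invariant spin structure $P=G\times H$. Then for a fixed $\epsilon\in\mathcal E_r$ the following conditions are equivalent: (1) $G$ is unimodular; (2) some invariant $\epsilon$-unit spinor is a generalized Killing spinor; (3) every invariant $\epsilon$-unit spinor is a generalized Killing spinor; (4) some $G$-equivariant section of $P$ is Lagrangian; (5) every $G$-equivariant section of $P$ is Lagrangian. Moreover, in this case all invariant generalized Killing spinors have the same associated symmetric endomorphism.
   Context: Algebra. $r=0$ is the Riemannian and $r=1$ the Lorentzian case. $\mathfrak m=(\mathbb R^{r,3-r},\langle\cdot,\cdot\rangle)$ is oriented with oriented orthonormal basis $X_0,X_1,X_2$, $\langle X_0,X_0\rangle=(-1)^r$, $\langle X_1,X_1\rangle=\langle X_2,X_2\rangle=1$; the cross product is defined by $\langle X\times Y,Z\rangle=\mathrm{vol}(X,Y,Z)$, $\mathrm{vol}(X_0,X_1,X_2)=1$. $H=\mathrm{SU}(2)$ if $r=0$, $H=\mathrm{SU}(1,1)$ if $r=1$, with Lie algebra $\mathfrak h$. Put $\gamma_1=\begin{pmatrix}0&1\\-1&0\end{pmatrix}$, $\gamma_2=\begin{pmatrix}0&\sqrt{-1}\\ \sqrt{-1}&0\end{pmatrix}$, and $\gamma_0=\mathrm{diag}(\sqrt{-1},-\sqrt{-1})$ if $r=0$, $\gamma_0=\mathrm{diag}(1,-1)$ if $r=1$; $\gamma\colon\mathfrak m\to\mathfrak{gl}(2,\mathbb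 C)$ is linear with $\gamma(X_k)=\gamma_k$. $\lambda\colon H\to\mathrm{SO}_0(\mathfrak m)$ is the double covering with $\gamma(\lambda(h)X)=h\gamma(X)h^{-1}$. $l_g\colon\mathfrak m\to\mathfrak h$ is the linear isomorphism with $\lambda_*(l_g(X))Y=X\times Y$ (explicitly $l_g(X)=\frac{(\sqrt{-1})^r}{2}\gamma(X)$). Spin structure. Fix a left-invariant oriented orthonormal frame $\mathcal X_0,\mathcal X_1,\mathcal X_2$ on $G$ with $g(\mathcal X_i,\mathcal X_j)=\langle X_i,X_j\rangle$. The $G$-invariant spin structure is the trivial principal $H$-bundle $P=G\times H$ (right multiplication on $H$) with $[(a,h),X]=[(a,\mathbf 1),\lambda(h)X]$ and $[(a,\mathbf 1),X_k]=\mathcal X_k|_a$, where $[u,X]\in T_{\pi(u)}G$ denotes the image of $X\in\mathfrak m$ under the orthonormal frame determined by $u\in P$. The lifted $G$-action is $\widetilde L_a(k,h)=(ak,h)$. A section $\sigma$ of $P$ is $G$-equivariant if $\widetilde L_a\sigma(q)=\sigma(aq)$ for all $a,q\in G$. A spinor is (left-)invariant if it is fixed by the induced action of $G$ on spinor fields, i.e. if it is $[(q,\mathbf 1),v]$ with $v\in\mathbb C^2$ constant. Lagrangian sections. $\theta$ is the solder form on $P$ ($d\pi(\xi)=[u,\theta(\xi)]$ for $\xi\in T_uP$), $\widetilde\omega$ the spin Levi-Civita connection form; $X^H$ ($X\in\mathfrak m$) is the vector field with $\theta(X^H)=X$, $\widetilde\omega(X^H)=0$; $U^\#$ ($U\in\mathfrak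 h$) is the fundamental vector field. $\Omega$ is the two-form on $P$ with $\Omega(X^H+U^\#,Y^H+V^\#)=\langle X,l_g^{-1}V\rangle-\langle l_g^{-1}U,Y\rangle$. A section $\sigma$ of $P$ is Lagrangian if $\sigma^*\Omega=0$. Spinors. $\Sigma G=P\times_H\mathbb C^2$ (defining representation); $[u,X]\cdot[u,v]=[u,\gamma(X)v]$; $\langle\psi,\phi\rangle=\psi^\dagger(\gamma_0)^r\phi$; $\nabla_{\mathcal X}[s,v]=[s,dv(\mathcal X)+(s^*\widetilde\omega)(\mathcal X)v]$ for a section $s$ of $P$. $\mathcal E_0=\{+1\}$, $\mathcal E_1=\{+1,-1\}$; $\psi$ is $\epsilon$-unit if $\langle\psi,\psi\rangle=\epsilon$. An $\epsilon$-unit spinor has a unique real $(1,1)$-tensor field $A$ with $\nabla_{\mathcal X}\psi=(\sqrt{-1})^rA(\mathcal X)\cdot\psi$ for all $\mathcal X$; it is a generalized Killing spinor if $A$ is $g$-symmetric, and then $A$ is its associated symmetric endomorphism. *)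

theory Defs
  imports "HOL-Analysis.Analysis"
begin

section \<open>Smooth manifolds of dimension three\<close>

primrec Ck_on :: "nat \<Rightarrow> 'a::real_normed_vector set \<Rightarrow> ('a \<Rightarrow> 'b::real_normed_vector) \<Rightarrow> bool" where
  "Ck_on 0 S f \<longleftrightarrow> continuous_on S f"
| "Ck_on (Suc k) S f \<longleftrightarrow>
     (\<forall>x\<in>S. f differentiable (at x)) \<and> (\<forall>v. Ck_on k S (\<lambda>x. frechet_derivative f (at x) v))"

text \<open>Only used for open \<open>S\<close> in finite-dimensional spaces, where it means \<open>C\<^sup>\<infinity>\<close> on \<open>S\<close>.\<close>

definition smooth_on :: "'a::real_normed_vector set \<Rightarrow> ('a \<Rightarrow> 'b::real_normed_vector) \<Rightarrow> bool" where
  "smooth_on S f \<longleftrightarrow> (\<forall>k. Ck_on k S f)"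

text \<open>
  A smooth structure is presented by an atlas indexed by the points of the manifold, the chart with
  index \<open>p\<close> being a chart around \<open>p\<close> (every maximal atlas contains such an atlas and is determined by
  it).  The tangent space at \<open>p\<close> is identified with \<open>real^3\<close> by means of the chart with index \<open>p\<close>;
  thus a tangent vector is a pair of a point \<open>p\<close> and its coordinate vector in the chart with index
  \<open>p\<close>, and a vector field is a function from points to \<open>real^3\<close>.
\<close>

type_synonym 'g charts = "'g \<Rightarrow> 'g set \<times> ('g \<Rightarrow> real^3)"
type_synonym 'g vfield = "'g \<Rightarrow> real^3"

definition dom_of :: "'g charts \<Rightarrow> 'g \<Rightarrow> 'g set" where
  "dom_of C p = fst (C p)"

definition coord :: "'g charts \<Rightarrow> 'g \<Rightarrow> 'g \<Rightarrow> real^3" where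
  "coord C p = snd (C p)"

definition pt :: "'g charts \<Rightarrow> 'g \<Rightarrow> real^3 \<Rightarrow> 'g" where
  "pt C p = inv_into (dom_of C p) (coord C p)"

definition smooth_atlas :: "'g::topological_space charts \<Rightarrow> bool" where
  "smooth_atlas C \<longleftrightarrow>
     (\<forall>p. p \<in> dom_of C p \<and> open (dom_of C p) \<and> open (coord C p ` dom_of C p)
          \<and> homeomorphism (dom_of C p) (coord C p ` dom_of C p) (coord C p) (pt C p))
     \<and> (\<forall>p q. smooth_on (coord C p ` (dom_of C p \<inter> dom_of C q)) (coord C q \<circ> pt C p))"

definition smooth_fun :: "'g charts \<Rightarrow> 'g set \<Rightarrow> ('g \<Rightarrow> 'b::real_normed_vector) \<Rightarrow> bool" where
  "smooth_fun C W f \<longleftrightarrow> (\<forall>p. smooth_on (coord C p ` (W \<inter> dom_of C p)) (f \<circ> pt C p))"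

definition smooth_map :: "'g::topological_space charts \<Rightarrow> ('g \<Rightarrow> 'g) \<Rightarrow> bool" where
  "smooth_map C f \<longleftrightarrow> continuous_on UNIV f
     \<and> (\<forall>p q. smooth_on (coord C p ` (dom_of C p \<inter> f -` dom_of C q)) (coord C q \<circ> f \<circ> pt C p))"

text \<open>\<open>fder C f p V\<close> is \<open>df(V)\<close> for a vector-valued function \<open>f\<close>, and \<open>mder C f p V\<close> is the value of
  the differential of a self-map \<open>f\<close> of the manifold, where \<open>V\<close> is tangent at \<open>p\<close>.\<close>

definition fder :: "'g charts \<Rightarrow> ('g \<Rightarrow> 'b::real_normed_vector) \<Rightarrow> 'g \<Rightarrow> real^3 \<Rightarrow> 'b" where
  "fder C f p V = frechet_derivative (f \<circ> pt C p) (at (coord C p p)) V"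

definition mder :: "'g charts \<Rightarrow> ('g \<Rightarrow> 'g) \<Rightarrow> 'g \<Rightarrow> real^3 \<Rightarrow> real^3" where
  "mder C f p V = frechet_derivative (coord C (f p) \<circ> f \<circ> pt C p) (at (coord C p p)) V"

text \<open>\<open>fder C (coord C p) q (X q)\<close> is the coordinate vector of \<open>X q\<close> in the chart with index \<open>p\<close>.\<close>

definition smooth_vf :: "'g charts \<Rightarrow> 'g vfield \<Rightarrow> bool" where
  "smooth_vf C X \<longleftrightarrow> (\<forall>p. smooth_fun C (dom_of C p) (\<lambda>q. fder C (coord C p) q (X q)))"

definition is_lie_bracket :: "'g::topological_space charts \<Rightarrow> 'g vfield \<Rightarrow> 'g vfield \<Rightarrow> 'g vfield \<Rightarrow> bool" where
  "is_lie_bracket C X Y Z \<longleftrightarrow>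
     (\<forall>W. \<forall>f::'g \<Rightarrow> real. open W \<and> smooth_fun C W f \<longrightarrow>
        (\<forall>p\<in>W. fder C f p (Z p)
              = fder C (\<lambda>q. fder C f q (Y q)) p (X p) - fder C (\<lambda>q. fder C f q (X q)) p (Y p)))"

definition tensor_field :: "'g charts \<Rightarrow> ('g \<Rightarrow> real^3 \<Rightarrow> real^3) \<Rightarrow> bool" where
  "tensor_field C A \<longleftrightarrow> (\<forall>p. linear (A p)) \<and> (\<forall>X. smooth_vf C X \<longrightarrow> smooth_vf C (\<lambda>p. A p (X p)))"

section \<open>Lie groups, Haar measure, left-invariant metrics\<close>

definition lie_group ::
  "'g::topological_space charts \<Rightarrow> ('g \<Rightarrow> 'g \<Rightarrow> 'g) \<Rightarrow> 'g \<Rightarrow> ('g \<Rightarrow> 'g) \<Rightarrow> bool" where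
  "lie_group C mul e iv \<longleftrightarrow>
     smooth_atlas C \<and> group mul e iv \<and> smooth_map C iv
     \<and> continuous_on UNIV (\<lambda>(a, b). mul a b)
     \<and> (\<forall>p q s. smooth_on
          {(x, y). x \<in> coord C p ` dom_of C p \<and> y \<in> coord C q ` dom_of C q
                   \<and> mul (pt C p x) (pt C q y) \<in> dom_of C s}
          (\<lambda>(x, y). coord C s (mul (pt C p x) (pt C q y))))"

text \<open>On a second countable Lie group every Borel measure that is finite on compact sets is regular,
  so regularity need not be required of a Haar measure.\<close>

definition left_haar :: "('g::topological_space \<Rightarrow> 'g \<Rightarrow> 'g) \<Rightarrow> 'g measure \<Rightarrow> bool" where
  "left_haar mul \<mu> \<longleftrightarrow>
     sets \<mu> = sets borel \<and> (\<forall>K. compact K \<longrightarrow> emeasure \<mu> K < \<infinity>) \<and> emeasure \<mu> UNIV \<noteq> 0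
     \<and> (\<forall>a. \<forall>E\<in>sets borel. emeasure \<mu> ((\<lambda>q. mul a q) ` E) = emeasure \<mu> E)"

definition unimodular :: "('g::topological_space \<Rightarrow> 'g \<Rightarrow> 'g) \<Rightarrow> bool" where
  "unimodular mul \<longleftrightarrow>
     (\<exists>\<mu>. left_haar mul \<mu> \<and> (\<forall>a. \<forall>E\<in>sets borel. emeasure \<mu> ((\<lambda>q. mul q a) ` E) = emeasure \<mu> E))"

definition left_invariant_vf :: "'g charts \<Rightarrow> ('g \<Rightarrow> 'g \<Rightarrow> 'g) \<Rightarrow> 'g vfield \<Rightarrow> bool" where
  "left_invariant_vf C mul X \<longleftrightarrow> smooth_vf C X \<and> (\<forall>a q. mder C (mul a) q (X q) = X (mul a q))"

text \<open>\<open>inner_m r\<close> is the scalar product of \<open>\<real>\<^bsup>r,3-r\<^esup>\<close> (for \<open>r \<in> {0, 1}\<close>).  The index type \<open>3\<close> has the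
  elements \<open>0, 1, 2\<close>, and \<open>X\<^sub>k\<close> is \<open>axis k 1\<close>.\<close>

definition inner_m :: "nat \<Rightarrow> real^3 \<Rightarrow> real^3 \<Rightarrow> real" where
  "inner_m r X Y = (-1)^r * (X$0 * Y$0) + X$1 * Y$1 + X$2 * Y$2"

definition pseudo_metric :: "nat \<Rightarrow> 'g charts \<Rightarrow> ('g \<Rightarrow> real^3 \<Rightarrow> real^3 \<Rightarrow> real) \<Rightarrow> bool" where
  "pseudo_metric r C g \<longleftrightarrow>
     (\<forall>p. bilinear (g p) \<and> (\<forall>V W. g p V W = g p W V)
          \<and> (\<exists>b::3 \<Rightarrow> real^3. \<forall>i j. g p (b i) (b j) = inner_m r (axis i 1) (axis j 1)))
     \<and> (\<forall>X Y. smooth_vf C X \<and> smooth_vf C Y \<longrightarrow> smooth_fun C UNIV (\<lambda>p. g p (X p) (Y p)))"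

definition left_invariant_metric ::
  "'g charts \<Rightarrow> ('g \<Rightarrow> 'g \<Rightarrow> 'g) \<Rightarrow> ('g \<Rightarrow> real^3 \<Rightarrow> real^3 \<Rightarrow> real) \<Rightarrow> bool" where
  "left_invariant_metric C mul g \<longleftrightarrow>
     (\<forall>a q V W. g (mul a q) (mder C (mul a) q V) (mder C (mul a) q W) = g q V W)"

definition levi_civita ::
  "'g::topological_space charts \<Rightarrow> ('g \<Rightarrow> real^3 \<Rightarrow> real^3 \<Rightarrow> real)
   \<Rightarrow> ('g vfield \<Rightarrow> 'g vfield \<Rightarrow> 'g vfield) \<Rightarrow> bool" where
  "levi_civita C g D \<longleftrightarrow>
     (\<forall>X Y. smooth_vf C X \<and> smooth_vf C Y \<longrightarrow>
        smooth_vf C (D X Y)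
        \<and> is_lie_bracket C X Y (\<lambda>p. D X Y p - D Y X p)
        \<and> (\<forall>f::'g \<Rightarrow> real. smooth_fun C UNIV f \<longrightarrow>
             D (\<lambda>p. f p *\<^sub>R X p) Y = (\<lambda>p. f p *\<^sub>R D X Y p)
             \<and> D X (\<lambda>p. f p *\<^sub>R Y p) = (\<lambda>p. fder C f p (X p) *\<^sub>R Y p + f p *\<^sub>R D X Y p))
        \<and> (\<forall>Z. smooth_vf C Z \<longrightarrow>
             D (\<lambda>p. X p + Z p) Y = (\<lambda>p. D X Y p + D Z Y p)
             \<and> D X (\<lambda>p. Y p + Z p) = (\<lambda>p. D X Y p + D X Z p)
             \<and> (\<forall>p. fder C (\<lambda>q. g q (Y q) (Z q)) p (X p)
                     = g p (D X Y p) (Z p) + g p (Y p) (D X Z p))))"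

text \<open>A left-invariant orthonormal frame \<open>E\<close>; the orientation of the group is the one it defines.\<close>

definition invariant_frame ::
  "nat \<Rightarrow> 'g charts \<Rightarrow> ('g \<Rightarrow> 'g \<Rightarrow> 'g) \<Rightarrow> ('g \<Rightarrow> real^3 \<Rightarrow> real^3 \<Rightarrow> real) \<Rightarrow> (3 \<Rightarrow> 'g vfield) \<Rightarrow> bool" where
  "invariant_frame r C mul g E \<longleftrightarrow>
     (\<forall>k. left_invariant_vf C mul (E k))
     \<and> (\<forall>p i j. g p (E i p) (E j p) = inner_m r (axis i 1) (axis j 1))"

section \<open>The groups SU(2) and SU(1,1) and their action on \<open>\<real>\<^bsup>r,3-r\<^esup>\<close>\<close>

type_synonym mat2 = "complex^2^2"

definition smat :: "complex \<Rightarrow> mat2 \<Rightarrow> mat2" where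
  "smat c M = (\<chi> i j. c * M$i$j)"

definition adjoint_mat :: "mat2 \<Rightarrow> mat2" where
  "adjoint_mat M = (\<chi> i j. cnj (M$j$i))"

definition gamma0 :: "nat \<Rightarrow> mat2" where
  "gamma0 r = (if r = 0 then vector [vector [\<i>, 0], vector [0, -\<i>]]
               else vector [vector [1, 0], vector [0, -1]])"

definition gamma1 :: mat2 where
  "gamma1 = vector [vector [0, 1], vector [-1, 0]]"

definition gamma2 :: mat2 where
  "gamma2 = vector [vector [0, \<i>], vector [\<i>, 0]]"

definition gam :: "nat \<Rightarrow> real^3 \<Rightarrow> mat2" where
  "gam r X = X$0 *\<^sub>R gamma0 r + X$1 *\<^sub>R gamma1 + X$2 *\<^sub>R gamma2"

text \<open>\<open>(\<gamma>\<^sub>0)\<^sup>r\<close> for \<open>r \<in> {0, 1}\<close>.\<close>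

definition gamma0_pow :: "nat \<Rightarrow> mat2" where
  "gamma0_pow r = (if r = 0 then mat 1 else gamma0 r)"

text \<open>\<open>SU(2)\<close> for \<open>r = 0\<close> and \<open>SU(1,1)\<close> for \<open>r = 1\<close>.\<close>

definition H_grp :: "nat \<Rightarrow> mat2 set" where
  "H_grp r = {h. adjoint_mat h ** gamma0_pow r ** h = gamma0_pow r \<and> det h = 1}"

definition H_tangent :: "nat \<Rightarrow> mat2 \<Rightarrow> mat2 set" where
  "H_tangent r h = {\<xi>. \<exists>c::real \<Rightarrow> mat2.
     (\<forall>t. c t \<in> H_grp r) \<and> c 0 = h \<and> (c has_vector_derivative \<xi>) (at 0)}"

definition H_lie :: "nat \<Rightarrow> mat2 set" where
  "H_lie r = H_tangent r (mat 1)"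

definition lam :: "nat \<Rightarrow> mat2 \<Rightarrow> real^3 \<Rightarrow> real^3" where
  "lam r h X = (THE Y. gam r Y = h ** gam r X ** matrix_inv h)"

text \<open>The differential \<open>\<lambda>\<^sub>*\<close> of \<open>lam r\<close> at the identity.\<close>

definition lam_star :: "nat \<Rightarrow> mat2 \<Rightarrow> real^3 \<Rightarrow> real^3" where
  "lam_star r U X = (THE Y. \<forall>c::real \<Rightarrow> mat2.
     (\<forall>t. c t \<in> H_grp r) \<and> c 0 = mat 1 \<and> (c has_vector_derivative U) (at 0)
     \<longrightarrow> ((\<lambda>t. lam r (c t) X) has_vector_derivative Y) (at 0))"

definition vol_m :: "real^3 \<Rightarrow> real^3 \<Rightarrow> real^3 \<Rightarrow> real" where
  "vol_m X Y Z = det (\<chi> i. if i = 0 then X else if i = 1 then Y else Z)"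

definition cross_m :: "nat \<Rightarrow> real^3 \<Rightarrow> real^3 \<Rightarrow> real^3" where
  "cross_m r X Y = (THE W. \<forall>Z. inner_m r W Z = vol_m X Y Z)"

definition l_g :: "nat \<Rightarrow> real^3 \<Rightarrow> mat2" where
  "l_g r X = (THE U. U \<in> H_lie r \<and> (\<forall>Y. lam_star r U Y = cross_m r X Y))"

section \<open>The invariant spin structure \<open>P = G \<times> H\<close>\<close>

text \<open>Points of \<open>P\<close> and tangent vectors of \<open>P\<close> are pairs.\<close>

type_synonym 'g ppoint = "'g \<times> mat2"
type_synonym ptangent = "(real^3) \<times> mat2"
type_synonym 'g pform = "'g ppoint \<Rightarrow> ptangent \<Rightarrow> mat2"

definition P_set :: "nat \<Rightarrow> 'g ppoint set" where
  "P_set r = UNIV \<times> H_grp r"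

definition P_tangent :: "nat \<Rightarrow> 'g ppoint \<Rightarrow> ptangent set" where
  "P_tangent r u = UNIV \<times> H_tangent r (snd u)"

definition P_right :: "'g ppoint \<Rightarrow> mat2 \<Rightarrow> 'g ppoint" where
  "P_right u k = (fst u, snd u ** k)"

definition P_left :: "('g \<Rightarrow> 'g \<Rightarrow> 'g) \<Rightarrow> 'g \<Rightarrow> 'g ppoint \<Rightarrow> 'g ppoint" where
  "P_left mul a u = (mul a (fst u), snd u)"

text \<open>\<open>frm r E u X\<close> is the tangent vector \<open>[u, X]\<close> at \<open>fst u\<close>.\<close>

definition frm :: "nat \<Rightarrow> (3 \<Rightarrow> 'g vfield) \<Rightarrow> 'g ppoint \<Rightarrow> real^3 \<Rightarrow> real^3" where
  "frm r E u X = (\<Sum>k\<in>UNIV. (lam r (snd u) X)$k *\<^sub>R E k (fst u))"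

definition solder :: "nat \<Rightarrow> (3 \<Rightarrow> 'g vfield) \<Rightarrow> 'g ppoint \<Rightarrow> ptangent \<Rightarrow> real^3" where
  "solder r E u \<zeta> = (THE X. frm r E u X = fst \<zeta>)"

definition fundamental :: "mat2 \<Rightarrow> 'g ppoint \<Rightarrow> ptangent" where
  "fundamental U u = (0, snd u ** U)"

definition smooth_section :: "nat \<Rightarrow> 'g charts \<Rightarrow> ('g \<Rightarrow> 'g ppoint) \<Rightarrow> bool" where
  "smooth_section r C s \<longleftrightarrow>
     (\<forall>q. s q \<in> P_set r \<and> fst (s q) = q) \<and> smooth_fun C UNIV (\<lambda>q. snd (s q))"

definition push :: "'g charts \<Rightarrow> ('g \<Rightarrow> 'g ppoint) \<Rightarrow> 'g \<Rightarrow> real^3 \<Rightarrow> ptangent" where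
  "push C s p V = (mder C (\<lambda>q. fst (s q)) p V, fder C (\<lambda>q. snd (s q)) p V)"

text \<open>\<open>\<omega>\<close> is the principal connection form on \<open>P\<close> that induces the Levi-Civita connection \<open>D\<close> on
  \<open>TG = P \<times>\<^sub>H \<real>\<^bsup>r,3-r\<^esup>\<close>.\<close>

definition spin_connection_form ::
  "nat \<Rightarrow> 'g charts \<Rightarrow> (3 \<Rightarrow> 'g vfield) \<Rightarrow> ('g vfield \<Rightarrow> 'g vfield \<Rightarrow> 'g vfield) \<Rightarrow> 'g pform \<Rightarrow> bool" where
  "spin_connection_form r C E D \<omega> \<longleftrightarrow>
     (\<forall>u\<in>P_set r.
        (\<forall>\<zeta>\<in>P_tangent r u. \<omega> u \<zeta> \<in> H_lie r)
        \<and> (\<forall>\<zeta>\<in>P_tangent r u. \<forall>\<eta>\<in>P_tangent r u. \<forall>a b.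
              \<omega> u (a *\<^sub>R \<zeta> + b *\<^sub>R \<eta>) = a *\<^sub>R \<omega> u \<zeta> + b *\<^sub>R \<omega> u \<eta>)
        \<and> (\<forall>U\<in>H_lie r. \<omega> u (fundamental U u) = U)
        \<and> (\<forall>\<zeta>\<in>P_tangent r u. \<forall>k\<in>H_grp r.
              \<omega> (P_right u k) (fst \<zeta>, snd \<zeta> ** k) = matrix_inv k ** \<omega> u \<zeta> ** k))
     \<and> (\<forall>s V. smooth_section r C s \<and> smooth_vf C V \<longrightarrow>
          smooth_fun C UNIV (\<lambda>p. \<omega> (s p) (push C s p (V p)))
          \<and> (\<forall>X::'g \<Rightarrow> real^3. smooth_fun C UNIV X \<longrightarrow>
               D V (\<lambda>p. frm r E (s p) (X p))
               = (\<lambda>p. frm r E (s p)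
                        (fder C X p (V p) + lam_star r (\<omega> (s p) (push C s p (V p))) (X p)))))"

text \<open>The value at \<open>u\<close> of the vector field \<open>X\<^sup>H\<close>.\<close>

definition horiz :: "nat \<Rightarrow> (3 \<Rightarrow> 'g vfield) \<Rightarrow> 'g pform \<Rightarrow> real^3 \<Rightarrow> 'g ppoint \<Rightarrow> ptangent" where
  "horiz r E \<omega> X u = (THE \<zeta>. \<zeta> \<in> P_tangent r u \<and> solder r E u \<zeta> = X \<and> \<omega> u \<zeta> = 0)"

definition Omega ::
  "nat \<Rightarrow> (3 \<Rightarrow> 'g vfield) \<Rightarrow> 'g pform \<Rightarrow> 'g ppoint \<Rightarrow> ptangent \<Rightarrow> ptangent \<Rightarrow> real" where
  "Omega r E \<omega> u \<zeta> \<eta> = (THE c. \<exists>X Y. \<exists>U\<in>H_lie r. \<exists>V\<in>H_lie r.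
     \<zeta> = horiz r E \<omega> X u + fundamental U u \<and> \<eta> = horiz r E \<omega> Y u + fundamental V u
     \<and> c = inner_m r X (inv (l_g r) V) - inner_m r (inv (l_g r) U) Y)"

definition lagrangian_section ::
  "nat \<Rightarrow> 'g charts \<Rightarrow> (3 \<Rightarrow> 'g vfield) \<Rightarrow> 'g pform \<Rightarrow> ('g \<Rightarrow> 'g ppoint) \<Rightarrow> bool" where
  "lagrangian_section r C E \<omega> s \<longleftrightarrow>
     smooth_section r C s \<and> (\<forall>p V W. Omega r E \<omega> (s p) (push C s p V) (push C s p W) = 0)"

definition equivariant_section ::
  "nat \<Rightarrow> 'g charts \<Rightarrow> ('g \<Rightarrow> 'g \<Rightarrow> 'g) \<Rightarrow> ('g \<Rightarrow> 'g ppoint) \<Rightarrow> bool" where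
  "equivariant_section r C mul s \<longleftrightarrow>
     smooth_section r C s \<and> (\<forall>a q. P_left mul a (s q) = s (mul a q))"

section \<open>Spinors\<close>

text \<open>\<open>assoc r u v\<close> is the element \<open>[u, v]\<close> of the associated bundle \<open>\<Sigma>G = P \<times>\<^sub>H \<complex>\<^sup>2\<close>, as an
  equivalence class.\<close>

type_synonym 'g spinor = "('g ppoint \<times> (complex^2)) set"

definition assoc :: "nat \<Rightarrow> 'g ppoint \<Rightarrow> complex^2 \<Rightarrow> 'g spinor" where
  "assoc r u v = {(P_right u k, matrix_inv k *v v) | k. k \<in> H_grp r}"

definition spinor_field :: "nat \<Rightarrow> 'g charts \<Rightarrow> ('g \<Rightarrow> 'g spinor) \<Rightarrow> bool" where
  "spinor_field r C \<psi> \<longleftrightarrow>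
     (\<exists>s v. smooth_section r C s \<and> smooth_fun C UNIV v \<and> (\<forall>q. \<psi> q = assoc r (s q) (v q)))"

definition invariant_spinor ::
  "nat \<Rightarrow> 'g charts \<Rightarrow> ('g \<Rightarrow> 'g \<Rightarrow> 'g) \<Rightarrow> ('g \<Rightarrow> 'g spinor) \<Rightarrow> bool" where
  "invariant_spinor r C mul \<psi> \<longleftrightarrow>
     spinor_field r C \<psi> \<and> (\<forall>a q. \<psi> (mul a q) = (\<lambda>(u, v). (P_left mul a u, v)) ` \<psi> q)"

definition herm :: "nat \<Rightarrow> complex^2 \<Rightarrow> complex^2 \<Rightarrow> complex" where
  "herm r v w = (\<Sum>i\<in>UNIV. cnj (v$i) * (gamma0_pow r *v w)$i)"

definition spinor_inner :: "nat \<Rightarrow> 'g spinor \<Rightarrow> 'g spinor \<Rightarrow> complex" where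
  "spinor_inner r x y =
     (THE c. \<exists>u\<in>P_set r. \<exists>v w. x = assoc r u v \<and> y = assoc r u w \<and> c = herm r v w)"

definition spinor_scale :: "complex \<Rightarrow> 'g spinor \<Rightarrow> 'g spinor" where
  "spinor_scale c x = (\<lambda>(u, v). (u, c *s v)) ` x"

definition clifford :: "nat \<Rightarrow> (3 \<Rightarrow> 'g vfield) \<Rightarrow> real^3 \<Rightarrow> 'g spinor \<Rightarrow> 'g spinor" where
  "clifford r E V x = (THE y. \<exists>u\<in>P_set r. \<exists>X v.
     V = frm r E u X \<and> x = assoc r u v \<and> y = assoc r u (gam r X *v v))"

text \<open>The covariant derivative of \<open>\<psi>\<close> at \<open>p\<close> in the direction \<open>V\<close>.\<close>

definition spinor_nabla ::
  "nat \<Rightarrow> 'g charts \<Rightarrow> 'g pform \<Rightarrow> ('g \<Rightarrow> 'g spinor) \<Rightarrow> 'g \<Rightarrow> real^3 \<Rightarrow> 'g spinor" where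
  "spinor_nabla r C \<omega> \<psi> p V = (THE y. \<exists>s v.
     smooth_section r C s \<and> smooth_fun C UNIV v \<and> (\<forall>q. \<psi> q = assoc r (s q) (v q))
     \<and> y = assoc r (s p) (fder C v p V + \<omega> (s p) (push C s p V) *v v p))"

definition eps_set :: "nat \<Rightarrow> real set" where
  "eps_set r = (if r = 0 then {1} else {1, -1})"

definition eps_unit :: "nat \<Rightarrow> real \<Rightarrow> ('g \<Rightarrow> 'g spinor) \<Rightarrow> bool" where
  "eps_unit r \<epsilon> \<psi> \<longleftrightarrow> (\<forall>q. spinor_inner r (\<psi> q) (\<psi> q) = complex_of_real \<epsilon>)"

text \<open>\<open>\<psi>\<close> is an \<open>\<epsilon>\<close>-unit generalized Killing spinor with associated symmetric endomorphism \<open>A\<close>.\<close>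

definition gen_killing_with ::
  "nat \<Rightarrow> 'g charts \<Rightarrow> ('g \<Rightarrow> real^3 \<Rightarrow> real^3 \<Rightarrow> real) \<Rightarrow> (3 \<Rightarrow> 'g vfield) \<Rightarrow> 'g pform
   \<Rightarrow> real \<Rightarrow> ('g \<Rightarrow> 'g spinor) \<Rightarrow> ('g \<Rightarrow> real^3 \<Rightarrow> real^3) \<Rightarrow> bool" where
  "gen_killing_with r C g E \<omega> \<epsilon> \<psi> A \<longleftrightarrow>
     spinor_field r C \<psi> \<and> eps_unit r \<epsilon> \<psi> \<and> tensor_field C A
     \<and> (\<forall>p V. spinor_nabla r C \<omega> \<psi> p V = spinor_scale (\<i>^r) (clifford r E (A p V) (\<psi> p)))
     \<and> (\<forall>p V W. g p (A p V) W = g p V (A p W))"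

definition gen_killing ::
  "nat \<Rightarrow> 'g charts \<Rightarrow> ('g \<Rightarrow> real^3 \<Rightarrow> real^3 \<Rightarrow> real) \<Rightarrow> (3 \<Rightarrow> 'g vfield) \<Rightarrow> 'g pform
   \<Rightarrow> real \<Rightarrow> ('g \<Rightarrow> 'g spinor) \<Rightarrow> bool" where
  "gen_killing r C g E \<omega> \<epsilon> \<psi> \<longleftrightarrow> (\<exists>A. gen_killing_with r C g E \<omega> \<epsilon> \<psi> A)"

end

theory Submission
  imports Defs
begin

text \<open>
  In the trivialisation of \<open>P\<close> given by the invariant frame the Levi-Civita connection form is
  \<open>l_g \<circ> \<beta>\<close> for a field \<open>\<beta>\<close> of endomorphisms.  Equivariant sections and invariant spinors are constant
  in this trivialisation; hence \<open>\<sigma>\<^sup>*\<Omega>(V, V') = \<langle>V, \<beta> V'\<rangle> - \<langle>\<beta> V, V'\<rangle>\<close> for every equivariant \<open>\<sigma>\<close>, and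
  every invariant \<open>\<epsilon>\<close>-unit spinor has \<open>A = \<beta> / 2\<close>, so that all conditions on sections and spinors say
  that \<open>\<beta>\<close> is symmetric.  Since the torsion vanishes, \<open>[E\<^sub>i, E\<^sub>k] = \<beta> E\<^sub>i \<times> E\<^sub>k - \<beta> E\<^sub>k \<times> E\<^sub>i\<close>, and the
  symmetry of \<open>\<beta>\<close> amounts to the vanishing of the traces of all \<open>ad E\<^sub>i\<close>.

  The density \<open>1 / \<bar>det E\<bar>\<close> in charts defines a left Haar measure, which right translation by \<open>a\<close>
  multiplies by \<open>\<bar>\<Delta>(a)\<bar>\<close>, where \<open>\<Delta>(a)\<close> is the determinant of the adjoint action of the inverse of \<open>a\<close>.
  The homomorphism \<open>\<Delta>\<close> has derivative \<open>- tr ad\<close>, so on a connected group it is trivial precisely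
  if all traces vanish; and a bi-invariant Haar measure forces \<open>\<bar>\<Delta>\<bar> = 1\<close> by the uniqueness of Haar
  measure.
\<close>

section \<open>Derivatives of order k and mixed derivatives\<close>

text \<open>The argument is pointwise: \<open>beta p\<close> is compared with the traces at the same
  \<open>p\<close>, and the traces at every \<open>p\<close> are tied to one object, the derivative
  of \<open>Delta\<close> at \<open>e\<close>. That is why the group law is differentiated near an
  arbitrary pair \<open>(p, e)\<close>. An antisymmetric endomorphism in dimension three has three
  independent entries, as many as there are traces of ad E_i; for the antisymmetric part of \<beta>
  the two triples agree up to sign.

  Unimodularity is a statement about measures, so the way from it to the Lie algebra leads through a
  concrete Haar measure.

  Most bundle notions are definite descriptions, evaluated by producing a solution and proving it
  unique. The evaluations show that the variable \<open>h\<close> of \<open>H\<close> cancels: in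
  \<open>Omega\<close> because \<open>lam r h\<close> is an isometry, in the spinor derivative
  because the derivative of the inverse of \<open>h\<close> cancels the Maurer-Cartan term. This is
  why "some" and "every" coincide. The factor in A = \<beta> / 2 comes from \<open>l_g\<close>,
  which is half of the operator in the Killing equation.\<close>

lemma frechet_derivative_cong_open:
  assumes "open S" "x \<in> S" "\<And>y. y \<in> S \<Longrightarrow> f y = g y"
  shows "frechet_derivative f (at x) = frechet_derivative g (at x)"
proof -
  \<comment> \<open>\<open>frechet_derivative\<close> is a choice among the derivatives, so it
    suffices that both functions have the same ones, even where there are none.\<close>
  have "(f has_derivative D) (at x) \<longleftrightarrow> (g has_derivative D) (at x)" for D
    using assms by (metis has_derivative_transform_within_open)
  then show ?thesis
    unfolding frechet_derivative_def by simp
qed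

lemma differentiable_cong_open:
  assumes "open S" "x \<in> S" "\<And>y. y \<in> S \<Longrightarrow> f y = g y" "f differentiable (at x)"
  shows "g differentiable (at x)"
  using assms unfolding differentiable_def by (metis has_derivative_transform_within_open)

section \<open>Closure properties of \<open>Ck_on\<close>\<close>

lemma Ck_on_subset: "Ck_on k S f \<Longrightarrow> T \<subseteq> S \<Longrightarrow> Ck_on k T f"
  by (induction k arbitrary: f) (auto intro: continuous_on_subset)

lemma Ck_on_cong:
  assumes "open S" "\<And>x. x \<in> S \<Longrightarrow> f x = g x" "Ck_on k S f"
  shows "Ck_on k S g"
  using assms(2,3)
proof (induction k arbitrary: f g)
  case 0
  then show ?case by (simp cong: continuous_on_cong)
next
  case (Suc k)
  have "Ck_on k S (\<lambda>x. frechet_derivative g (at x) v)" for v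
    using Suc.IH[of "\<lambda>x. frechet_derivative f (at x) v" "\<lambda>x. frechet_derivative g (at x) v"]
      Suc.prems frechet_derivative_cong_open[OF assms(1), of _ f g] by auto
  then show ?case
    using Suc.prems differentiable_cong_open[OF assms(1), of _ f g] by auto
qed

lemma Ck_on_SucD: "Ck_on (Suc k) S f \<Longrightarrow> Ck_on k S f"
proof (induction k arbitrary: f)
  case 0
  then show ?case
    by (auto intro!: continuous_at_imp_continuous_on differentiable_imp_continuous_within)
next
  case (Suc k)
  then show ?case by (metis Ck_on.simps(2))
qed

lemma Ck_on_const: "Ck_on k S (\<lambda>x. c)"
  by (induction k arbitrary: c) auto

lemma Ck_on_add:
  assumes "open S"
  shows "Ck_on k S f \<Longrightarrow> Ck_on k S g \<Longrightarrow> Ck_on k S (\<lambda>x. f x + g x)"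
proof (induction k arbitrary: f g)
  case 0
  then show ?case by (auto intro: continuous_intros)
next
  case (Suc k)
  have "Ck_on k S (\<lambda>x. frechet_derivative (\<lambda>x. f x + g x) (at x) v)" for v
  proof (rule Ck_on_cong[OF assms])
    show "Ck_on k S (\<lambda>x. frechet_derivative f (at x) v + frechet_derivative g (at x) v)"
      using Suc by auto
    show "frechet_derivative f (at x) v + frechet_derivative g (at x) v
        = frechet_derivative (\<lambda>x. f x + g x) (at x) v" if "x \<in> S" for x
      using Suc.prems that frechet_derivative_at[OF has_derivative_add[of f "frechet_derivative f (at x)"
          "at x" g "frechet_derivative g (at x)"]]
      by (auto simp: frechet_derivative_works dest!: fun_cong[of _ _ v])
  qed
  then show ?case using Suc.prems by auto
qed

lemma Ck_on_bounded_linear: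
  assumes "open S" "bounded_linear L"
  shows "Ck_on k S f \<Longrightarrow> Ck_on k S (\<lambda>x. L (f x))"
proof (induction k arbitrary: f)
  case 0
  then show ?case using bounded_linear.continuous_on[OF assms(2)] by auto
next
  case (Suc k)
  have D: "((\<lambda>x. L (f x)) has_derivative (\<lambda>v. L (frechet_derivative f (at x) v))) (at x)"
    if "x \<in> S" for x
    using Suc.prems that
    by (auto intro!: bounded_linear.has_derivative[OF assms(2)] simp: frechet_derivative_works)
  have "Ck_on k S (\<lambda>x. frechet_derivative (\<lambda>x. L (f x)) (at x) v)" for v
  proof (rule Ck_on_cong[OF assms(1)])
    show "Ck_on k S (\<lambda>x. L (frechet_derivative f (at x) v))"
      using Suc by auto
    show "L (frechet_derivative f (at x) v) = frechet_derivative (\<lambda>x. L (f x)) (at x) v"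
      if "x \<in> S" for x
      using frechet_derivative_at[OF D[OF that]] by metis
  qed
  then show ?case using D by (auto simp: differentiable_def)
qed

lemma Ck_on_scaleR:
  fixes f :: "'a::real_normed_vector \<Rightarrow> real"
  assumes "open S"
  shows "Ck_on k S f \<Longrightarrow> Ck_on k S g \<Longrightarrow> Ck_on k S (\<lambda>x. f x *\<^sub>R g x)"
proof (induction k arbitrary: f g)
  case 0
  then show ?case by (auto intro: continuous_intros)
next
  case (Suc k)
  have D: "((\<lambda>x. f x *\<^sub>R g x) has_derivative
      (\<lambda>v. f x *\<^sub>R frechet_derivative g (at x) v + frechet_derivative f (at x) v *\<^sub>R g x)) (at x)"
    if "x \<in> S" for x
    using Suc.prems that
    by (auto intro!: has_derivative_scaleR simp: frechet_derivative_works)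
  have "Ck_on k S (\<lambda>x. frechet_derivative (\<lambda>x. f x *\<^sub>R g x) (at x) v)" for v
  proof (rule Ck_on_cong[OF assms(1)])
    show "Ck_on k S (\<lambda>x. f x *\<^sub>R frechet_derivative g (at x) v
        + frechet_derivative f (at x) v *\<^sub>R g x)"
      \<comment> \<open>Each summand of the product rule keeps one factor undifferentiated, which
        the induction hypothesis takes at order \<open>k\<close>.\<close>
      using Suc Ck_on_SucD[OF Suc.prems(1)] Ck_on_SucD[OF Suc.prems(2)]
      by (auto intro!: Ck_on_add[OF assms(1)])
    show "f x *\<^sub>R frechet_derivative g (at x) v + frechet_derivative f (at x) v *\<^sub>R g x
        = frechet_derivative (\<lambda>x. f x *\<^sub>R g x) (at x) v"
      if "x \<in> S" for x
      using frechet_derivative_at[OF D[OF that]] by metis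
  qed
  then show ?case using D by (auto simp: differentiable_def)
qed

lemma smooth_on_const: "smooth_on S (\<lambda>x. c)"
  by (simp add: smooth_on_def Ck_on_const)

lemma smooth_on_differentiable: "smooth_on S f \<Longrightarrow> x \<in> S \<Longrightarrow> f differentiable (at x)"
  unfolding smooth_on_def by (metis Ck_on.simps(2))

lemma smooth_on_continuous: "smooth_on S f \<Longrightarrow> continuous_on S f"
  unfolding smooth_on_def by (metis Ck_on.simps(1))

lemma smooth_on_derivative: "smooth_on S f \<Longrightarrow> smooth_on S (\<lambda>x. frechet_derivative f (at x) v)"
  unfolding smooth_on_def by (metis Ck_on.simps(2))

text \<open>The second difference over the parallelogram spanned by \<open>h *\<^sub>R v\<close> and
  \<open>h *\<^sub>R w\<close> is the increment in \<open>s\<close> of an increment in direction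
  \<open>w\<close>; the mean value theorem in \<open>s\<close> and then in \<open>t\<close> turns it
  into one value of the mixed derivative.\<close>

lemma second_difference_mean_value:
  fixes f :: "'a::real_normed_vector \<Rightarrow> real"
  assumes h: "0 < h"
    and S: "\<And>s t. 0 \<le> s \<Longrightarrow> s \<le> h \<Longrightarrow> 0 \<le> t \<Longrightarrow> t \<le> h \<Longrightarrow> a + s *\<^sub>R v + t *\<^sub>R w \<in> S"
    and f: "\<And>x. x \<in> S \<Longrightarrow> f differentiable (at x)"
    and fv: "\<And>x. x \<in> S \<Longrightarrow> (\<lambda>x. frechet_derivative f (at x) v) differentiable (at x)"
  shows "\<exists>s t. 0 < s \<and> s < h \<and> 0 < t \<and> t < h \<and>
      f (a + h *\<^sub>R v + h *\<^sub>R w) - f (a + h *\<^sub>R v) - f (a + h *\<^sub>R w) + f a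
      = h * h * frechet_derivative (\<lambda>x. frechet_derivative f (at x) v) (at (a + s *\<^sub>R v + t *\<^sub>R w)) w"
proof -
  define fv where "fv = (\<lambda>x. frechet_derivative f (at x) v)"
  have df: "(f has_derivative frechet_derivative f (at x)) (at x)" if "x \<in> S" for x
    using f[OF that] by (simp add: frechet_derivative_works)
  have dfv: "(fv has_derivative frechet_derivative fv (at x)) (at x)" if "x \<in> S" for x
    using fv[OF that] by (simp add: frechet_derivative_works fv_def)
  have 1: "((\<lambda>s. f (a + s *\<^sub>R v + t *\<^sub>R w)) has_real_derivative fv (a + s *\<^sub>R v + t *\<^sub>R w)) (at s)"
    if "0 \<le> s" "s \<le> h" "0 \<le> t" "t \<le> h" for s t
  proof -
    have "((\<lambda>s. f (a + s *\<^sub>R v + t *\<^sub>R w)) has_derivative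
        (\<lambda>r. frechet_derivative f (at (a + s *\<^sub>R v + t *\<^sub>R w)) (r *\<^sub>R v))) (at s)"
      by (rule has_derivative_compose[where g=f and f="\<lambda>s. a + s *\<^sub>R v + t *\<^sub>R w" and f'="\<lambda>r. r *\<^sub>R v" and x=s,
        OF _ df[OF S[OF that]]]) (auto intro!: derivative_eq_intros)
    moreover have "frechet_derivative f (at x) (r *\<^sub>R v) = r * fv x" if "x \<in> S" for x r
      using linear_cmul[OF has_derivative_linear[OF df[OF that]], of r v] by (simp add: fv_def)
    ultimately show ?thesis
      using S[OF that] by (simp add: has_field_derivative_def mult_commute_abs)
  qed
  have 2: "((\<lambda>t. fv (a + s *\<^sub>R v + t *\<^sub>R w)) has_real_derivative
      frechet_derivative fv (at (a + s *\<^sub>R v + t *\<^sub>R w)) w) (at t)"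
    if "0 \<le> s" "s \<le> h" "0 \<le> t" "t \<le> h" for s t
  proof -
    have "((\<lambda>t. fv (a + s *\<^sub>R v + t *\<^sub>R w)) has_derivative
        (\<lambda>r. frechet_derivative fv (at (a + s *\<^sub>R v + t *\<^sub>R w)) (r *\<^sub>R w))) (at t)"
      by (rule has_derivative_compose[where g=fv and f="\<lambda>t. a + s *\<^sub>R v + t *\<^sub>R w" and f'="\<lambda>r. r *\<^sub>R w" and x=t,
        OF _ dfv[OF S[OF that]]]) (auto intro!: derivative_eq_intros)
    moreover have "frechet_derivative fv (at x) (r *\<^sub>R w) = r * frechet_derivative fv (at x) w"
      if "x \<in> S" for x r
      using linear_cmul[OF has_derivative_linear[OF dfv[OF that]], of r w] by simp
    ultimately show ?thesis
      using S[OF that] by (simp add: has_field_derivative_def mult_commute_abs)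
  qed
  \<comment> \<open>The term \<open>0 *\<^sub>R w\<close> is kept so that fact \<open>1\<close>
    applies to both terms of the difference.\<close>
  define g where "g = (\<lambda>s. f (a + s *\<^sub>R v + h *\<^sub>R w) - f (a + s *\<^sub>R v + 0 *\<^sub>R w))"
  have "(g has_real_derivative (fv (a + s *\<^sub>R v + h *\<^sub>R w) - fv (a + s *\<^sub>R v + 0 *\<^sub>R w))) (at s)"
    if "0 \<le> s" "s \<le> h" for s
    unfolding g_def by (intro DERIV_diff 1) (use that h in auto)
  from MVT2[OF h this] obtain s where s: "0 < s" "s < h"
    "g h - g 0 = h * (fv (a + s *\<^sub>R v + h *\<^sub>R w) - fv (a + s *\<^sub>R v + 0 *\<^sub>R w))"
    by auto
  from MVT2[OF h 2, of s] s obtain t where t: "0 < t" "t < h"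
    "fv (a + s *\<^sub>R v + h *\<^sub>R w) - fv (a + s *\<^sub>R v + 0 *\<^sub>R w)
      = h * frechet_derivative fv (at (a + s *\<^sub>R v + t *\<^sub>R w)) w"
    by auto
  have "f (a + h *\<^sub>R v + h *\<^sub>R w) - f (a + h *\<^sub>R v) - f (a + h *\<^sub>R w) + f a = g h - g 0"
    by (simp add: g_def)
  then show ?thesis
    using s t unfolding fv_def by (intro exI[of _ s] exI[of _ t]) simp
qed

text \<open>Schwarz's theorem. The second difference is symmetric in \<open>v\<close> and
  \<open>w\<close>, so the two mixed derivatives share a value, taken at possibly different points,
  arbitrarily close to \<open>a\<close>; if they differed at \<open>a\<close>, continuity would
  exclude this.\<close>

lemma mixed_derivatives_commute_real:
  fixes f :: "'a::real_normed_vector \<Rightarrow> real"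
  assumes "open S" "a \<in> S" "Ck_on 2 S f"
  shows "frechet_derivative (\<lambda>x. frechet_derivative f (at x) v) (at a) w
       = frechet_derivative (\<lambda>x. frechet_derivative f (at x) w) (at a) v"
proof (rule ccontr)
  define A where "A = (\<lambda>x. frechet_derivative (\<lambda>x. frechet_derivative f (at x) v) (at x) w)"
  define B where "B = (\<lambda>x. frechet_derivative (\<lambda>x. frechet_derivative f (at x) w) (at x) v)"
  have C: "Ck_on (Suc (Suc 0)) S f" using assms(3) by (simp add: numeral_2_eq_2)
  then have f: "f differentiable (at x)" if "x \<in> S" for x
    using that by auto
  have fv: "(\<lambda>x. frechet_derivative f (at x) u) differentiable (at x)" if "x \<in> S" for x u
    using that C by auto
  have "continuous_on S A" "continuous_on S B"
    using C by (auto simp: A_def B_def)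
  then have cA: "isCont A a" and cB: "isCont B a"
    using assms by (auto simp: continuous_on_eq_continuous_at)
  assume "\<not> ?thesis"
  then have pos: "0 < dist (A a) (B a) / 2" by (simp add: A_def B_def)
  obtain d1 where d1: "d1 > 0" "\<And>x. dist x a < d1 \<Longrightarrow> dist (A x) (A a) < dist (A a) (B a) / 2"
    using cA pos unfolding continuous_at_eps_delta by metis
  obtain d2 where d2: "d2 > 0" "\<And>x. dist x a < d2 \<Longrightarrow> dist (B x) (B a) < dist (A a) (B a) / 2"
    using cB pos unfolding continuous_at_eps_delta by metis
  obtain d3 where d3: "d3 > 0" "ball a d3 \<subseteq> S"
    using assms by (meson open_contains_ball)
  define d where "d = min d1 (min d2 d3)"
  \<comment> \<open>Any parallelogram with sides at most \<open>h\<close> then stays within distance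
    \<open>d\<close> of \<open>a\<close>; the summand 1 keeps the denominator positive when
    \<open>v\<close> and \<open>w\<close> vanish.\<close>
  define h where "h = d / (2 * (norm v + norm w + 1))"
  have d: "d > 0" and h: "h > 0"
    using d1 d2 d3 by (auto simp: d_def h_def add_nonneg_pos)
  have near: "dist (a + s *\<^sub>R v + t *\<^sub>R w) a < d" if "0 \<le> s" "s \<le> h" "0 \<le> t" "t \<le> h" for s t
  proof -
    have "dist (a + s *\<^sub>R v + t *\<^sub>R w) a \<le> norm (s *\<^sub>R v) + norm (t *\<^sub>R w)"
      by (simp add: dist_norm) (metis norm_scaleR norm_triangle_ineq)
    also have "\<dots> \<le> h * norm v + h * norm w"
      using that by (intro add_mono) (auto intro: mult_right_mono)
    also have "\<dots> < h * (2 * (norm v + norm w + 1))"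
      using h by (simp add: algebra_simps add_nonneg_pos)
    also have "\<dots> = d"
    proof -
      have "norm v + norm w + 1 \<noteq> 0" using norm_ge_zero[of v] norm_ge_zero[of w] by linarith
      then show ?thesis by (simp add: h_def)
    qed
    finally show ?thesis .
  qed
  then have inS: "a + s *\<^sub>R v + t *\<^sub>R w \<in> S" if "0 \<le> s" "s \<le> h" "0 \<le> t" "t \<le> h" for s t
    using d3(2) that by (force simp: d_def dist_commute)
  obtain s t where st: "0 < s" "s < h" "0 < t" "t < h"
    "f (a + h *\<^sub>R v + h *\<^sub>R w) - f (a + h *\<^sub>R v) - f (a + h *\<^sub>R w) + f a = h * h * A (a + s *\<^sub>R v + t *\<^sub>R w)"
    using second_difference_mean_value[OF h inS f fv] unfolding A_def by auto
  have inS': "a + s *\<^sub>R w + t *\<^sub>R v \<in> S" if "0 \<le> s" "s \<le> h" "0 \<le> t" "t \<le> h" for s t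
    using inS[of t s] that by (simp add: algebra_simps)
  obtain s' t' where st': "0 < s'" "s' < h" "0 < t'" "t' < h"
    "f (a + h *\<^sub>R w + h *\<^sub>R v) - f (a + h *\<^sub>R w) - f (a + h *\<^sub>R v) + f a = h * h * B (a + s' *\<^sub>R w + t' *\<^sub>R v)"
    using second_difference_mean_value[OF h inS' f fv] unfolding B_def by auto
  have "h * h * A (a + s *\<^sub>R v + t *\<^sub>R w) = h * h * B (a + t' *\<^sub>R v + s' *\<^sub>R w)"
    using st(5) st'(5) by (simp add: algebra_simps)
  then have "A (a + s *\<^sub>R v + t *\<^sub>R w) = B (a + t' *\<^sub>R v + s' *\<^sub>R w)"
    using h by simp
  moreover have "dist (A (a + s *\<^sub>R v + t *\<^sub>R w)) (A a) < dist (A a) (B a) / 2"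
    by (rule d1(2)) (use near[of s t] st in \<open>simp add: d_def\<close>)
  moreover have "dist (B (a + t' *\<^sub>R v + s' *\<^sub>R w)) (B a) < dist (A a) (B a) / 2"
    by (rule d2(2)) (use near[of t' s'] st' in \<open>simp add: d_def\<close>)
  ultimately show False
    using dist_triangle_half_r[of "A (a + s *\<^sub>R v + t *\<^sub>R w)" "A a" "dist (A a) (B a)" "B a"] by simp
qed

lemma mixed_derivatives_commute:
  fixes f :: "'a::real_normed_vector \<Rightarrow> 'b::euclidean_space"
  assumes "open S" "a \<in> S" "Ck_on 2 S f"
  shows "frechet_derivative (\<lambda>x. frechet_derivative f (at x) v) (at a) w
       = frechet_derivative (\<lambda>x. frechet_derivative f (at x) w) (at a) v"
proof (rule euclidean_eqI)
  fix b :: 'b assume "b \<in> Basis"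
  have C: "Ck_on (Suc (Suc 0)) S f" using assms(3) by (simp add: numeral_2_eq_2)
  have bl: "bounded_linear (\<lambda>y::'b. y \<bullet> b)" by (rule bounded_linear_inner_left)
  have fd: "frechet_derivative (\<lambda>x. g x \<bullet> b) (at x) u = frechet_derivative g (at x) u \<bullet> b"
    if "g differentiable (at x)" for g :: "'a \<Rightarrow> 'b" and x u
    using frechet_derivative_at[OF bounded_linear.has_derivative[OF bl, of g "frechet_derivative g (at x)"]]
      that by (metis frechet_derivative_works)
  have 1: "frechet_derivative (\<lambda>x. frechet_derivative f (at x) v') (at a) w' \<bullet> b
     = frechet_derivative (\<lambda>x. frechet_derivative (\<lambda>x. f x \<bullet> b) (at x) v') (at a) w'" for v' w'
  proof -
    have "frechet_derivative (\<lambda>x. frechet_derivative (\<lambda>x. f x \<bullet> b) (at x) v') (at a)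
        = frechet_derivative (\<lambda>x. frechet_derivative f (at x) v' \<bullet> b) (at a)"
      by (rule frechet_derivative_cong_open[OF assms(1,2)]) (use C in \<open>auto simp: fd\<close>)
    moreover have "frechet_derivative (\<lambda>x. frechet_derivative f (at x) v' \<bullet> b) (at a) w'
        = frechet_derivative (\<lambda>x. frechet_derivative f (at x) v') (at a) w' \<bullet> b"
      by (rule fd) (use C assms in auto)
    ultimately show ?thesis by simp
  qed
  have "Ck_on 2 S (\<lambda>x. f x \<bullet> b)"
    by (rule Ck_on_bounded_linear[OF assms(1) bl assms(3)])
  from mixed_derivatives_commute_real[OF assms(1,2) this, of v w] 1
  show "frechet_derivative (\<lambda>x. frechet_derivative f (at x) v) (at a) w \<bullet> b
     = frechet_derivative (\<lambda>x. frechet_derivative f (at x) w) (at a) v \<bullet> b"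
    by simp
qed

section \<open>Charts\<close>

text \<open>Chart maps have arbitrary values off their domains, so composites through different
  charts agree only near a point; derivatives are therefore transferred between germs.\<close>

lemma has_derivative_cong_nhds:
  assumes "eventually (\<lambda>y. f y = g y) (nhds x)" "(f has_derivative D) (at x)"
  shows "(g has_derivative D) (at x)"
  using assms unfolding eventually_nhds by (metis has_derivative_transform_within_open)

locale manifold3 =
  fixes C :: "'g::t2_space charts"
  assumes atlas: "smooth_atlas C"
begin

abbreviation "img p \<equiv> coord C p ` dom_of C p"

lemma in_dom: "p \<in> dom_of C p"
  and open_dom: "open (dom_of C p)"
  and open_img: "open (img p)"
  and homeo: "homeomorphism (dom_of C p) (img p) (coord C p) (pt C p)"
  and transition: "smooth_on (coord C p ` (dom_of C p \<inter> dom_of C q)) (coord C q \<circ> pt C p)"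
  using atlas[unfolded smooth_atlas_def, THEN conjunct1, rule_format, of p]
    atlas[unfolded smooth_atlas_def, THEN conjunct2, rule_format, of p q] by simp_all

lemma pt_coord [simp]: "q \<in> dom_of C p \<Longrightarrow> pt C p (coord C p q) = q"
  and coord_pt [simp]: "y \<in> img p \<Longrightarrow> coord C p (pt C p y) = y"
  and pt_in_dom: "y \<in> img p \<Longrightarrow> pt C p y \<in> dom_of C p"
  and continuous_coord: "continuous_on (dom_of C p) (coord C p)"
  and continuous_pt: "continuous_on (img p) (pt C p)"
  using homeomorphism_apply1[OF homeo] homeomorphism_apply2[OF homeo] homeomorphism_image2[OF homeo]
    homeomorphism_cont1[OF homeo] homeomorphism_cont2[OF homeo] by blast+

lemma pt_coord_self [simp]: "pt C p (coord C p p) = p"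
  by (simp add: in_dom)

lemma coord_self_in_img: "coord C p p \<in> img p"
  by (simp add: in_dom)

lemma open_coord_image: "open W \<Longrightarrow> open (coord C p ` (W \<inter> dom_of C p))"
proof -
  assume W: "open W"
  have "coord C p ` (W \<inter> dom_of C p) = img p \<inter> pt C p -` W"
    by (force simp: pt_in_dom)
  also have "open \<dots>"
    by (rule continuous_open_preimage[OF continuous_pt open_img W])
  finally show ?thesis .
qed

lemma isCont_pt: "y \<in> img p \<Longrightarrow> isCont (pt C p) y"
  using continuous_on_eq_continuous_at[OF open_img] continuous_pt by blast

lemma isCont_coord: "q \<in> dom_of C p \<Longrightarrow> isCont (coord C p) q"
  using continuous_on_eq_continuous_at[OF open_dom] continuous_coord by blast

lemma transition_differentiable:
  assumes "q \<in> dom_of C p" "q \<in> dom_of C p'"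
  shows "(coord C p' \<circ> pt C p) differentiable (at (coord C p q))"
  using smooth_on_differentiable[OF transition] assms by blast

lemma eventually_pt_in:
  assumes "y \<in> img p" "pt C p y \<in> W" "open W"
  shows "eventually (\<lambda>y. y \<in> img p \<and> pt C p y \<in> W) (nhds y)"
  using topological_tendstoD[OF isCont_pt[OF assms(1), unfolded isCont_def] assms(3,2)] assms
    eventually_nhds_in_open[OF open_img assms(1)]
  by (auto simp: eventually_at_filter elim: eventually_elim2)

lemma fder_eqI: "((f \<circ> pt C q) has_derivative D) (at (coord C q q)) \<Longrightarrow> fder C f q V = D V"
  by (simp add: fder_def frechet_derivative_at[symmetric])

lemma mder_eqI:
  "((coord C (f q) \<circ> f \<circ> pt C q) has_derivative D) (at (coord C q q)) \<Longrightarrow> mder C f q V = D V"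
  by (simp add: mder_def frechet_derivative_at[symmetric])

lemma transition_has_derivative:
  assumes "q \<in> dom_of C p"
  shows "((coord C p \<circ> pt C q) has_derivative fder C (coord C p) q) (at (coord C q q))"
  using transition_differentiable[OF in_dom assms]
  by (simp add: fder_def[abs_def] frechet_derivative_works)

lemma fder_coord_self [simp]: "fder C (coord C p) p V = V"
proof -
  have "frechet_derivative (coord C p \<circ> pt C p) (at (coord C p p)) = frechet_derivative (\<lambda>y. y) (at (coord C p p))"
    by (rule frechet_derivative_cong_open[OF open_img coord_self_in_img]) simp
  also have "\<dots> = (\<lambda>y. y)" by simp
  finally show ?thesis by (simp add: fder_def)
qed

text \<open>The tangent space at \<open>q\<close> is read in the chart with index \<open>q\<close>.
  A derivative found in another chart \<open>p\<close> has to be precomposed with the differential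
  of the transition, which is \<open>fder C (coord C p) q\<close>.\<close>

lemma chart_change:
  assumes "q \<in> dom_of C p" "((f \<circ> pt C p) has_derivative D) (at (coord C p q))"
  shows "((f \<circ> pt C q) has_derivative (\<lambda>V. D (fder C (coord C p) q V))) (at (coord C q q))"
proof -
  have "((f \<circ> pt C p) \<circ> (coord C p \<circ> pt C q) has_derivative D \<circ> fder C (coord C p) q) (at (coord C q q))"
    by (rule diff_chain_at[OF transition_has_derivative[OF assms(1)]]) (use assms in simp)
  moreover have "eventually (\<lambda>y. ((f \<circ> pt C p) \<circ> (coord C p \<circ> pt C q)) y = (f \<circ> pt C q) y) (nhds (coord C q q))"
    using eventually_pt_in[OF coord_self_in_img, of q "dom_of C p"] assms(1) open_dom
    by (auto elim!: eventually_mono)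
  ultimately have "(f \<circ> pt C q has_derivative D \<circ> fder C (coord C p) q) (at (coord C q q))"
    by (rule has_derivative_cong_nhds[rotated])
  then show ?thesis by (simp add: o_def)
qed

lemma fder_chart:
  assumes "q \<in> dom_of C p" "((f \<circ> pt C p) has_derivative D) (at (coord C p q))"
  shows "fder C f q V = D (fder C (coord C p) q V)"
  by (rule fder_eqI[OF chart_change[OF assms]])

lemma linear_fder_coord: "q \<in> dom_of C p \<Longrightarrow> linear (fder C (coord C p) q)"
  using transition_has_derivative has_derivative_linear by blast

text \<open>The differential of the opposite transition is a left inverse, because
  \<open>coord C q\<close> has the identity as its differential at \<open>q\<close>.\<close>

lemma inj_fder_coord:
  assumes "q \<in> dom_of C p"
  shows "inj (fder C (coord C p) q)"
proof -
  obtain D where "((coord C q \<circ> pt C p) has_derivative D) (at (coord C p q))"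
    using transition_differentiable[OF assms in_dom] by (auto simp: differentiable_def)
  from fder_chart[OF assms this] have "D (fder C (coord C p) q V) = V" for V
    by simp
  then show ?thesis by (metis injI)
qed

text \<open>Continuity is part of the notion because \<open>coord C (f q)\<close> is arbitrary off
  its domain: only for points that \<open>f\<close> keeps in that domain does the chart expression
  describe \<open>f\<close>.\<close>

definition mdiff :: "('g \<Rightarrow> 'g) \<Rightarrow> 'g \<Rightarrow> bool" where
  "mdiff f q \<longleftrightarrow> isCont f q \<and> (coord C (f q) \<circ> f \<circ> pt C q) differentiable (at (coord C q q))"

lemma mdiff_has_derivative:
  "mdiff f q \<Longrightarrow> ((coord C (f q) \<circ> f \<circ> pt C q) has_derivative mder C f q) (at (coord C q q))"
  by (simp add: mdiff_def mder_def[abs_def] frechet_derivative_works)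

lemma linear_mder: "mdiff f q \<Longrightarrow> linear (mder C f q)"
  using mdiff_has_derivative has_derivative_linear by blast

lemma eventually_map_pt_in:
  assumes "isCont f q" "f q \<in> W" "open W" "q \<in> dom_of C p"
  shows "eventually (\<lambda>y. f (pt C p y) \<in> W) (nhds (coord C p q))"
proof -
  have "isCont (\<lambda>y. f (pt C p y)) (coord C p q)"
    using isCont_o2[OF isCont_pt[of "coord C p q" p]] assms by simp
  from topological_tendstoD[OF this[unfolded isCont_def] assms(3)] assms
  show ?thesis by (simp add: eventually_at_filter) (auto elim: eventually_mono)
qed

text \<open>Smoothness of the group law yields derivatives in arbitrary charts, while
  \<open>mder\<close> uses the charts with index \<open>q\<close> and \<open>f q\<close>; the
  differentials of the coordinate maps intertwine the two readings.\<close>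

lemma mder_chart:
  assumes q: "q \<in> dom_of C p" and fq: "f q \<in> dom_of C p'" and f: "isCont f q"
    and D: "((coord C p' \<circ> f \<circ> pt C p) has_derivative D) (at (coord C p q))"
  shows "mdiff f q" "fder C (coord C p') (f q) (mder C f q V) = D (fder C (coord C p) q V)"
proof -
  obtain T where T: "((coord C (f q) \<circ> pt C p') has_derivative T) (at (coord C p' (f q)))"
    using transition_differentiable[OF fq in_dom] by (auto simp: differentiable_def)
  have "((coord C (f q) \<circ> pt C p') \<circ> (coord C p' \<circ> f \<circ> pt C p) has_derivative T \<circ> D) (at (coord C p q))"
    by (rule diff_chain_at[OF D]) (use T q in simp)
  moreover have "eventually (\<lambda>y. ((coord C (f q) \<circ> pt C p') \<circ> (coord C p' \<circ> f \<circ> pt C p)) y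
      = ((coord C (f q) \<circ> f) \<circ> pt C p) y) (nhds (coord C p q))"
    using eventually_map_pt_in[OF f fq open_dom q] by (auto elim!: eventually_mono)
  ultimately have "((coord C (f q) \<circ> f) \<circ> pt C p has_derivative T \<circ> D) (at (coord C p q))"
    by (rule has_derivative_cong_nhds[rotated])
  from chart_change[OF q this] show md: "mdiff f q"
    using f by (auto simp: mdiff_def differentiable_def)
  have D': "((coord C p' \<circ> f) \<circ> pt C q has_derivative (\<lambda>V. D (fder C (coord C p) q V))) (at (coord C q q))"
    by (rule chart_change[OF q D])
  have "((coord C p' \<circ> pt C (f q)) \<circ> (coord C (f q) \<circ> f \<circ> pt C q) has_derivative
      fder C (coord C p') (f q) \<circ> mder C f q) (at (coord C q q))"
    by (rule diff_chain_at[OF mdiff_has_derivative[OF md]])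
      (use transition_has_derivative[OF fq] in simp)
  moreover have "eventually (\<lambda>y. ((coord C p' \<circ> pt C (f q)) \<circ> (coord C (f q) \<circ> f \<circ> pt C q)) y
      = ((coord C p' \<circ> f) \<circ> pt C q) y) (nhds (coord C q q))"
    using eventually_map_pt_in[OF f in_dom open_dom in_dom] by (auto elim!: eventually_mono)
  ultimately have "((coord C p' \<circ> f) \<circ> pt C q has_derivative
      fder C (coord C p') (f q) \<circ> mder C f q) (at (coord C q q))"
    by (rule has_derivative_cong_nhds[rotated])
  from has_derivative_unique[OF this D']
  show "fder C (coord C p') (f q) (mder C f q V) = D (fder C (coord C p) q V)"
    by (metis comp_apply)
qed

lemma mder_comp:
  fixes f h :: "'g \<Rightarrow> 'g" and q :: 'g
  assumes h: "mdiff h q" and f: "mdiff f (h q)"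
  shows "mdiff (\<lambda>x. f (h x)) q"
    and "mder C (\<lambda>x. f (h x)) q V = mder C f (h q) (mder C h q V)"
proof -
  have "((coord C (f (h q)) \<circ> f \<circ> pt C (h q)) \<circ> (coord C (h q) \<circ> h \<circ> pt C q) has_derivative
      mder C f (h q) \<circ> mder C h q) (at (coord C q q))"
    by (rule diff_chain_at[OF mdiff_has_derivative[OF h]]) (use mdiff_has_derivative[OF f] in simp)
  moreover have "eventually (\<lambda>y. ((coord C (f (h q)) \<circ> f \<circ> pt C (h q)) \<circ> (coord C (h q) \<circ> h \<circ> pt C q)) y
      = (coord C (f (h q)) \<circ> (\<lambda>x. f (h x)) \<circ> pt C q) y) (nhds (coord C q q))"
    using eventually_map_pt_in[where f=h and q=q, OF _ in_dom open_dom in_dom] h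
    by (auto elim!: eventually_mono simp: mdiff_def)
  ultimately have D: "(coord C (f (h q)) \<circ> (\<lambda>x. f (h x)) \<circ> pt C q has_derivative
      mder C f (h q) \<circ> mder C h q) (at (coord C q q))"
    by (rule has_derivative_cong_nhds[rotated])
  have "isCont (\<lambda>x. f (h x)) q"
    using h f by (auto simp: mdiff_def intro: isCont_o2)
  then show "mdiff (\<lambda>x. f (h x)) q"
    using D by (auto simp: mdiff_def differentiable_def)
  show "mder C (\<lambda>x. f (h x)) q V = mder C f (h q) (mder C h q V)"
    using mder_eqI[where f="\<lambda>x. f (h x)", OF D] by simp
qed

lemma mder_id [simp]: "mder C (\<lambda>x. x) q V = V"
  using fder_coord_self[of q V] by (simp add: mder_def fder_def o_def)

section \<open>Smooth functions and vector fields\<close>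

lemma smooth_fun_const: "smooth_fun C W (\<lambda>q. c)"
  by (simp add: smooth_fun_def o_def smooth_on_const)

lemma smooth_fun_subset: "smooth_fun C W f \<Longrightarrow> W' \<subseteq> W \<Longrightarrow> smooth_fun C W' f"
  unfolding smooth_fun_def smooth_on_def by (blast intro: Ck_on_subset)

lemma smooth_fun_add:
  "open W \<Longrightarrow> smooth_fun C W f \<Longrightarrow> smooth_fun C W h \<Longrightarrow> smooth_fun C W (\<lambda>q. f q + h q)"
  unfolding smooth_fun_def smooth_on_def o_def by (intro allI Ck_on_add open_coord_image) auto

lemma smooth_fun_scaleR:
  "open W \<Longrightarrow> smooth_fun C W f \<Longrightarrow> smooth_fun C W h \<Longrightarrow> smooth_fun C W (\<lambda>q. f q *\<^sub>R h q)"
  unfolding smooth_fun_def smooth_on_def o_def by (intro allI Ck_on_scaleR open_coord_image) auto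

lemma smooth_fun_sum:
  assumes "open W" "finite I" "\<And>i. i \<in> I \<Longrightarrow> smooth_fun C W (f i)"
  shows "smooth_fun C W (\<lambda>q. \<Sum>i\<in>I. f i q)"
  using assms(2,3) by (induction I rule: finite_induct) (auto intro: smooth_fun_const smooth_fun_add assms(1))

lemma smooth_fun_bounded_linear:
  "open W \<Longrightarrow> bounded_linear L \<Longrightarrow> smooth_fun C W f \<Longrightarrow> smooth_fun C W (\<lambda>q. L (f q))"
  unfolding smooth_fun_def smooth_on_def o_def by (intro allI Ck_on_bounded_linear[of _ L] open_coord_image) auto

lemma smooth_fun_cong:
  assumes "open W" "\<And>q. q \<in> W \<Longrightarrow> f q = h q" "smooth_fun C W f"
  shows "smooth_fun C W h"
  unfolding smooth_fun_def smooth_on_def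
proof (intro allI)
  fix p k
  show "Ck_on k (coord C p ` (W \<inter> dom_of C p)) (h \<circ> pt C p)"
    by (rule Ck_on_cong[OF open_coord_image[OF assms(1)], of p "f \<circ> pt C p"])
      (use assms in \<open>auto simp: smooth_fun_def smooth_on_def\<close>)
qed

lemma smooth_fun_has_derivative:
  assumes "smooth_fun C W f" "q \<in> W" "q \<in> dom_of C p"
  shows "((f \<circ> pt C p) has_derivative frechet_derivative (f \<circ> pt C p) (at (coord C p q))) (at (coord C p q))"
  using smooth_on_differentiable[of _ "f \<circ> pt C p"] assms
  by (auto simp: smooth_fun_def simp flip: frechet_derivative_works)

lemma smooth_fun_fder:
  "smooth_fun C W f \<Longrightarrow> q \<in> W \<Longrightarrow> ((f \<circ> pt C q) has_derivative fder C f q) (at (coord C q q))"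
  using smooth_fun_has_derivative[OF _ _ in_dom] by (simp add: fder_def[abs_def])

lemma smooth_fun_coord: "smooth_fun C (dom_of C p) (coord C p)"
  using transition by (simp add: smooth_fun_def Int_commute)

lemma smooth_vf_scaleR:
  assumes "smooth_fun C UNIV f" "smooth_vf C X"
  shows "smooth_vf C (\<lambda>q. f q *\<^sub>R X q)"
  unfolding smooth_vf_def
proof
  fix p
  have "smooth_fun C (dom_of C p) (\<lambda>q. f q *\<^sub>R fder C (coord C p) q (X q))"
    using assms by (intro smooth_fun_scaleR open_dom) (auto simp: smooth_vf_def intro: smooth_fun_subset)
  then show "smooth_fun C (dom_of C p) (\<lambda>q. fder C (coord C p) q (f q *\<^sub>R X q))"
    by (rule smooth_fun_cong[OF open_dom, rotated]) (simp add: linear_cmul[OF linear_fder_coord])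
qed

lemma smooth_vf_sum:
  assumes "finite I" "\<And>i. i \<in> I \<Longrightarrow> smooth_vf C (X i)"
  shows "smooth_vf C (\<lambda>q. \<Sum>i\<in>I. X i q)"
  unfolding smooth_vf_def
proof
  fix p
  have "smooth_fun C (dom_of C p) (\<lambda>q. \<Sum>i\<in>I. fder C (coord C p) q (X i q))"
    using assms by (intro smooth_fun_sum open_dom) (auto simp: smooth_vf_def)
  then show "smooth_fun C (dom_of C p) (\<lambda>q. fder C (coord C p) q (\<Sum>i\<in>I. X i q))"
    by (rule smooth_fun_cong[OF open_dom, rotated]) (simp add: linear_sum[OF linear_fder_coord])
qed

text \<open>Testing the bracket on the coordinate functions of the chart with index
  \<open>p\<close>, which are smooth on its domain, gives the classical coordinate formula.\<close>

lemma is_lie_bracket_coord: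
  assumes Z: "is_lie_bracket C X Y Z" and X: "smooth_vf C X" and Y: "smooth_vf C Y"
  shows "Z p = fder C (\<lambda>q. fder C (coord C p) q (Y q)) p (X p)
             - fder C (\<lambda>q. fder C (coord C p) q (X q)) p (Y p)"
proof -
  have comp: "fder C (\<lambda>q. h q $ j) q V = fder C h q V $ j"
    if "smooth_fun C W h" "q \<in> W" for h :: "'g \<Rightarrow> real^3" and W j q V
  proof -
    have "((\<lambda>y. (h \<circ> pt C q) y $ j) has_derivative (\<lambda>V. fder C h q V $ j)) (at (coord C q q))"
      using smooth_fun_fder[OF that]
      by (rule bounded_linear.has_derivative[OF bounded_linear_vec_nth])
    then have "((\<lambda>q. h q $ j) \<circ> pt C q has_derivative (\<lambda>V. fder C h q V $ j)) (at (coord C q q))"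
      by (simp add: o_def)
    then show ?thesis by (rule fder_eqI)
  qed
  have loc: "fder C f p V = fder C h p V" if "\<And>q. q \<in> dom_of C p \<Longrightarrow> f q = h q"
    for f h :: "'g \<Rightarrow> real" and V
  proof -
    have "frechet_derivative (f \<circ> pt C p) (at (coord C p p)) = frechet_derivative (h \<circ> pt C p) (at (coord C p p))"
      by (rule frechet_derivative_cong_open[OF open_img coord_self_in_img])
        (use that pt_in_dom in auto)
    then show ?thesis by (simp add: fder_def)
  qed
  have "Z p $ j = fder C (\<lambda>q. fder C (coord C p) q (Y q)) p (X p) $ j
             - fder C (\<lambda>q. fder C (coord C p) q (X q)) p (Y p) $ j" for j
  proof -
    let ?f = "\<lambda>q. coord C p q $ j"
    have f: "smooth_fun C (dom_of C p) ?f"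
      by (rule smooth_fun_bounded_linear[OF open_dom bounded_linear_vec_nth smooth_fun_coord])
    have XY: "fder C (\<lambda>q. fder C ?f q (V q)) p U = fder C (\<lambda>q. fder C (coord C p) q (V q)) p U $ j"
      if "smooth_vf C V" for V U
    proof -
      have "fder C (\<lambda>q. fder C ?f q (V q)) p U = fder C (\<lambda>q. fder C (coord C p) q (V q) $ j) p U"
        by (rule loc) (use comp[OF smooth_fun_coord] in auto)
      also have "\<dots> = fder C (\<lambda>q. fder C (coord C p) q (V q)) p U $ j"
        by (rule comp[of "dom_of C p"]) (use that in_dom in \<open>auto simp: smooth_vf_def\<close>)
      finally show ?thesis .
    qed
    have "Z p $ j = fder C ?f p (Z p)"
      using comp[OF smooth_fun_coord in_dom] by simp
    also have "\<dots> = fder C (\<lambda>q. fder C ?f q (Y q)) p (X p) - fder C (\<lambda>q. fder C ?f q (X q)) p (Y p)"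
      using Z f in_dom[of p] open_dom unfolding is_lie_bracket_def by blast
    finally show ?thesis using XY X Y by simp
  qed
  then show ?thesis by (simp add: vec_eq_iff)
qed

end

section \<open>Lie groups with a left-invariant frame\<close>

text \<open>Jacobi's formula: at the identity matrix, every product in the determinant with an
  off-diagonal factor has at least two of them, so only the diagonal contributes to the
  derivative.\<close>

lemma det_has_derivative_at_identity:
  fixes A :: "'b::real_normed_vector \<Rightarrow> real^3^3"
  assumes "\<And>i j. ((\<lambda>z. A z $ i $ j) has_derivative A' i j) (at z)" "A z = mat 1"
  shows "((\<lambda>z. det (A z)) has_derivative (\<lambda>h. \<Sum>k\<in>UNIV. A' k k h)) (at z)"
proof -
  have I: "A z $ i $ j = (if i = j then 1 else 0)" for i j
    using assms(2) by (simp add: mat_def)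
  have P: "((\<lambda>z. A z $ i $ j * A z $ k $ l * A z $ m $ n) has_derivative
      (\<lambda>h. A z $ i $ j * A z $ k $ l * A' m n h
        + (A z $ i $ j * A' k l h + A' i j h * A z $ k $ l) * A z $ m $ n)) (at z)" for i j k l m n
    by (rule has_derivative_mult[OF has_derivative_mult[OF assms(1) assms(1)] assms(1)])
  have "((\<lambda>z. det (A z)) has_derivative (\<lambda>h. A' 1 1 h + A' 2 2 h + A' 3 3 h)) (at z)"
    unfolding det_3
    by (rule has_derivative_eq_rhs, (rule has_derivative_diff has_derivative_add P)+) (simp add: I fun_eq_iff)
  then show ?thesis by (simp add: sum_3)
qed

locale framed_lie_group = manifold3 C for C :: "'g::t2_space charts" +
  fixes mul :: "'g \<Rightarrow> 'g \<Rightarrow> 'g" and e :: 'g and iv :: "'g \<Rightarrow> 'g" and E :: "3 \<Rightarrow> 'g vfield"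
  assumes lie: "lie_group C mul e iv"
    and left_invariant: "left_invariant_vf C mul (E k)"
    and frame_inj: "(\<Sum>k\<in>UNIV. x $ k *\<^sub>R E k p) = 0 \<Longrightarrow> x = 0"
begin

section \<open>The group law and its translations in charts\<close>

lemma mul_assoc: "mul (mul a b) c = mul a (mul b c)"
  and mul_e_left [simp]: "mul e a = a"
  and mul_e_right [simp]: "mul a e = a"
  and mul_iv_left [simp]: "mul (iv a) a = e"
  and mul_iv_right [simp]: "mul a (iv a) = e"
proof -
  have "group mul e iv" using lie by (simp add: lie_group_def)
  then interpret G: group mul e iv .
  show "mul (mul a b) c = mul a (mul b c)" "mul e a = a" "mul a e = a" "mul (iv a) a = e" "mul a (iv a) = e"
    by (simp_all add: G.assoc G.left_neutral G.right_neutral)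
qed

lemma mul_iv_cancel [simp]: "mul a (mul (iv a) b) = b" "mul (iv a) (mul a b) = b"
  "mul (mul b a) (iv a) = b" "mul (mul b (iv a)) a = b"
  by (simp_all add: mul_assoc) (simp_all flip: mul_assoc)

lemma continuous_mul: "continuous_on UNIV (\<lambda>(a, b). mul a b)"
  and continuous_iv: "continuous_on UNIV iv"
  using lie by (auto simp: lie_group_def smooth_map_def)

lemma continuous_mul' [continuous_intros]:
  assumes "continuous_on S f" "continuous_on S h"
  shows "continuous_on S (\<lambda>x. mul (f x) (h x))"
  using continuous_on_compose2[OF continuous_mul continuous_on_Pair[OF assms]] by simp

lemma isCont_mul_left: "isCont (mul a) q"
  and isCont_mul_right: "isCont (\<lambda>q. mul q a) q"
  using continuous_mul'[OF continuous_on_const continuous_on_id, of UNIV a]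
    continuous_mul'[OF continuous_on_id continuous_on_const, of UNIV a]
  by (auto simp: continuous_on_eq_continuous_at)

text \<open>The group law as one function of two variables: its partial differential in the second
  slot is that of left translations, in the first slot that of right translations. Both are needed
  for the same function when mixed derivatives are exchanged.\<close>

definition mrep :: "'g \<Rightarrow> 'g \<Rightarrow> 'g \<Rightarrow> (real^3) \<times> (real^3) \<Rightarrow> real^3" where
  "mrep p q s = (\<lambda>(x, y). coord C s (mul (pt C p x) (pt C q y)))"

definition mdom :: "'g \<Rightarrow> 'g \<Rightarrow> 'g \<Rightarrow> ((real^3) \<times> (real^3)) set" where
  "mdom p q s = {(x, y). x \<in> img p \<and> y \<in> img q \<and> mul (pt C p x) (pt C q y) \<in> dom_of C s}"

lemma smooth_mrep: "smooth_on (mdom p q s) (mrep p q s)"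
  using lie by (simp add: lie_group_def mrep_def mdom_def)

lemma open_mdom: "open (mdom p q s)"
proof -
  have "continuous_on (img p \<times> img q) (\<lambda>z. mul (pt C p (fst z)) (pt C q (snd z)))"
    by (intro continuous_intros continuous_on_compose2[OF continuous_pt]) auto
  from continuous_open_preimage[OF this open_Times[OF open_img open_img] open_dom, of s]
  show ?thesis
    by (rule back_subst[of "open"]) (auto simp: mdom_def)
qed

lemma mrep_has_derivative:
  assumes "z \<in> mdom p q s"
  shows "(mrep p q s has_derivative frechet_derivative (mrep p q s) (at z)) (at z)"
  using smooth_on_differentiable[OF smooth_mrep assms] by (simp add: frechet_derivative_works)

lemma mul_left_chart:
  assumes "(coord C b a, coord C p q) \<in> mdom b p s" "a \<in> dom_of C b"
  shows "((coord C s \<circ> mul a \<circ> pt C p) has_derivative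
     (\<lambda>V. frechet_derivative (mrep b p s) (at (coord C b a, coord C p q)) (0, V))) (at (coord C p q))"
proof -
  have "((\<lambda>y. mrep b p s (coord C b a, y)) has_derivative
     (\<lambda>V. frechet_derivative (mrep b p s) (at (coord C b a, coord C p q)) (0, V))) (at (coord C p q))"
    by (rule has_derivative_compose[where f="\<lambda>y. (coord C b a, y)", OF _ mrep_has_derivative[OF assms(1)]])
      (auto intro!: derivative_eq_intros)
  then show ?thesis using assms(2) by (simp add: mrep_def o_def)
qed

lemma mul_right_chart:
  assumes "(coord C p q, y) \<in> mdom p b s"
  shows "((coord C s \<circ> (\<lambda>x. mul x (pt C b y)) \<circ> pt C p) has_derivative
     (\<lambda>V. frechet_derivative (mrep p b s) (at (coord C p q, y)) (V, 0))) (at (coord C p q))"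
proof -
  have "((\<lambda>x. mrep p b s (x, y)) has_derivative
     (\<lambda>V. frechet_derivative (mrep p b s) (at (coord C p q, y)) (V, 0))) (at (coord C p q))"
    by (rule has_derivative_compose[where f="\<lambda>x. (x, y)", OF _ mrep_has_derivative[OF assms]])
      (auto intro!: derivative_eq_intros)
  then show ?thesis by (simp add: mrep_def o_def)
qed

lemma mdiff_mul_left: "mdiff (mul a) q"
  by (rule mder_chart(1)[OF in_dom in_dom isCont_mul_left mul_left_chart[OF _ in_dom]])
    (auto simp: mdom_def in_dom)

lemma mdiff_mul_right: "mdiff (\<lambda>x. mul x b) q"
proof (rule mder_chart(1)[OF in_dom in_dom isCont_mul_right])
  show "((coord C (mul q b) \<circ> (\<lambda>x. mul x b) \<circ> pt C q) has_derivative
      (\<lambda>V. frechet_derivative (mrep q b (mul q b)) (at (coord C q q, coord C b b)) (V, 0))) (at (coord C q q))"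
    using mul_right_chart[of q q "coord C b b" b "mul q b"] by (simp add: mdom_def in_dom)
qed

lemma mder_right_right:
  "mder C (\<lambda>x. mul x a) (mul q b) (mder C (\<lambda>x. mul x b) q V) = mder C (\<lambda>x. mul x (mul b a)) q V"
  using mder_comp(2)[of "\<lambda>x. mul x b" q "\<lambda>x. mul x a" V, OF mdiff_mul_right mdiff_mul_right] by (simp add: mul_assoc)

lemma mder_left_right:
  "mder C (mul a) (mul q b) (mder C (\<lambda>x. mul x b) q V)
    = mder C (\<lambda>x. mul x b) (mul a q) (mder C (mul a) q V)"
  using mder_comp(2)[of "\<lambda>x. mul x b" q "mul a" V, OF mdiff_mul_right mdiff_mul_left]
    mder_comp(2)[of "mul a" q "\<lambda>x. mul x b" V, OF mdiff_mul_left mdiff_mul_right] by (simp add: mul_assoc)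

section \<open>The frame, the adjoint action and its determinant\<close>

lemma E_invariant: "mder C (mul a) q (E k q) = E k (mul a q)"
  and smooth_E: "smooth_vf C (E k)"
  using left_invariant by (auto simp: left_invariant_vf_def)

definition fr :: "'g \<Rightarrow> real^3 \<Rightarrow> real^3" where
  "fr p x = (\<Sum>k\<in>UNIV. x $ k *\<^sub>R E k p)"

definition co :: "'g \<Rightarrow> real^3 \<Rightarrow> real^3" where
  "co p = inv (fr p)"

lemma linear_fr: "linear (fr p)"
  unfolding fr_def
  by (intro linearI) (simp_all add: sum.distrib scaleR_left_distrib scaleR_sum_right)

lemma inj_fr: "inj (fr p)"
  using linear_injective_0[OF linear_fr] frame_inj by (auto simp: fr_def)

lemma surj_fr: "surj (fr p)"
  by (rule linear_injective_imp_surjective[OF linear_fr inj_fr]) simp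

lemma co_fr [simp]: "co p (fr p x) = x"
  and fr_co [simp]: "fr p (co p V) = V"
  by (simp_all add: co_def inj_fr surj_fr surj_f_inv_f)

lemma linear_co: "linear (co p)"
  unfolding co_def using inj_linear_imp_inv_linear[OF linear_fr inj_fr] .

lemma fr_axis [simp]: "fr p (axis k 1) = E k p"
  by (simp add: fr_def axis_def if_distrib[of "\<lambda>x. x *\<^sub>R _"] cong: if_cong)

lemma mder_left_fr: "mder C (mul a) q (fr q x) = fr (mul a q) x"
  by (simp add: fr_def linear_sum[OF linear_mder[OF mdiff_mul_left]]
      linear_cmul[OF linear_mder[OF mdiff_mul_left]] E_invariant)

text \<open>\<open>Ad a\<close> is the adjoint action of the inverse of \<open>a\<close>; in particular it reverses products.\<close>

definition Ad :: "'g \<Rightarrow> real^3 \<Rightarrow> real^3" where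
  "Ad a x = co a (mder C (\<lambda>q. mul q a) e (fr e x))"

lemma linear_Ad: "linear (Ad a)"
  unfolding Ad_def using linear_compose[OF linear_compose[OF linear_fr linear_mder[OF mdiff_mul_right]] linear_co]
  by (simp add: o_def)

text \<open>Left and right translations commute, so the matrix of a right translation with respect
  to the left-invariant frame is the same at every point \<open>q\<close>.\<close>

lemma mder_right_fr: "mder C (\<lambda>x. mul x a) q (fr q x) = fr (mul q a) (Ad a x)"
proof -
  have "mder C (\<lambda>x. mul x a) q (fr q x) = mder C (\<lambda>x. mul x a) (mul q e) (mder C (mul q) e (fr e x))"
    using mder_left_fr[of q e x] by simp
  also have "\<dots> = mder C (mul q) (mul e a) (mder C (\<lambda>x. mul x a) e (fr e x))"
    by (rule mder_left_right[symmetric])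
  also have "mder C (\<lambda>x. mul x a) e (fr e x) = fr a (Ad a x)"
    by (simp add: Ad_def)
  finally show ?thesis by (simp add: mder_left_fr)
qed

lemma Ad_mul: "Ad (mul b a) x = Ad a (Ad b x)"
proof -
  have "fr (mul b a) (Ad (mul b a) x) = mder C (\<lambda>x. mul x (mul b a)) e (fr e x)"
    by (simp add: mder_right_fr)
  also have "\<dots> = fr (mul b a) (Ad a (Ad b x))"
    using mder_right_right[of a e b "fr e x"] by (simp add: mder_right_fr)
  finally show ?thesis using inj_fr by (meson injD)
qed

lemma Ad_e [simp]: "Ad e x = x"
  by (simp add: Ad_def)

text \<open>The determinant is taken with its sign, so that Jacobi's formula applies to it directly.
  It is a homomorphism although \<open>Ad\<close> reverses products, since determinants
  commute.\<close>

definition Delta :: "'g \<Rightarrow> real" where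
  "Delta a = det (matrix (Ad a))"

lemma Delta_mul: "Delta (mul a b) = Delta a * Delta b"
proof -
  have "Ad (mul a b) = Ad b \<circ> Ad a" by (auto simp: Ad_mul)
  then show ?thesis
    by (simp add: Delta_def matrix_compose[OF linear_Ad linear_Ad] det_mul)
qed

lemma Delta_e [simp]: "Delta e = 1"
proof -
  have "Ad e = id" by auto
  then show ?thesis by (simp add: Delta_def matrix_id_mat_1)
qed

text \<open>\<open>E j q\<close> is the image of \<open>E j e\<close> under left translation by
  \<open>q\<close>, so the field near \<open>p\<close> is a partial derivative of the group law
  taken at \<open>e\<close> in the second slot.\<close>

lemma E_chart:
  assumes "q \<in> dom_of C p"
  shows "fder C (coord C p) q (E j q)
    = frechet_derivative (mrep p e p) (at (coord C p q, coord C e e)) (0, E j e)"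
proof -
  have "(coord C p q, coord C e e) \<in> mdom p e p"
    using assms by (simp add: mdom_def in_dom)
  from mder_chart(2)[OF in_dom _ isCont_mul_left mul_left_chart[OF this assms], of "E j e"] assms
  show ?thesis by (simp add: E_invariant)
qed

lemma mder_right_chart:
  assumes "(coord C p p, z) \<in> mdom p e p"
  shows "fder C (coord C p) (mul p (pt C e z)) (mder C (\<lambda>x. mul x (pt C e z)) p V)
    = frechet_derivative (mrep p e p) (at (coord C p p, z)) (V, 0)"
  using mder_chart(2)[OF in_dom _ isCont_mul_right mul_right_chart[OF assms], of V] assms
  by (simp add: mdom_def)

text \<open>The two derivatives of the group law at \<open>(p, e)\<close> express the left-invariant frame near \<open>p\<close> and
  the right translates of the frame at \<open>p\<close>; since mixed derivatives commute, the derivative of the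
  change-of-frame determinant is minus the trace of the bracket.\<close>

lemma Delta_derivative:
  shows "((Delta \<circ> pt C e) has_derivative fder C Delta e) (at (coord C e e))"
    and "(\<And>k. is_lie_bracket C (E i) (E k) (Z k)) \<Longrightarrow>
      fder C Delta e (E i e) = - (\<Sum>k\<in>UNIV. co p (Z k p) $ k)"
proof -
  define G where "G = mrep p e p"
  define \<Omega> where "\<Omega> = mdom p e p"
  define x0 where "x0 = coord C e e"
  define y0 where "y0 = coord C p p"
  define DG where "DG = (\<lambda>v a. frechet_derivative G (at a) v)"
  define DD where "DD = (\<lambda>v a u. frechet_derivative (DG v) (at a) u)"
  have sG: "smooth_on \<Omega> G" and sDG: "smooth_on \<Omega> (DG v)" for v
    unfolding G_def \<Omega>_def DG_def by (intro smooth_on_derivative smooth_mrep)+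
  have o\<Omega>: "open \<Omega>" unfolding \<Omega>_def by (rule open_mdom)
  have a0: "(y0, x0) \<in> \<Omega>"
    by (simp add: \<Omega>_def y0_def x0_def mdom_def in_dom)
  have N: "eventually (\<lambda>z. (y0, z) \<in> \<Omega>) (nhds x0)"
  proof -
    have "open ((\<lambda>z. (y0, z)) -` \<Omega>)"
      by (intro open_vimage o\<Omega> continuous_intros)
    then show ?thesis
      using a0 eventually_nhds_in_open[of "(\<lambda>z. (y0, z)) -` \<Omega>" x0] by simp
  qed
  have G0: "G (y0, x0) = y0" by (simp add: G_def mrep_def y0_def x0_def)
  have dG: "(G has_derivative (\<lambda>v. DG v (y0, x0))) (at (y0, x0))"
    using smooth_on_differentiable[OF sG a0] by (simp add: DG_def frechet_derivative_works)
  have dDG: "(DG v has_derivative DD v (y0, x0)) (at (y0, x0))" for v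
    using smooth_on_differentiable[OF sDG a0] by (simp add: DD_def frechet_derivative_works)
  \<comment> \<open>At the point \<open>mul p (pt C e z)\<close>, \<open>R k\<close> is the frame
    vector \<open>E k p\<close> carried there by right translation and \<open>S k\<close> is the
    value of the field \<open>E k\<close> itself. Both are read in the coordinate basis given by the
    frame at \<open>p\<close>, and by \<open>mder_right_fr\<close> they differ by the matrix of
    \<open>Ad\<close>.\<close>
  define R where "R = (\<lambda>k z. co p (DG (E k p, 0) (y0, z)))"
  define S where "S = (\<lambda>k z. co p (DG (0, E k e) (G (y0, z), x0)))"
  define Rm where "Rm = (\<lambda>z. (\<chi> i k. R k z $ i) :: real^3^3)"
  define Sm where "Sm = (\<lambda>z. (\<chi> i k. S k z $ i) :: real^3^3)"
  have SE: "DG (0, E j e) (coord C p q, x0) = fder C (coord C p) q (E j q)" if "q \<in> dom_of C p" for j q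
    using E_chart[OF that, of j] by (simp add: DG_def G_def x0_def)
  have RR: "DG (V, 0) (y0, z) = fder C (coord C p) (mul p (pt C e z)) (mder C (\<lambda>x. mul x (pt C e z)) p V)"
    if "(y0, z) \<in> \<Omega>" for V z
    using mder_right_chart[of p z V] that by (simp add: DG_def G_def y0_def \<Omega>_def)
  have RS: "R k z = (\<Sum>j\<in>UNIV. Ad (pt C e z) (axis k 1) $ j *\<^sub>R S j z)" if z: "(y0, z) \<in> \<Omega>" for k z
  proof -
    define q where "q = mul p (pt C e z)"
    have q: "q \<in> dom_of C p" using z by (simp add: q_def \<Omega>_def mdom_def y0_def)
    have Gq: "G (y0, z) = coord C p q" by (simp add: G_def mrep_def q_def y0_def)
    note lin = linear_compose[OF linear_fder_coord[OF q] linear_co[of p]]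
    have "R k z = (co p \<circ> fder C (coord C p) q) (fr q (Ad (pt C e z) (axis k 1)))"
      using RR[OF z, of "E k p"] mder_right_fr[of "pt C e z" p "axis k 1"] by (simp add: R_def q_def)
    also have "\<dots> = (\<Sum>j\<in>UNIV. Ad (pt C e z) (axis k 1) $ j *\<^sub>R (co p \<circ> fder C (coord C p) q) (E j q))"
      unfolding fr_def by (simp only: linear_sum[OF lin] linear_cmul[OF lin])
    also have "\<dots> = (\<Sum>j\<in>UNIV. Ad (pt C e z) (axis k 1) $ j *\<^sub>R S j z)"
      by (simp add: S_def Gq SE[OF q])
    finally show ?thesis .
  qed
  have det_eq: "det (Rm z) = det (Sm z) * Delta (pt C e z)" if "(y0, z) \<in> \<Omega>" for z
  proof -
    have "Rm z = Sm z ** matrix (Ad (pt C e z))"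
      by (simp add: vec_eq_iff Rm_def Sm_def matrix_matrix_mult_def matrix_def RS[OF that] mult.commute)
    then show ?thesis by (simp add: det_mul Delta_def)
  qed
  have R0: "R k x0 = axis k 1" for k
    using RR[OF a0, of "E k p"] by (simp add: R_def x0_def co_fr[of p "axis k 1", simplified])
  have S0: "S k x0 = axis k 1" for k
    using SE[OF in_dom[of p]] by (simp add: S_def G0 y0_def[symmetric] co_fr[of p "axis k 1", simplified])
  have Rm0: "Rm x0 = mat 1" and Sm0: "Sm x0 = mat 1"
    by (auto simp: Rm_def Sm_def R0 S0 mat_def axis_def vec_eq_iff)
  have bl: "bounded_linear (\<lambda>V. co p V $ i)" for i
    by (rule bounded_linear_compose[OF bounded_linear_vec_nth linear_conv_bounded_linear[THEN iffD1, OF linear_co]])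
  have dR: "((\<lambda>z. Rm z $ i $ k) has_derivative (\<lambda>w. co p (DD (E k p, 0) (y0, x0) (0, w)) $ i)) (at x0)" for i k
  proof -
    have "((\<lambda>z. DG (E k p, 0) (y0, z)) has_derivative (\<lambda>w. DD (E k p, 0) (y0, x0) (0, w))) (at x0)"
      by (rule has_derivative_compose[where f="\<lambda>z. (y0, z)", OF _ dDG]) (auto intro!: derivative_eq_intros)
    from bounded_linear.has_derivative[OF bl this] show ?thesis by (simp add: Rm_def R_def)
  qed
  have dS: "((\<lambda>z. Sm z $ i $ k) has_derivative
      (\<lambda>w. co p (DD (0, E k e) (y0, x0) (DG (0, w) (y0, x0), 0)) $ i)) (at x0)" for i k
  proof -
    have 1: "((\<lambda>z. G (y0, z)) has_derivative (\<lambda>w. DG (0, w) (y0, x0))) (at x0)"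
      by (rule has_derivative_compose[where f="\<lambda>z. (y0, z)", OF _ dG]) (auto intro!: derivative_eq_intros)
    have "((\<lambda>z. DG (0, E k e) (G (y0, z), x0)) has_derivative
        (\<lambda>w. DD (0, E k e) (y0, x0) (DG (0, w) (y0, x0), 0))) (at x0)"
      by (rule has_derivative_compose[where f="\<lambda>z. (G (y0, z), x0)"])
        (auto intro!: derivative_eq_intros 1 simp: G0 dDG)
    from bounded_linear.has_derivative[OF bl this] show ?thesis by (simp add: Sm_def S_def)
  qed
  note ddR = det_has_derivative_at_identity[OF dR Rm0]
  note ddS = det_has_derivative_at_identity[OF dS Sm0]
  have "isCont (\<lambda>z. det (Sm z)) x0"
    using ddS by (rule has_derivative_continuous)
  then have "eventually (\<lambda>z. det (Sm z) \<noteq> 0) (nhds x0)"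
    using t1_space_nhds[of "det (Sm x0)" 0] Sm0
    by (simp add: continuous_within tendsto_imp_eventually_ne eventually_nhds_conv_at)
  \<comment> \<open>\<open>Delta\<close> becomes a quotient of two determinants equal to 1 at
    \<open>e\<close>, so its derivative is the difference of two traces.\<close>
  with N have ev: "eventually (\<lambda>z. det (Rm z) / det (Sm z) = (Delta \<circ> pt C e) z) (nhds x0)"
    by eventually_elim (simp add: det_eq)
  have "((\<lambda>z. det (Rm z) / det (Sm z)) has_derivative
     (\<lambda>w. (\<Sum>k\<in>UNIV. co p (DD (E k p, 0) (y0, x0) (0, w)) $ k)
        - (\<Sum>k\<in>UNIV. co p (DD (0, E k e) (y0, x0) (DG (0, w) (y0, x0), 0)) $ k))) (at x0)"
    by (rule has_derivative_eq_rhs[OF has_derivative_divide'[OF ddR ddS]]) (simp_all add: Rm0 Sm0)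
  from has_derivative_cong_nhds[OF ev this]
  have D: "((Delta \<circ> pt C e) has_derivative
     (\<lambda>w. (\<Sum>k\<in>UNIV. co p (DD (E k p, 0) (y0, x0) (0, w)) $ k)
        - (\<Sum>k\<in>UNIV. co p (DD (0, E k e) (y0, x0) (DG (0, w) (y0, x0), 0)) $ k))) (at (coord C e e))"
    unfolding x0_def .
  then show "((Delta \<circ> pt C e) has_derivative fder C Delta e) (at (coord C e e))"
    using fder_eqI[OF D] by (metis (no_types, lifting) ext)
  assume Z: "\<And>k. is_lie_bracket C (E i) (E k) (Z k)"
  have fd: "fder C (\<lambda>q. fder C (coord C p) q (E k q)) p V = DD (0, E k e) (y0, x0) (V, 0)" for k V
  proof (rule fder_eqI)
    have "((\<lambda>y. DG (0, E k e) (y, x0)) has_derivative (\<lambda>V. DD (0, E k e) (y0, x0) (V, 0))) (at (coord C p p))"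
      by (rule has_derivative_compose[where f="\<lambda>y. (y, x0)"])
        (auto intro!: derivative_eq_intros dDG simp: y0_def[symmetric])
    then show "((\<lambda>q. fder C (coord C p) q (E k q)) \<circ> pt C p has_derivative
        (\<lambda>V. DD (0, E k e) (y0, x0) (V, 0))) (at (coord C p p))"
    proof (rule has_derivative_transform_within_open[OF _ open_img coord_self_in_img])
      show "DG (0, E k e) (y, x0) = ((\<lambda>q. fder C (coord C p) q (E k q)) \<circ> pt C p) y" if "y \<in> img p" for y
        using SE[OF pt_in_dom[OF that], of k] that by simp
    qed
  qed
  have Zk: "Z k p = DD (0, E k e) (y0, x0) (E i p, 0) - DD (E k p, 0) (y0, x0) (0, E i e)" for k
  proof -
    \<comment> \<open>After the exchange the second term is the derivative of the field
      \<open>E i\<close> along \<open>E k p\<close>, as the coordinate formula for the bracket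
      requires.\<close>
    have "DD (E k p, 0) (y0, x0) (0, E i e) = DD (0, E i e) (y0, x0) (E k p, 0)"
      using sG mixed_derivatives_commute[OF o\<Omega> a0, of G]
      by (simp add: DD_def DG_def smooth_on_def)
    then show ?thesis
      using is_lie_bracket_coord[OF Z smooth_E smooth_E, of k p] by (simp add: fd)
  qed
  have DGi: "DG (0, E i e) (y0, x0) = E i p"
    using SE[OF in_dom, of i] by (simp add: y0_def)
  have "fder C Delta e (E i e) = (\<Sum>k\<in>UNIV. co p (DD (E k p, 0) (y0, x0) (0, E i e)) $ k)
        - (\<Sum>k\<in>UNIV. co p (DD (0, E k e) (y0, x0) (E i p, 0)) $ k)"
    using fder_eqI[OF D, of "E i e"] by (simp add: DGi)
  also have "\<dots> = - (\<Sum>k\<in>UNIV. co p (Z k p) $ k)"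
    by (simp add: Zk linear_diff[OF linear_co] sum_subtractf)
  finally show "fder C Delta e (E i e) = - (\<Sum>k\<in>UNIV. co p (Z k p) $ k)" .
qed

end

section \<open>Haar measure\<close>

text \<open>Bridge between the change of variables theorem, which speaks of absolutely integrable
  functions with integral \<open>b\<close>, and extended nonnegative integrals, which may be
  infinite.\<close>

lemma absolutely_integrable_nonneg_iff:
  fixes h :: "'a::euclidean_space \<Rightarrow> real"
  assumes h: "\<And>x. 0 \<le> h x"
    and m: "(\<lambda>x. indicator S x *\<^sub>R h x) \<in> borel_measurable borel"
  shows "h absolutely_integrable_on S \<and> integral S h = b
    \<longleftrightarrow> 0 \<le> b \<and> (\<integral>\<^sup>+x. ennreal (indicator S x *\<^sub>R h x) \<partial>lborel) = ennreal b"
proof -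
  have m': "(\<lambda>x. indicator S x *\<^sub>R h x) \<in> borel_measurable lebesgue"
    using m by (simp add: measurable_completion)
  have pos: "0 \<le> indicator S x *\<^sub>R h x" for x using h by simp
  have nn: "(\<integral>\<^sup>+x. ennreal (indicator S x *\<^sub>R h x) \<partial>lebesgue)
      = (\<integral>\<^sup>+x. ennreal (indicator S x *\<^sub>R h x) \<partial>lborel)"
    by (rule nn_integral_completion)
  have "h absolutely_integrable_on S \<and> integral S h = b
     \<longleftrightarrow> integrable lebesgue (\<lambda>x. indicator S x *\<^sub>R h x) \<and> (LINT x|lebesgue. indicator S x *\<^sub>R h x) = b"
    using set_lebesgue_integral_eq_integral(2)[of S h]
    by (auto simp: set_integrable_def set_lebesgue_integral_def)
  also have "\<dots> \<longleftrightarrow> 0 \<le> b \<and> (\<integral>\<^sup>+x. ennreal (indicator S x *\<^sub>R h x) \<partial>lborel) = ennreal b"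
  proof (intro iffI conjI)
    assume a: "integrable lebesgue (\<lambda>x. indicator S x *\<^sub>R h x) \<and> (LINT x|lebesgue. indicator S x *\<^sub>R h x) = b"
    have "0 \<le> (LINT x|lebesgue. indicator S x *\<^sub>R h x)"
      by (rule Bochner_Integration.integral_nonneg) (rule pos)
    then show "0 \<le> b" using a by simp
    show "(\<integral>\<^sup>+x. ennreal (indicator S x *\<^sub>R h x) \<partial>lborel) = ennreal b"
      using nn_integral_eq_integral[OF conjunct1[OF a] AE_I2[OF pos]] conjunct2[OF a] nn by metis
  next
    assume a: "0 \<le> b \<and> (\<integral>\<^sup>+x. ennreal (indicator S x *\<^sub>R h x) \<partial>lborel) = ennreal b"
    have a': "(\<integral>\<^sup>+x. ennreal (indicator S x *\<^sub>R h x) \<partial>lebesgue) = ennreal b"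
      by (rule trans[OF nn conjunct2[OF a]])
    show i: "integrable lebesgue (\<lambda>x. indicator S x *\<^sub>R h x)"
      unfolding integrable_iff_bounded real_norm_def abs_of_nonneg[OF pos] a' using m' by simp
    show "(LINT x|lebesgue. indicator S x *\<^sub>R h x) = b"
    proof -
      have "ennreal (LINT x|lebesgue. indicator S x *\<^sub>R h x) = ennreal b"
        using nn_integral_eq_integral[OF i AE_I2[OF pos]] a' by metis
      moreover have "0 \<le> (LINT x|lebesgue. indicator S x *\<^sub>R h x)"
        by (rule Bochner_Integration.integral_nonneg) (rule pos)
      ultimately show ?thesis using a by simp
    qed
  qed
  finally show ?thesis .
qed

text \<open>The classical theorem says that the two integrals attain the same finite values
  \<open>b\<close>; for nonnegative integrands this determines them in the extended
  half-line.\<close>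

lemma nn_integral_change_of_variables:
  fixes g :: "real^'n::{finite,wellorder} \<Rightarrow> real^'n::_" and f :: "real^'n::_ \<Rightarrow> real"
  assumes S: "S \<in> sets borel"
    and der: "\<And>x. x \<in> S \<Longrightarrow> (g has_derivative g' x) (at x)"
    and inj: "inj_on g S"
    and f: "\<And>y. 0 \<le> f y"
    and m1: "(\<lambda>y. indicator (g ` S) y *\<^sub>R f y) \<in> borel_measurable borel"
    and m2: "(\<lambda>x. indicator S x *\<^sub>R (\<bar>det (matrix (g' x))\<bar> * f (g x))) \<in> borel_measurable borel"
  shows "(\<integral>\<^sup>+y. ennreal (indicator (g ` S) y *\<^sub>R f y) \<partial>lborel)
    = (\<integral>\<^sup>+x. ennreal (indicator S x *\<^sub>R (\<bar>det (matrix (g' x))\<bar> * f (g x))) \<partial>lborel)"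
proof -
  have S': "S \<in> sets lebesgue" using S by simp
  have der': "\<And>x. x \<in> S \<Longrightarrow> (g has_derivative g' x) (at x within S)"
    using der by (blast intro: has_derivative_at_withinI)
  \<comment> \<open>The theorem is about vector-valued integrands, so the real function is viewed
    with values in \<open>real^1\<close>.\<close>
  have *: "(\<lambda>x. \<bar>det (matrix (g' x))\<bar> * f (g x)) absolutely_integrable_on S
      \<and> integral S (\<lambda>x. \<bar>det (matrix (g' x))\<bar> * f (g x)) = b
    \<longleftrightarrow> f absolutely_integrable_on (g ` S) \<and> integral (g ` S) f = b" for b
    using has_absolute_integral_change_of_variables[OF S' der' inj, of "\<lambda>y. vec (f y) :: real^1" "vec b"]
    by (simp add: absolutely_integrable_on_1_iff integral_on_1_eq)
  have **: "0 \<le> b \<and> (\<integral>\<^sup>+y. ennreal (indicator (g ` S) y *\<^sub>R f y) \<partial>lborel) = ennreal b \<longleftrightarrow>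
     0 \<le> b \<and> (\<integral>\<^sup>+x. ennreal (indicator S x *\<^sub>R (\<bar>det (matrix (g' x))\<bar> * f (g x))) \<partial>lborel) = ennreal b" for b
    using * absolutely_integrable_nonneg_iff[OF f m1, of b]
      absolutely_integrable_nonneg_iff[OF _ m2, of b] f by simp
  show ?thesis
  proof (cases "\<integral>\<^sup>+y. ennreal (indicator (g ` S) y *\<^sub>R f y) \<partial>lborel")
    case (real b)
    then show ?thesis using **[of b] by simp
  next
    \<comment> \<open>If the left integral is infinite, it equals no real \<open>b\<close>; by
      \<open>**\<close> neither does the right one.\<close>
    case top
    then show ?thesis
      using ** by (cases "\<integral>\<^sup>+x. ennreal (indicator S x *\<^sub>R (\<bar>det (matrix (g' x))\<bar> * f (g x))) \<partial>lborel") auto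
  qed
qed

context manifold3
begin

text \<open>The converse passage to \<open>mder_chart\<close>: from the charts with index
  \<open>q\<close> and \<open>f q\<close> to the fixed charts in which a whole Borel set and its
  image are integrated.\<close>

lemma mdiff_chart:
  assumes md: "mdiff f q" and q: "q \<in> dom_of C p" and fq: "f q \<in> dom_of C p'"
  obtains D where "((coord C p' \<circ> f \<circ> pt C p) has_derivative D) (at (coord C p q))"
    "\<And>V. D (fder C (coord C p) q V) = fder C (coord C p') (f q) (mder C f q V)"
proof -
  have f: "isCont f q" using md by (simp add: mdiff_def)
  obtain T where T: "((coord C q \<circ> pt C p) has_derivative T) (at (coord C p q))"
    using transition_differentiable[OF q in_dom] by (auto simp: differentiable_def)
  have 1: "((coord C p' \<circ> pt C (f q)) \<circ> (coord C (f q) \<circ> f \<circ> pt C q) has_derivative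
      fder C (coord C p') (f q) \<circ> mder C f q) (at (coord C q q))"
    by (rule diff_chain_at[OF mdiff_has_derivative[OF md]])
      (use transition_has_derivative[OF fq] in simp)
  have "(((coord C p' \<circ> pt C (f q)) \<circ> (coord C (f q) \<circ> f \<circ> pt C q)) \<circ> (coord C q \<circ> pt C p) has_derivative
      (fder C (coord C p') (f q) \<circ> mder C f q) \<circ> T) (at (coord C p q))"
    by (rule diff_chain_at[OF T]) (use 1 q in simp)
  moreover have "eventually (\<lambda>y. ((coord C p' \<circ> pt C (f q)) \<circ> (coord C (f q) \<circ> f \<circ> pt C q) \<circ> (coord C q \<circ> pt C p)) y
      = (coord C p' \<circ> f \<circ> pt C p) y) (nhds (coord C p q))"
  proof -
    have "eventually (\<lambda>y. pt C p y \<in> dom_of C q) (nhds (coord C p q))"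
      using eventually_map_pt_in[where f="\<lambda>x. x" and q=q, OF _ in_dom open_dom q] by simp
    then show ?thesis using eventually_map_pt_in[OF f in_dom open_dom q]
      by eventually_elim simp
  qed
  ultimately have D: "((coord C p' \<circ> f \<circ> pt C p) has_derivative
      (fder C (coord C p') (f q) \<circ> mder C f q) \<circ> T) (at (coord C p q))"
    by (rule has_derivative_cong_nhds[rotated])
  show thesis
    using that[OF D] mder_chart(2)[where f=f, OF q fq f D] by metis
qed

end

locale haar_group = framed_lie_group C mul e iv E
  for C :: "'g::{t2_space,second_countable_topology} charts"
    and mul :: "'g \<Rightarrow> 'g \<Rightarrow> 'g" and e :: 'g and iv :: "'g \<Rightarrow> 'g" and E :: "3 \<Rightarrow> 'g vfield"
begin

definition Emat :: "'g \<Rightarrow> real^3 \<Rightarrow> real^3^3" where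
  "Emat p y = (\<chi> i k. fder C (coord C p) (pt C p y) (E k (pt C p y)) $ i)"

text \<open>The density that gives the parallelepiped spanned by the frame volume 1.\<close>

definition rho :: "'g \<Rightarrow> real^3 \<Rightarrow> real" where
  "rho p y = 1 / \<bar>det (Emat p y)\<bar>"

definition chart_measure :: "'g \<Rightarrow> (real^3) measure" where
  "chart_measure p = density lborel (\<lambda>y. ennreal (indicator (img p) y *\<^sub>R rho p y))"

abbreviation cimg :: "'g \<Rightarrow> 'g set \<Rightarrow> (real^3) set" where
  "cimg p A \<equiv> coord C p ` (A \<inter> dom_of C p)"

lemma Emat_matrix: "y \<in> img p \<Longrightarrow> Emat p y = matrix (fder C (coord C p) (pt C p y) \<circ> fr (pt C p y))"
  by (simp add: Emat_def matrix_def)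

lemma det_Emat: "y \<in> img p \<Longrightarrow> det (Emat p y) \<noteq> 0"
proof -
  assume y: "y \<in> img p"
  let ?f = "fder C (coord C p) (pt C p y) \<circ> fr (pt C p y)"
  have "linear ?f" "inj ?f"
    using linear_compose[OF linear_fr linear_fder_coord[OF pt_in_dom[OF y]]]
      inj_compose[OF inj_fder_coord[OF pt_in_dom[OF y]] inj_fr] by auto
  then show ?thesis
    using det_nz_iff_inj[of ?f] by (simp add: Emat_matrix[OF y])
qed

lemma continuous_rho: "continuous_on (img p) (rho p)"
proof -
  have c: "continuous_on (img p) (\<lambda>y. fder C (coord C p) (pt C p y) (E k (pt C p y)))" for k
  proof -
    have "smooth_on (coord C p ` (dom_of C p \<inter> dom_of C p)) ((\<lambda>q. fder C (coord C p) q (E k q)) \<circ> pt C p)"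
      using smooth_E[of k] unfolding smooth_vf_def smooth_fun_def by blast
    then show ?thesis using smooth_on_continuous by (fastforce simp: o_def)
  qed
  have "continuous_on (img p) (\<lambda>y. Emat p y $ i $ j)" for i j
    unfolding Emat_def by (simp add: continuous_on_component c)
  then have "continuous_on (img p) (\<lambda>y. det (Emat p y))"
    unfolding det_3 by (intro continuous_on_add continuous_on_diff continuous_on_mult)
  then show ?thesis unfolding rho_def
    by (intro continuous_intros) (auto simp: det_Emat)
qed

lemma rho_nonneg: "0 \<le> rho p y"
  and rho_pos: "y \<in> img p \<Longrightarrow> 0 < rho p y"
  by (simp_all add: rho_def det_Emat)

lemma measurable_rho:
  assumes "S \<in> sets borel" "S \<subseteq> img p"
  shows "(\<lambda>y. indicator S y *\<^sub>R rho p y) \<in> borel_measurable borel"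
  by (rule borel_measurable_continuous_on_indicator[OF assms(1) continuous_on_subset[OF continuous_rho assms(2)]])

lemma sets_chart_measure [measurable_cong, simp]: "sets (chart_measure p) = sets borel"
  by (simp add: chart_measure_def)

lemma cimg_eq: "cimg p A = img p \<inter> pt C p -` A"
  by (force simp: pt_in_dom)

lemma cimg_borel:
  assumes "A \<in> sets borel" shows "cimg p A \<in> sets borel"
proof -
  have "pt C p \<in> borel_measurable (restrict_space borel (img p))"
    by (rule borel_measurable_continuous_on_restrict[OF continuous_pt])
  from measurable_sets[OF this assms] have "img p \<inter> pt C p -` A \<in> sets (restrict_space borel (img p))"
    by (simp add: space_restrict_space Int_commute)
  then show ?thesis
    unfolding cimg_eq using open_img[of p] by (simp add: sets_restrict_space_iff borel_open)
qed

lemma emeasure_chart_measure: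
  assumes "S \<in> sets borel" "S \<subseteq> img p"
  shows "emeasure (chart_measure p) S = (\<integral>\<^sup>+y. ennreal (indicator S y *\<^sub>R rho p y) \<partial>lborel)"
proof -
  have "emeasure (chart_measure p) S
      = (\<integral>\<^sup>+y. ennreal (indicator (img p) y *\<^sub>R rho p y) * indicator S y \<partial>lborel)"
    unfolding chart_measure_def
    by (rule emeasure_density) (use assms measurable_rho[OF borel_open[OF open_img]] in auto)
  also have "\<dots> = (\<integral>\<^sup>+y. ennreal (indicator S y *\<^sub>R rho p y) \<partial>lborel)"
    by (rule nn_integral_cong) (use assms(2) in \<open>auto simp: indicator_def\<close>)
  finally show ?thesis .
qed

text \<open>A map whose differential is a constant matrix \<open>L\<close> in the frame multiplies
  frame volume by the determinant of \<open>L\<close>. Left translations, right translations and,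
  for the identity map, changes of chart are all instances.\<close>

lemma chart_measure_transform:
  fixes T :: "'g \<Rightarrow> 'g" and L :: "real^3 \<Rightarrow> real^3"
  assumes T: "\<And>q. mdiff T q" "inj T" and L: "linear L"
    and TL: "\<And>q x. mder C T q (fr q x) = fr (T q) (L x)"
    and A: "A \<in> sets borel" "A \<subseteq> dom_of C p" and TA: "T ` A \<in> sets borel" "T ` A \<subseteq> dom_of C p'"
  shows "emeasure (chart_measure p') (cimg p' (T ` A))
    = ennreal \<bar>det (matrix L)\<bar> * emeasure (chart_measure p) (cimg p A)"
proof -
  let ?g = "coord C p' \<circ> T \<circ> pt C p"
  let ?S = "cimg p A"
  have S: "?S \<in> sets borel" "?S \<subseteq> img p" using cimg_borel[OF A(1)] by auto
  have gS: "?g ` ?S = cimg p' (T ` A)"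
  proof -
    have "?g ` ?S = coord C p' ` T ` A"
      unfolding image_comp[symmetric] using A(2) by (force simp: image_iff)
    then show ?thesis using TA(2) by (simp add: Int_absorb2)
  qed
  have gSb: "?g ` ?S \<in> sets borel" "?g ` ?S \<subseteq> img p'"
    unfolding gS using cimg_borel[OF TA(1)] by auto
  have "\<exists>D. (?g has_derivative D) (at x) \<and> \<bar>det (matrix D)\<bar> * rho p' (?g x) = \<bar>det (matrix L)\<bar> * rho p x"
    if x: "x \<in> ?S" for x
  proof -
    define q where "q = pt C p x"
    have q: "q \<in> A" "q \<in> dom_of C p" "x = coord C p q" "T q \<in> dom_of C p'"
      using x TA(2) by (auto simp: q_def)
    from mdiff_chart[OF T(1) q(2,4)] obtain D where D: "(?g has_derivative D) (at (coord C p q))"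
      "\<And>V. D (fder C (coord C p) q V) = fder C (coord C p') (T q) (mder C T q V)" by blast
    have xi: "x \<in> img p" and gi: "?g x \<in> img p'" using q by auto
    have qx: "pt C p x = q" "pt C p' (?g x) = T q" using q by auto
    have Ex: "Emat p x = matrix (fder C (coord C p) q \<circ> fr q)"
      unfolding Emat_matrix[OF xi] qx(1) ..
    have Eg: "Emat p' (?g x) = matrix (fder C (coord C p') (T q) \<circ> fr (T q))"
      unfolding Emat_matrix[OF gi] qx(2) ..
    \<comment> \<open>The chart derivative of \<open>T\<close> conjugates \<open>L\<close> by the
      frame matrices at source and target; taking determinants, Jacobian times target density is a
      constant multiple of the source density.\<close>
    have "D \<circ> (fder C (coord C p) q \<circ> fr q) = (fder C (coord C p') (T q) \<circ> fr (T q)) \<circ> L"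
      by (auto simp: D(2) TL)
    then have "matrix (D \<circ> (fder C (coord C p) q \<circ> fr q)) = matrix ((fder C (coord C p') (T q) \<circ> fr (T q)) \<circ> L)"
      by simp
    then have "matrix D ** Emat p x = Emat p' (?g x) ** matrix L"
      using matrix_compose[OF linear_compose[OF linear_fr linear_fder_coord[OF q(2)]] has_derivative_linear[OF D(1)]]
        matrix_compose[OF L linear_compose[OF linear_fr linear_fder_coord[OF q(4)]]]
      unfolding Ex Eg by simp
    then have "det (matrix D) * det (Emat p x) = det (Emat p' (?g x)) * det (matrix L)"
      by (metis det_mul)
    then have "\<bar>det (matrix D)\<bar> * \<bar>det (Emat p x)\<bar> = \<bar>det (Emat p' (?g x))\<bar> * \<bar>det (matrix L)\<bar>"
      by (metis abs_mult)
    then have "\<bar>det (matrix D)\<bar> * rho p' (?g x) = \<bar>det (matrix L)\<bar> * rho p x"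
      using det_Emat[OF xi] det_Emat[OF gi] by (simp add: rho_def field_simps)
    then show ?thesis using D(1) q(3) by auto
  qed
  then obtain g' where g': "\<And>x. x \<in> ?S \<Longrightarrow> (?g has_derivative g' x) (at x)"
    "\<And>x. x \<in> ?S \<Longrightarrow> \<bar>det (matrix (g' x))\<bar> * rho p' (?g x) = \<bar>det (matrix L)\<bar> * rho p x"
    by metis
  have inj: "inj_on ?g ?S"
  proof (rule inj_onI)
    fix x y assume x: "x \<in> ?S" and y: "y \<in> ?S" and xy: "?g x = ?g y"
    obtain a b where ab: "a \<in> A" "x = coord C p a" "b \<in> A" "y = coord C p b" using x y by auto
    moreover from ab have "a \<in> dom_of C p" "b \<in> dom_of C p" using A(2) by auto
    ultimately have "coord C p' (T a) = coord C p' (T b)" "T a \<in> dom_of C p'" "T b \<in> dom_of C p'"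
      using xy TA(2) by auto
    then have "T a = T b" by (metis pt_coord)
    then show "x = y" using injD[OF T(2)] ab by blast
  qed
  have ind: "indicator ?S x *\<^sub>R (\<bar>det (matrix (g' x))\<bar> * rho p' (?g x))
      = \<bar>det (matrix L)\<bar> * (indicator ?S x *\<^sub>R rho p x)" for x
    using g'(2)[of x] by (cases "x \<in> ?S") auto
  have "emeasure (chart_measure p') (cimg p' (T ` A))
      = (\<integral>\<^sup>+y. ennreal (indicator (?g ` ?S) y *\<^sub>R rho p' y) \<partial>lborel)"
    using emeasure_chart_measure[OF gSb] by (simp only: gS)
  also have "\<dots> = (\<integral>\<^sup>+x. ennreal (indicator ?S x *\<^sub>R (\<bar>det (matrix (g' x))\<bar> * rho p' (?g x))) \<partial>lborel)"
  proof (rule nn_integral_change_of_variables[OF S(1) g'(1) inj rho_nonneg])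
    show "(\<lambda>y. indicator (?g ` ?S) y *\<^sub>R rho p' y) \<in> borel_measurable borel"
      by (rule measurable_rho[OF gSb])
    show "(\<lambda>x. indicator ?S x *\<^sub>R (\<bar>det (matrix (g' x))\<bar> * rho p' (?g x))) \<in> borel_measurable borel"
      unfolding ind using measurable_rho[OF S] by simp
  qed auto
  also have "\<dots> = (\<integral>\<^sup>+x. ennreal \<bar>det (matrix L)\<bar> * ennreal (indicator ?S x *\<^sub>R rho p x) \<partial>lborel)"
    unfolding ind using rho_nonneg by (intro nn_integral_cong) (simp add: ennreal_mult)
  also have "\<dots> = ennreal \<bar>det (matrix L)\<bar> * emeasure (chart_measure p) ?S"
    unfolding emeasure_chart_measure[OF S] by (rule nn_integral_cmult) (use measurable_rho[OF S] in simp)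
  finally show ?thesis .
qed


section \<open>Gluing the chart measures along a countable partition\<close>

lemma cimg_disjoint: "A \<inter> B = {} \<Longrightarrow> cimg p A \<inter> cimg p B = {}"
  using inj_on_image_Int[of "coord C p" "dom_of C p" "A \<inter> dom_of C p" "B \<inter> dom_of C p"]
    homeomorphism_apply1[OF homeo] by (metis Int_empty_left Int_left_commute Int_lower2 image_empty inf_assoc inj_on_inverseI)

lemma chart_measure_suminf:
  fixes A :: "nat \<Rightarrow> 'g set"
  assumes "\<And>i. A i \<in> sets borel" "disjoint_family A"
  shows "(\<Sum>i. emeasure (chart_measure p) (cimg p (A i))) = emeasure (chart_measure p) (cimg p (\<Union>i. A i))"
proof -
  have "(\<Sum>i. emeasure (chart_measure p) (cimg p (A i))) = emeasure (chart_measure p) (\<Union>i. cimg p (A i))"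
  proof (rule suminf_emeasure)
    show "range (\<lambda>i. cimg p (A i)) \<subseteq> sets (chart_measure p)"
      using cimg_borel[OF assms(1)] by auto
    show "disjoint_family (\<lambda>i. cimg p (A i))"
      using assms(2) cimg_disjoint unfolding disjoint_family_on_def by blast
  qed
  also have "(\<Union>i. cimg p (A i)) = cimg p (\<Union>i. A i)" by blast
  finally show ?thesis .
qed

definition cover :: "nat \<Rightarrow> 'g" where
  "cover = (SOME c. (\<Union>n. dom_of C (c n)) = UNIV)"

definition piece :: "nat \<Rightarrow> 'g set" where
  "piece = disjointed (\<lambda>n. dom_of C (cover n))"

lemma Union_cover: "(\<Union>n. dom_of C (cover n)) = UNIV"
proof -
  obtain F where F: "F \<subseteq> range (dom_of C)" "countable F" "\<Union>F = \<Union>(range (dom_of C))"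
    using Lindelof[of "range (dom_of C)"] open_dom by blast
  have U: "\<Union>F = UNIV" using F(3) in_dom by auto
  then have "F \<noteq> {}" by auto
  have "\<exists>p. dom_of C p = from_nat_into F n" for n
    using from_nat_into[OF \<open>F \<noteq> {}\<close>, of n] F(1) by (metis imageE subsetD)
  then obtain c where c: "\<And>n. dom_of C (c n) = from_nat_into F n" by metis
  have "(\<Union>n. dom_of C (c n)) = UNIV"
    using U range_from_nat_into[OF \<open>F \<noteq> {}\<close> F(2)] by (simp add: c)
  then show ?thesis unfolding cover_def by (rule someI[where P="\<lambda>c. (\<Union>n. dom_of C (c n)) = UNIV"])
qed

lemma piece_borel: "piece n \<in> sets borel"
proof -
  have "range (\<lambda>n. dom_of C (cover n)) \<subseteq> sets borel"
    using open_dom by (auto intro: borel_open)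
  from sets.range_disjointed_sets[OF this] show ?thesis by (auto simp: piece_def)
qed

lemma piece_subset: "piece n \<subseteq> dom_of C (cover n)"
  and disjoint_piece: "disjoint_family piece"
  and Union_piece: "(\<Union>n. piece n) = UNIV"
  by (auto simp: piece_def disjointed_subset disjoint_family_disjointed UN_disjointed_eq Union_cover
      dest: subsetD[OF disjointed_subset])

lemma suminf_piece:
  assumes "A \<in> sets borel"
  shows "(\<Sum>n. emeasure (chart_measure p) (cimg p (A \<inter> piece n))) = emeasure (chart_measure p) (cimg p A)"
proof -
  have "(\<Union>n. A \<inter> piece n) = A" using Union_piece by auto
  moreover have "disjoint_family (\<lambda>n. A \<inter> piece n)"
    using disjoint_piece by (auto simp: disjoint_family_on_def)
  ultimately show ?thesis
    using chart_measure_suminf[of "\<lambda>n. A \<inter> piece n" p] assms piece_borel by auto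
qed

lemma piece_unique: "x \<in> piece m \<Longrightarrow> x \<in> piece n \<Longrightarrow> m = n"
  using disjoint_piece by (auto simp: disjoint_family_on_def)

lemma piece_cover: "\<exists>n. x \<in> piece n"
  using Union_piece by auto

text \<open>With the sum over the pieces written as an integral over a counting measure, countable
  additivity is an exchange of that integral with a sum.\<close>

definition haar :: "'g measure" where
  "haar = measure_of UNIV (sets borel)
     (\<lambda>A. \<integral>\<^sup>+n. emeasure (chart_measure (cover n)) (cimg (cover n) (A \<inter> piece n)) \<partial>count_space UNIV)"

lemma sets_haar [measurable_cong, simp]: "sets haar = sets borel"
  and space_haar [simp]: "space haar = UNIV"
  using sets.sigma_sets_eq[of "borel :: 'g measure"]
  by (simp_all add: haar_def sets_measure_of_conv space_measure_of_conv)

lemma emeasure_haar: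
  assumes "A \<in> sets borel"
  shows "emeasure haar A = (\<Sum>n. emeasure (chart_measure (cover n)) (cimg (cover n) (A \<inter> piece n)))"
proof -
  let ?\<mu> = "\<lambda>A. \<integral>\<^sup>+n. emeasure (chart_measure (cover n)) (cimg (cover n) (A \<inter> piece n)) \<partial>count_space UNIV"
  have "emeasure haar A = ?\<mu> A"
  proof (rule emeasure_measure_of[OF haar_def])
    show "sets (borel :: 'g measure) \<subseteq> Pow UNIV" by simp
    show "A \<in> sets haar" using assms by simp
    show "positive (sets haar) ?\<mu>" by (simp add: positive_def)
    show "countably_additive (sets haar) ?\<mu>"
      unfolding countably_additive_def
    proof (intro allI impI)
      fix B :: "nat \<Rightarrow> 'g set"
      assume B: "range B \<subseteq> sets haar" "disjoint_family B" "\<Union> (range B) \<in> sets haar"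
      have "(\<Sum>i. ?\<mu> (B i)) = (\<integral>\<^sup>+n. (\<Sum>i. emeasure (chart_measure (cover n)) (cimg (cover n) (B i \<inter> piece n))) \<partial>count_space UNIV)"
        by (rule nn_integral_suminf[symmetric]) simp
      also have "\<dots> = ?\<mu> (\<Union> (range B))"
      proof (rule nn_integral_cong)
        fix n
        have "disjoint_family (\<lambda>i. B i \<inter> piece n)"
          using B(2) by (auto simp: disjoint_family_on_def)
        then show "(\<Sum>i. emeasure (chart_measure (cover n)) (cimg (cover n) (B i \<inter> piece n)))
            = emeasure (chart_measure (cover n)) (cimg (cover n) (\<Union> (range B) \<inter> piece n))"
          using chart_measure_suminf[of "\<lambda>i. B i \<inter> piece n" "cover n"] B(1) piece_borel by auto
      qed
      finally show "(\<Sum>i. ?\<mu> (B i)) = ?\<mu> (\<Union> (range B))" .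
    qed
  qed
  then show ?thesis by (simp add: nn_integral_count_space_nat)
qed

text \<open>\<open>A\<close> is cut by the pieces containing its points and by those containing
  their images, so that each \<open>Q n m\<close> lies in one source chart and maps into one target
  chart; the double sum is then reordered. The continuous inverse \<open>T'\<close> makes images of
  Borel sets Borel.\<close>

lemma haar_transform:
  fixes T :: "'g \<Rightarrow> 'g" and L :: "real^3 \<Rightarrow> real^3"
  assumes T: "\<And>q. mdiff T q" and T': "continuous_on UNIV T'" "\<And>x. T' (T x) = x" "\<And>x. T (T' x) = x"
    and L: "linear L" and TL: "\<And>q x. mder C T q (fr q x) = fr (T q) (L x)"
    and A: "A \<in> sets borel"
  shows "emeasure haar (T ` A) = ennreal \<bar>det (matrix L)\<bar> * emeasure haar A"
proof -
  let ?d = "ennreal \<bar>det (matrix L)\<bar>"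
  have inj: "inj T" using T'(2) by (metis injI)
  have im: "T ` B = T' -` B" for B
    by (auto simp: T'(2)) (metis T'(3) image_eqI)
  have Tb: "T ` B \<in> sets borel" if "B \<in> sets borel" for B
    using measurable_sets[OF borel_measurable_continuous_onI[OF T'(1)] that] by (simp add: im)
  have Tcont: "continuous_on UNIV T"
    using T by (simp add: mdiff_def continuous_on_eq_continuous_at)
  define Q where "Q = (\<lambda>n m. A \<inter> piece n \<inter> T -` piece m)"
  have Qb: "Q n m \<in> sets borel" for n m
    using measurable_sets[OF borel_measurable_continuous_onI[OF Tcont] piece_borel[of m]] A piece_borel[of n]
    by (simp add: Q_def)
  define a where "a = (\<lambda>n m. emeasure (chart_measure (cover n)) (cimg (cover n) (Q n m)))"
  have step: "emeasure (chart_measure (cover m)) (cimg (cover m) (T ` (Q n m))) = ?d * a n m" for n m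
    unfolding a_def
    by (rule chart_measure_transform[OF T inj L TL Qb _ Tb[OF Qb]])
      (use piece_subset in \<open>auto simp: Q_def\<close>)
  have "emeasure haar (T ` A) = (\<Sum>m. emeasure (chart_measure (cover m)) (cimg (cover m) (T ` A \<inter> piece m)))"
    by (rule emeasure_haar[OF Tb[OF A]])
  also have "\<dots> = (\<Sum>m. \<Sum>n. ?d * a n m)"
  proof (rule suminf_cong)
    fix m
    have "(\<Union>n. T ` Q n m) = T ` A \<inter> piece m"
      using piece_cover by (fastforce simp: Q_def)
    moreover have "disjoint_family (\<lambda>n. T ` Q n m)"
      using inj by (auto simp: disjoint_family_on_def Q_def inj_eq dest: piece_unique)
    ultimately show "emeasure (chart_measure (cover m)) (cimg (cover m) (T ` A \<inter> piece m)) = (\<Sum>n. ?d * a n m)"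
      using chart_measure_suminf[of "\<lambda>n. T ` Q n m" "cover m"] Tb[OF Qb] by (simp add: step)
  qed
  also have "\<dots> = (\<integral>\<^sup>+m. (\<Sum>n. ?d * a n m) \<partial>count_space UNIV)"
    by (rule nn_integral_count_space_nat[symmetric])
  also have "\<dots> = (\<Sum>n. \<integral>\<^sup>+m. ?d * a n m \<partial>count_space UNIV)"
    by (rule nn_integral_suminf) simp
  also have "\<dots> = (\<Sum>n. ?d * (\<Sum>m. a n m))"
    by (simp add: nn_integral_count_space_nat ennreal_suminf_cmult)
  also have "\<dots> = ?d * (\<Sum>n. \<Sum>m. a n m)"
    by (simp add: ennreal_suminf_cmult)
  also have "(\<Sum>n. \<Sum>m. a n m) = (\<Sum>n. emeasure (chart_measure (cover n)) (cimg (cover n) (A \<inter> piece n)))"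
  proof (rule suminf_cong)
    fix n
    have "(\<Union>m. Q n m) = A \<inter> piece n" using piece_cover by (auto simp: Q_def)
    moreover have "disjoint_family (\<lambda>m. Q n m)"
      using disjoint_piece by (auto simp: disjoint_family_on_def Q_def)
    ultimately show "(\<Sum>m. a n m) = emeasure (chart_measure (cover n)) (cimg (cover n) (A \<inter> piece n))"
      using chart_measure_suminf[of "\<lambda>m. Q n m" "cover n"] Qb by (simp add: a_def)
  qed
  also have "\<dots> = emeasure haar A" by (rule emeasure_haar[OF A, symmetric])
  finally show ?thesis .
qed

text \<open>Translation by \<open>e\<close> is the identity map, so its transformation rule says
  that different charts give the same measure on their overlap; the choice of cover and pieces drops
  out.\<close>

lemma haar_chart:
  assumes A: "A \<in> sets borel" "A \<subseteq> dom_of C p"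
  shows "emeasure haar A = emeasure (chart_measure p) (cimg p A)"
proof -
  have im: "mul e ` B = B" for B by simp
  have "emeasure (chart_measure (cover n)) (cimg (cover n) (mul e ` (A \<inter> piece n)))
      = ennreal \<bar>det (matrix (\<lambda>x::real^3. x))\<bar> * emeasure (chart_measure p) (cimg p (A \<inter> piece n))" for n
  proof (rule chart_measure_transform[OF mdiff_mul_left _ linear_ident mder_left_fr])
    show "inj (mul e)" by (simp add: inj_def)
  qed (use A piece_borel[of n] piece_subset[of n] in \<open>auto simp: im\<close>)
  then have "emeasure haar A = (\<Sum>n. emeasure (chart_measure p) (cimg p (A \<inter> piece n)))"
    by (simp add: emeasure_haar[OF A(1)] im matrix_id_mat_1[unfolded id_def])
  then show ?thesis by (simp add: suminf_piece[OF A(1)])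
qed


lemma emeasure_haar_open_pos:
  assumes "open U" "p \<in> U"
  shows "emeasure haar U > 0"
proof -
  let ?W = "U \<inter> dom_of C p"
  have W: "?W \<in> sets borel" "?W \<subseteq> dom_of C p" using assms open_dom by auto
  have S: "cimg p ?W \<in> sets borel" "cimg p ?W \<subseteq> img p" "open (cimg p ?W)"
    using cimg_borel[OF W(1)] open_coord_image[OF assms(1), of p] by (auto simp: Int_assoc)
  have "emeasure (chart_measure p) (cimg p ?W) \<noteq> 0"
  proof
    assume "emeasure (chart_measure p) (cimg p ?W) = 0"
    then have "AE y in lborel. ennreal (indicator (cimg p ?W) y *\<^sub>R rho p y) = 0"
      unfolding emeasure_chart_measure[OF S(1,2)]
      using measurable_rho[OF S(1,2)] by (subst (asm) nn_integral_0_iff_AE) auto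
    then have "AE y in lborel. y \<notin> cimg p ?W"
    proof eventually_elim
      case (elim y)
      show ?case
      proof
        assume y: "y \<in> cimg p ?W"
        then have "0 < rho p y" using S(2) rho_pos by blast
        then show False using elim y by simp
      qed
    qed
    then have "cimg p ?W \<in> null_sets lborel"
      using S(1) by (subst AE_iff_null_sets) auto
    then have "negligible (cimg p ?W)"
      by (simp add: negligible_iff_null_sets null_sets_completionI)
    moreover have "coord C p p \<in> cimg p ?W"
      using assms(2) in_dom by auto
    ultimately show False using open_not_negligible[OF S(3)] by blast
  qed
  moreover have "emeasure haar ?W \<le> emeasure haar U"
    by (rule emeasure_mono) (use assms in auto)
  ultimately show ?thesis
    unfolding haar_chart[OF W] by (simp add: zero_less_iff_neq_zero) (metis zero_less_iff_neq_zero less_le_trans not_less_zero le_zero_eq)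
qed

text \<open>The density is bounded on a closed ball inside the chart. The compact set
  \<open>K\<close> is recorded for other Haar measures, about which only finiteness on compact sets
  is known.\<close>

lemma emeasure_haar_locally_finite:
  obtains U where "open U" "p \<in> U" "emeasure haar U < \<infinity>" "\<exists>K. compact K \<and> U \<subseteq> K"
proof -
  obtain d where d: "d > 0" "cball (coord C p p) d \<subseteq> img p"
    using open_img[of p] coord_self_in_img[of p] by (meson open_contains_cball)
  let ?B = "ball (coord C p p) d"
  have Bsub: "?B \<subseteq> cball (coord C p p) d" by auto
  have "compact (rho p ` cball (coord C p p) d)"
    by (intro compact_continuous_image continuous_on_subset[OF continuous_rho d(2)]) auto
  then obtain M where M: "\<And>y. y \<in> cball (coord C p p) d \<Longrightarrow> rho p y \<le> M"
    using compact_imp_bounded bounded_imp_bdd_above by (metis bdd_above.unfold imageI)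
  define U where "U = dom_of C p \<inter> coord C p -` ?B"
  have U: "open U" unfolding U_def
    by (rule continuous_open_preimage[OF continuous_coord open_dom]) auto
  have pU: "p \<in> U" using in_dom d(1) by (auto simp: U_def)
  have cU: "cimg p U = ?B"
  proof
    show "?B \<subseteq> cimg p U"
    proof
      fix y assume y: "y \<in> ?B"
      then have "y \<in> img p" using d(2) by auto
      then show "y \<in> cimg p U"
        using y by (intro image_eqI[of _ _ "pt C p y"]) (auto simp: U_def pt_in_dom)
    qed
  qed (auto simp: U_def)
  have Bi: "?B \<subseteq> img p" using d(2) by auto
  have "emeasure haar U = (\<integral>\<^sup>+y. ennreal (indicator ?B y *\<^sub>R rho p y) \<partial>lborel)"
    using haar_chart[of U p] U emeasure_chart_measure[of ?B p] Bi by (simp add: cU) (simp add: U_def)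
  also have "\<dots> \<le> (\<integral>\<^sup>+y. ennreal M * indicator ?B y \<partial>lborel)"
    by (rule nn_integral_mono) (use M in \<open>auto simp: indicator_def intro!: ennreal_leI\<close>)
  also have "\<dots> = ennreal M * emeasure lborel ?B"
    by (rule nn_integral_cmult_indicator) simp
  also have "\<dots> < \<infinity>"
    using emeasure_bounded_finite[of ?B] by (simp add: ennreal_mult_less_top)
  finally have fin: "emeasure haar U < \<infinity>" .
  have "compact (pt C p ` cball (coord C p p) d)"
    by (intro compact_continuous_image continuous_on_subset[OF continuous_pt d(2)]) auto
  moreover have "U \<subseteq> pt C p ` cball (coord C p p) d"
    by (auto simp: U_def image_iff) (metis mem_cball less_imp_le pt_coord)
  ultimately show thesis using that U pU fin by blast
qed

lemma emeasure_haar_compact: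
  assumes "compact K" shows "emeasure haar K < \<infinity>"
proof -
  obtain U where U: "\<And>p. open (U p)" "\<And>p. p \<in> U p" "\<And>p. emeasure haar (U p) < \<infinity>"
  proof -
    have "\<exists>U. open U \<and> p \<in> U \<and> emeasure haar U < \<infinity>" for p
      by (rule emeasure_haar_locally_finite[of p]) blast
    then show ?thesis using that by metis
  qed
  obtain F where F: "finite F" "K \<subseteq> (\<Union>p\<in>F. U p)"
  proof -
    have "K \<subseteq> (\<Union>p\<in>UNIV. U p)" using U(2) by blast
    then show ?thesis
      by (rule compactE_image[OF assms U(1)]) (rule that)
  qed
  have "emeasure haar K \<le> emeasure haar (\<Union>p\<in>F. U p)"
    by (rule emeasure_mono[OF F(2)]) (use U F(1) in auto)
  also have "\<dots> \<le> (\<Sum>p\<in>F. emeasure haar (U p))"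
    by (rule emeasure_subadditive_finite[OF F(1)]) (use U in auto)
  also have "\<dots> < \<infinity>" using U(3) F(1) by (simp add: less_top)
  finally show ?thesis .
qed

section \<open>Translations of the constructed measure\<close>

lemma haar_left:
  assumes "A \<in> sets borel" shows "emeasure haar (mul a ` A) = emeasure haar A"
  using haar_transform[OF mdiff_mul_left continuous_mul'[OF continuous_on_const continuous_on_id]
      _ _ linear_ident mder_left_fr assms, of "iv a" a]
  by (simp add: matrix_id_mat_1[unfolded id_def])

lemma haar_right:
  assumes "A \<in> sets borel"
  shows "emeasure haar ((\<lambda>q. mul q a) ` A) = ennreal \<bar>Delta a\<bar> * emeasure haar A"
  using haar_transform[OF mdiff_mul_right continuous_mul'[OF continuous_on_id continuous_on_const]
      _ _ linear_Ad mder_right_fr assms, of a "iv a"]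
  by (simp add: Delta_def)

lemma left_haar_haar: "left_haar mul haar"
  using emeasure_haar_open_pos[of UNIV e] emeasure_haar_compact haar_left
  by (auto simp: left_haar_def)

end

section \<open>The modular function\<close>

text \<open>Images under \<open>T\<close> are preimages under \<open>T'\<close>, so the scaling of
  sets says that the push-forward of \<open>M\<close> under \<open>T'\<close> is \<open>M\<close>
  with constant density \<open>c\<close>.\<close>

lemma nn_integral_scaling:
  assumes s: "sets M = sets borel" and T: "\<And>x. T (T' x) = x" "\<And>x. T' (T x) = x"
    and T': "T' \<in> borel_measurable borel"
    and c: "\<And>A. A \<in> sets borel \<Longrightarrow> emeasure M (T ` A) = c * emeasure M A"
    and f: "f \<in> borel_measurable borel"
  shows "(\<integral>\<^sup>+x. f (T' x) \<partial>M) = c * (\<integral>\<^sup>+x. f x \<partial>M)"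
proof -
  have sp: "space M = UNIV" using sets_eq_imp_space_eq[OF s] by simp
  have mT: "T' \<in> measurable M borel" using T' measurable_cong_sets[OF s refl] by blast
  have mf: "f \<in> borel_measurable M" using f measurable_cong_sets[OF s refl] by blast
  have mf': "f \<in> borel_measurable (distr M borel T')" using f by simp
  have im: "T ` A = T' -` A" for A
    by (auto simp: T) (metis T(1) image_eqI)
  have "distr M borel T' = density M (\<lambda>_. c)"
  proof (rule measure_eqI)
    fix A assume "A \<in> sets (distr M borel T')"
    then have A: "A \<in> sets borel" by simp
    then show "emeasure (distr M borel T') A = emeasure (density M (\<lambda>_. c)) A"
      using c[OF A] s by (simp add: emeasure_distr[OF mT] sp im emeasure_density nn_integral_cmult_indicator)
  qed (simp add: s)
  then have "(\<integral>\<^sup>+x. f x \<partial>distr M borel T') = (\<integral>\<^sup>+x. f x \<partial>density M (\<lambda>_. c))" by simp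
  then show ?thesis
    using mf by (simp add: nn_integral_distr[OF mT mf'] nn_integral_density nn_integral_cmult)
qed

context haar_group
begin

text \<open>Near \<open>q\<close>, \<open>Delta\<close> is \<open>Delta q\<close> times its value at
  the left translate by \<open>iv q\<close>, which is near \<open>e\<close>; this transports the
  derivative from \<open>e\<close> to \<open>q\<close>.\<close>

lemma Delta_has_derivative:
  assumes q: "q \<in> dom_of C p"
  obtains D where "((Delta \<circ> pt C p) has_derivative (\<lambda>V. Delta q * fder C Delta e (D V))) (at (coord C p q))"
proof -
  have he: "mul (iv q) q = e" by simp
  from mdiff_chart[OF mdiff_mul_left[of "iv q" q] q, of e] he in_dom[of e]
  obtain D where D: "((coord C e \<circ> mul (iv q) \<circ> pt C p) has_derivative D) (at (coord C p q))" by auto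
  have "((Delta \<circ> pt C e) \<circ> (coord C e \<circ> mul (iv q) \<circ> pt C p) has_derivative fder C Delta e \<circ> D) (at (coord C p q))"
    by (rule diff_chain_at[OF D]) (use Delta_derivative(1) q in simp)
  then have "((\<lambda>y. Delta q * ((Delta \<circ> pt C e) \<circ> (coord C e \<circ> mul (iv q) \<circ> pt C p)) y) has_derivative
      (\<lambda>V. Delta q * (fder C Delta e \<circ> D) V)) (at (coord C p q))"
    by (rule has_derivative_mult_right)
  moreover have "eventually (\<lambda>y. Delta q * ((Delta \<circ> pt C e) \<circ> (coord C e \<circ> mul (iv q) \<circ> pt C p)) y
      = (Delta \<circ> pt C p) y) (nhds (coord C p q))"
    using eventually_map_pt_in[OF isCont_mul_left[where a="iv q" and q=q] _ open_dom q, of e] in_dom[of e]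
    by (simp add: he) (auto elim!: eventually_mono simp flip: Delta_mul)
  ultimately show thesis
    using that[of D] by (auto dest: has_derivative_cong_nhds simp: o_def)
qed

lemma continuous_Delta: "continuous_on UNIV Delta"
proof (rule continuous_at_imp_continuous_on, rule ballI)
  fix p
  obtain D where "((Delta \<circ> pt C p) has_derivative D) (at (coord C p p))"
    using Delta_has_derivative[OF in_dom] by blast
  then have "isCont (Delta \<circ> pt C p) (coord C p p)"
    by (rule has_derivative_continuous)
  then have "isCont ((Delta \<circ> pt C p) \<circ> coord C p) p"
    unfolding o_def by (rule isCont_o2[OF isCont_coord[OF in_dom]])
  moreover have "eventually (\<lambda>x. ((Delta \<circ> pt C p) \<circ> coord C p) x = Delta x) (nhds p)"
    using eventually_nhds_in_open[OF open_dom in_dom, of p] by eventually_elim simp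
  ultimately show "isCont Delta p" by (simp add: isCont_cong)
qed

lemma fder_Delta_zero_iff:
  "(\<forall>i. fder C Delta e (E i e) = 0) \<longleftrightarrow> (\<forall>V. fder C Delta e V = 0)"
proof
  assume 0: "\<forall>i. fder C Delta e (E i e) = 0"
  have lin: "linear (fder C Delta e)"
    using Delta_derivative(1) has_derivative_linear by blast
  have "fder C Delta e (fr e x) = 0" for x
    unfolding fr_def by (simp add: linear_sum[OF lin] linear_cmul[OF lin] 0)
  then show "\<forall>V. fder C Delta e V = 0" by (metis fr_co)
qed blast

text \<open>If the absolute value is 1, the square of \<open>Delta\<close> is constant, and its
  derivative at \<open>e\<close> is twice that of \<open>Delta\<close>. Conversely the homomorphism
  property spreads a vanishing derivative from \<open>e\<close> over the group, so
  \<open>Delta\<close> is locally constant and connectedness makes it 1.\<close>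

lemma Delta_abs_one_iff:
  assumes conn: "connected (UNIV :: 'g set)"
  shows "(\<forall>a. \<bar>Delta a\<bar> = 1) \<longleftrightarrow> (\<forall>i. fder C Delta e (E i e) = 0)"
proof
  assume 1: "\<forall>a. \<bar>Delta a\<bar> = 1"
  have "((\<lambda>z. (Delta \<circ> pt C e) z * (Delta \<circ> pt C e) z) has_derivative
      (\<lambda>V. (Delta \<circ> pt C e) (coord C e e) * fder C Delta e V
        + fder C Delta e V * (Delta \<circ> pt C e) (coord C e e))) (at (coord C e e))"
    by (rule has_derivative_mult[OF Delta_derivative(1) Delta_derivative(1)])
  moreover have "(\<lambda>z. (Delta \<circ> pt C e) z * (Delta \<circ> pt C e) z) = (\<lambda>z. 1)"
  proof
    fix z show "(Delta \<circ> pt C e) z * (Delta \<circ> pt C e) z = 1"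
      using 1 abs_mult_self_eq[of "Delta (pt C e z)"] by simp
  qed
  ultimately have "((\<lambda>z::real^3. 1::real) has_derivative (\<lambda>V. 2 * fder C Delta e V)) (at (coord C e e))"
    by simp
  from has_derivative_unique[OF this has_derivative_const]
  show "\<forall>i. fder C Delta e (E i e) = 0" by (simp add: fun_eq_iff)
next
  assume "\<forall>i. fder C Delta e (E i e) = 0"
  then have 0: "fder C Delta e V = 0" for V using fder_Delta_zero_iff by blast
  have der0: "((Delta \<circ> pt C p) has_derivative (\<lambda>V. 0)) (at y)" if "y \<in> img p" for p y
    using Delta_has_derivative[OF pt_in_dom[OF that]] that by (auto simp: 0)
  have "eventually (\<lambda>b. Delta p = Delta b) (at p)" for p
  proof -
    obtain d where d: "d > 0" "ball (coord C p p) d \<subseteq> img p"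
      using open_img[of p] coord_self_in_img[of p] by (meson open_contains_ball)
    have const: "(Delta \<circ> pt C p) y = (Delta \<circ> pt C p) (coord C p p)" if y: "y \<in> ball (coord C p p) d" for y
    proof -
      have "\<exists>c. \<forall>x\<in>ball (coord C p p) d. (Delta \<circ> pt C p) x = c"
        by (rule has_derivative_zero_constant[OF convex_ball])
          (use der0 d(2) in \<open>blast intro: has_derivative_at_withinI\<close>)
      then show ?thesis using y d(1) by (metis centre_in_ball)
    qed
    have "eventually (\<lambda>b. coord C p b \<in> ball (coord C p p) d) (at p)"
      using topological_tendstoD[OF isCont_coord[OF in_dom, unfolded isCont_def] open_ball, of p "coord C p p" d] d(1)
      by simp
    moreover have "eventually (\<lambda>b. b \<in> dom_of C p) (at p)"
      using eventually_nhds_in_open[OF open_dom in_dom, of p] by (simp add: eventually_nhds_conv_at)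
    ultimately show ?thesis
      by eventually_elim (use const in force)
  qed
  then have "Delta a = Delta e" for a
    using connected_local_const[OF conn, of a e Delta] by simp
  then show "\<forall>a. \<bar>Delta a\<bar> = 1" by simp
qed

text \<open>Every point has an open neighbourhood inside a compact set, and by the Lindelof property
  countably many of them cover the group.\<close>

lemma sigma_finite_of_compact_finite:
  fixes M :: "'g measure"
  assumes s: "sets M = sets borel" and fin: "\<And>K. compact K \<Longrightarrow> emeasure M K < \<infinity>"
  shows "\<exists>F. countable F \<and> (\<forall>U\<in>F. open U \<and> emeasure M U < \<infinity>) \<and> \<Union>F = UNIV"
proof -
  have "\<exists>U. open U \<and> p \<in> U \<and> emeasure M U < \<infinity>" for p
  proof -
    obtain U K where U: "open U" "p \<in> U" "compact K" "U \<subseteq> K"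
      using emeasure_haar_locally_finite[of p] by metis
    have "emeasure M U \<le> emeasure M K"
      by (rule emeasure_mono[OF U(4)]) (use s borel_closed[OF compact_imp_closed[OF U(3)]] in simp)
    then show ?thesis using U fin[OF U(3)] by (meson le_less_trans)
  qed
  then obtain U where U: "\<And>p. open (U p)" "\<And>p. p \<in> U p" "\<And>p. emeasure M (U p) < \<infinity>" by metis
  obtain F where F: "F \<subseteq> range U" "countable F" "\<Union>F = \<Union>(range U)"
    using Lindelof[of "range U"] U(1) by blast
  have "\<Union>F = UNIV" using F(3) U(2) by auto
  moreover have "open V \<and> emeasure M V < \<infinity>" if "V \<in> F" for V
    using subsetD[OF F(1) that] U(1,3) by (metis imageE)
  ultimately show ?thesis using F(2) by blast
qed

lemma sigma_finite_measureI_compact: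
  fixes M :: "'g measure"
  assumes s: "sets M = sets borel" and fin: "\<And>K. compact K \<Longrightarrow> emeasure M K < \<infinity>"
  shows "sigma_finite_measure M"
proof
  obtain F where F: "countable F" "\<forall>U\<in>F. open U \<and> emeasure M U < \<infinity>" "\<Union>F = UNIV"
    proof -
      have "\<exists>F. countable F \<and> (\<forall>U\<in>F. open U \<and> emeasure M U < \<infinity>) \<and> \<Union>F = UNIV"
        by (rule sigma_finite_of_compact_finite[OF s fin])
      then show ?thesis by (elim exE conjE) (rule that)
    qed
  have "space M = UNIV" using sets_eq_imp_space_eq[OF s] by simp
  then show "\<exists>A. countable A \<and> A \<subseteq> sets M \<and> \<Union>A = space M \<and> (\<forall>a\<in>A. emeasure M a \<noteq> \<infinity>)"
    using F s by (intro exI[of _ F]) (auto simp: less_top)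
qed

section \<open>Comparison of two Haar measures\<close>

lemma measurable_mul [measurable (raw)]:
  assumes "f \<in> borel_measurable M" "h \<in> borel_measurable M"
  shows "(\<lambda>x. mul (f x) (h x)) \<in> borel_measurable M"
  by (rule borel_measurable_continuous_Pair[OF assms])
    (use continuous_mul in \<open>simp add: case_prod_beta'\<close>)

lemma measurable_iv [measurable]: "iv \<in> borel_measurable borel"
  and measurable_Delta [measurable]: "Delta \<in> borel_measurable borel"
  by (rule borel_measurable_continuous_onI continuous_iv continuous_Delta)+

lemma iv_mul: "iv (mul a b) = mul (iv b) (iv a)"
proof -
  have "mul (mul a b) (mul (iv b) (iv a)) = e" by (simp add: mul_assoc)
  then have "mul (iv (mul a b)) (mul (mul a b) (mul (iv b) (iv a))) = iv (mul a b)" by simp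
  then show ?thesis by simp
qed

text \<open>Weil's comparison of two Haar measures: evaluating the integral of \<open>1\<^sub>A(y) 1\<^sub>B(yx)\<close> in both orders
  shows that a bi-invariant measure is a multiple of \<open>\<bar>Delta\<bar>\<^sup>-\<^sup>1\<close> times \<open>haar\<close>; both being
  left-invariant, \<open>\<bar>Delta\<bar> = 1\<close>.\<close>

lemma unimodular_imp_Delta:
  assumes "unimodular mul"
  shows "\<bar>Delta a\<bar> = 1"
proof -
  obtain \<mu> where \<mu>: "left_haar mul \<mu>"
    and R: "\<And>a A. A \<in> sets borel \<Longrightarrow> emeasure \<mu> ((\<lambda>q. mul q a) ` A) = emeasure \<mu> A"
    using assms by (auto simp: unimodular_def)
  have s [measurable_cong]: "sets \<mu> = sets borel" and nz: "emeasure \<mu> UNIV \<noteq> 0"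
    and fin: "\<And>K. compact K \<Longrightarrow> emeasure \<mu> K < \<infinity>"
    and L: "\<And>a A. A \<in> sets borel \<Longrightarrow> emeasure \<mu> (mul a ` A) = emeasure \<mu> A"
    using \<mu> by (auto simp: left_haar_def)
  interpret \<mu>: sigma_finite_measure \<mu> by (rule sigma_finite_measureI_compact[OF s fin])
  interpret \<nu>: sigma_finite_measure haar by (rule sigma_finite_measureI_compact[OF sets_haar emeasure_haar_compact])
  interpret pair_sigma_finite haar \<mu> ..
  have \<mu>L: "(\<integral>\<^sup>+x. f (mul a x) \<partial>\<mu>) = (\<integral>\<^sup>+x. f x \<partial>\<mu>)" if "f \<in> borel_measurable borel" for f a
    using nn_integral_scaling[of \<mu> "mul (iv a)" "mul a" 1 f, OF s _ _ _ _ that] L by simp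
  have \<mu>R: "(\<integral>\<^sup>+x. f (mul x a) \<partial>\<mu>) = (\<integral>\<^sup>+x. f x \<partial>\<mu>)" if "f \<in> borel_measurable borel" for f a
    using nn_integral_scaling[of \<mu> "\<lambda>x. mul x (iv a)" "\<lambda>x. mul x a" 1 f, OF s _ _ _ _ that] R by simp
  have \<nu>L: "(\<integral>\<^sup>+x. f (mul a x) \<partial>haar) = (\<integral>\<^sup>+x. f x \<partial>haar)" if "f \<in> borel_measurable borel" for f a
    using nn_integral_scaling[of haar "mul (iv a)" "mul a" 1 f, OF sets_haar _ _ _ _ that] haar_left by simp
  \<comment> \<open>Preimages under right translation by \<open>a\<close> are translates by
    \<open>iv a\<close>; hence the inverse in the scaling factor for integrals.\<close>
  define \<delta> where "\<delta> = (\<lambda>x. ennreal \<bar>Delta (iv x)\<bar>)"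
  have \<delta>m [measurable]: "\<delta> \<in> borel_measurable borel" unfolding \<delta>_def by measurable
  have \<delta>_mul: "\<delta> (mul x y) = \<delta> x * \<delta> y" for x y
    by (simp add: \<delta>_def iv_mul Delta_mul abs_mult ennreal_mult mult.commute)
  have \<nu>R: "(\<integral>\<^sup>+x. f (mul x a) \<partial>haar) = \<delta> a * (\<integral>\<^sup>+x. f x \<partial>haar)" if "f \<in> borel_measurable borel" for f a
    using nn_integral_scaling[of haar "\<lambda>x. mul x (iv a)" "\<lambda>x. mul x a" "\<delta> a" f, OF sets_haar _ _ _ _ that]
      haar_right[of _ "iv a"] by (simp add: \<delta>_def)
  obtain A where A: "open A" "e \<in> A" "emeasure haar A < \<infinity>"
    using emeasure_haar_locally_finite by metis
  have A0: "emeasure haar A > 0" by (rule emeasure_haar_open_pos[OF A(1,2)])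
  have Ab [measurable]: "A \<in> sets borel" using A(1) by simp
  define K where "K = (\<integral>\<^sup>+x. \<delta> x * indicator A (iv x) \<partial>\<mu>)"
  have key: "emeasure haar A * emeasure \<mu> B = K * (\<integral>\<^sup>+y. indicator B y * \<delta> y \<partial>haar)"
    if Bb [measurable]: "B \<in> sets borel" for B
  proof -
    have "emeasure haar A * emeasure \<mu> B = (\<integral>\<^sup>+y. indicator A y * emeasure \<mu> B \<partial>haar)"
      by (simp add: nn_integral_multc)
    also have "\<dots> = (\<integral>\<^sup>+y. (\<integral>\<^sup>+x. indicator A y * indicator B (mul y x) \<partial>\<mu>) \<partial>haar)"
    proof (rule nn_integral_cong)
      fix y
      have "(\<integral>\<^sup>+x. indicator A y * indicator B (mul y x) \<partial>\<mu>) = indicator A y * (\<integral>\<^sup>+x. indicator B (mul y x) \<partial>\<mu>)"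
        by (rule nn_integral_cmult) measurable
      also have "(\<integral>\<^sup>+x. indicator B (mul y x) \<partial>\<mu>) = (\<integral>\<^sup>+x. indicator B x \<partial>\<mu>)"
        by (rule \<mu>L) measurable
      finally show "indicator A y * emeasure \<mu> B = (\<integral>\<^sup>+x. indicator A y * indicator B (mul y x) \<partial>\<mu>)"
        using s by simp
    qed
    also have "\<dots> = (\<integral>\<^sup>+x. (\<integral>\<^sup>+y. indicator A y * indicator B (mul y x) \<partial>haar) \<partial>\<mu>)"
      by (rule Fubini'[symmetric]) measurable
    also have "\<dots> = (\<integral>\<^sup>+x. (\<integral>\<^sup>+y. \<delta> x * (indicator A (mul y (iv x)) * indicator B y) \<partial>haar) \<partial>\<mu>)"
    proof (rule nn_integral_cong)
      fix x
      have "(\<integral>\<^sup>+y. indicator A y * indicator B (mul y x) \<partial>haar)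
          = (\<integral>\<^sup>+y. (\<lambda>y. indicator A (mul y (iv x)) * indicator B y) (mul y x) \<partial>haar)"
        by simp
      also have "\<dots> = \<delta> x * (\<integral>\<^sup>+y. indicator A (mul y (iv x)) * indicator B y \<partial>haar)"
        by (rule \<nu>R) measurable
      also have "\<dots> = (\<integral>\<^sup>+y. \<delta> x * (indicator A (mul y (iv x)) * indicator B y) \<partial>haar)"
        by (rule nn_integral_cmult[symmetric]) measurable
      finally show "(\<integral>\<^sup>+y. indicator A y * indicator B (mul y x) \<partial>haar)
          = (\<integral>\<^sup>+y. \<delta> x * (indicator A (mul y (iv x)) * indicator B y) \<partial>haar)" .
    qed
    also have "\<dots> = (\<integral>\<^sup>+y. (\<integral>\<^sup>+x. \<delta> x * (indicator A (mul y (iv x)) * indicator B y) \<partial>\<mu>) \<partial>haar)"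
      by (rule Fubini') measurable
    also have "\<dots> = (\<integral>\<^sup>+y. K * (indicator B y * \<delta> y) \<partial>haar)"
    proof (rule nn_integral_cong)
      \<comment> \<open>Right invariance of \<open>\<mu>\<close> allows \<open>mul x y\<close> in
        place of \<open>x\<close>; then \<open>mul y (iv x)\<close> becomes \<open>iv x\<close>, and
        the dependence on \<open>y\<close> splits off, leaving \<open>K\<close>.\<close>
      fix y
      have "(\<integral>\<^sup>+x. \<delta> x * (indicator A (mul y (iv x)) * indicator B y) \<partial>\<mu>)
          = (\<integral>\<^sup>+x. (\<lambda>x. \<delta> x * (indicator A (mul y (iv x)) * indicator B y)) (mul x y) \<partial>\<mu>)"
        by (rule \<mu>R[symmetric]) measurable
      also have "\<dots> = (\<integral>\<^sup>+x. (indicator B y * \<delta> y) * (\<delta> x * indicator A (iv x)) \<partial>\<mu>)"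
        by (rule nn_integral_cong) (simp add: iv_mul \<delta>_mul mult_ac)
      also have "\<dots> = (indicator B y * \<delta> y) * K"
        unfolding K_def by (rule nn_integral_cmult) measurable
      finally show "(\<integral>\<^sup>+x. \<delta> x * (indicator A (mul y (iv x)) * indicator B y) \<partial>\<mu>) = K * (indicator B y * \<delta> y)"
        by (simp add: mult.commute)
    qed
    also have "\<dots> = K * (\<integral>\<^sup>+y. indicator B y * \<delta> y \<partial>haar)"
      by (rule nn_integral_cmult) measurable
    finally show ?thesis .
  qed
  obtain B where B: "open B" "emeasure \<mu> B < \<infinity>" "emeasure \<mu> B > 0"
  proof -
    obtain F where F: "countable F" "\<forall>U\<in>F. open U \<and> emeasure \<mu> U < \<infinity>" "\<Union>F = UNIV"
      proof -
      have "\<exists>F. countable F \<and> (\<forall>U\<in>F. open U \<and> emeasure \<mu> U < \<infinity>) \<and> \<Union>F = UNIV"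
        by (rule sigma_finite_of_compact_finite[OF s fin])
      then show ?thesis by (elim exE conjE) (rule that)
    qed
    \<comment> \<open>Otherwise the whole group would be a countable union of null sets.\<close>
    have "\<exists>U\<in>F. emeasure \<mu> U \<noteq> 0"
    proof (rule ccontr)
      assume "\<not> ?thesis"
      then have "U \<in> null_sets \<mu>" if "U \<in> F" for U
        using that F(2) s by (auto intro!: null_setsI)
      then have "(\<Union>U\<in>F. U) \<in> null_sets \<mu>" by (rule null_sets_UN'[OF F(1)])
      then show False using F(3) nz by auto
    qed
    then show thesis using F(2) that by (metis zero_less_iff_neq_zero)
  qed
  have Bb [measurable]: "B \<in> sets borel" using B(1) by simp
  have aB [measurable]: "mul a ` B \<in> sets borel"
  proof -
    have "mul a ` B = mul (iv a) -` B" by (auto simp: image_iff) (metis mul_iv_cancel(1))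
    moreover have "mul (iv a) -` B \<inter> space borel \<in> sets borel" by measurable
    ultimately show ?thesis by simp
  qed
  have "emeasure haar A * emeasure \<mu> (mul a ` B) = K * (\<integral>\<^sup>+y. indicator (mul a ` B) y * \<delta> y \<partial>haar)"
    by (rule key) measurable
  also have "(\<integral>\<^sup>+y. indicator (mul a ` B) y * \<delta> y \<partial>haar)
      = (\<integral>\<^sup>+y. (\<lambda>y. indicator (mul a ` B) y * \<delta> y) (mul a y) \<partial>haar)"
    by (rule \<nu>L[symmetric]) measurable
  also have "\<dots> = (\<integral>\<^sup>+y. \<delta> a * (indicator B y * \<delta> y) \<partial>haar)"
  proof (rule nn_integral_cong)
    fix y
    have "mul a y \<in> mul a ` B \<longleftrightarrow> y \<in> B" by (auto simp: image_iff) (metis mul_iv_cancel(2))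
    then show "(\<lambda>y. indicator (mul a ` B) y * \<delta> y) (mul a y) = \<delta> a * (indicator B y * \<delta> y)"
      by (simp add: \<delta>_mul indicator_def)
  qed
  also have "\<dots> = \<delta> a * (\<integral>\<^sup>+y. indicator B y * \<delta> y \<partial>haar)"
    by (rule nn_integral_cmult) measurable
  \<comment> \<open>\<open>K\<close> is not known to be finite, so it is eliminated through
    \<open>key\<close> instead of being cancelled; what is cancelled later is the product of
    \<open>emeasure haar A\<close> and \<open>emeasure \<mu> B\<close>, positive and finite by
    choice of \<open>A\<close> and \<open>B\<close>.\<close>
  also have "K * \<dots> = \<delta> a * (emeasure haar A * emeasure \<mu> B)"
    unfolding key[OF Bb] by (simp add: mult_ac)
  finally have eq: "emeasure haar A * emeasure \<mu> B = \<delta> a * (emeasure haar A * emeasure \<mu> B)"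
    unfolding L[OF Bb] .
  obtain u where u: "emeasure haar A = ennreal u" "u > 0"
    using A(3) A0 by (cases "emeasure haar A") auto
  obtain v where v: "emeasure \<mu> B = ennreal v" "v > 0"
    using B(2,3) by (cases "emeasure \<mu> B") auto
  have "ennreal (u * v) = ennreal (\<bar>Delta (iv a)\<bar> * (u * v))"
    using eq u v by (simp add: \<delta>_def ennreal_mult)
  then have "u * v = \<bar>Delta (iv a)\<bar> * (u * v)"
    using u v by (subst (asm) ennreal_inj) auto
  then have "\<bar>Delta (iv a)\<bar> = 1" using u v by simp
  then show ?thesis
    using Delta_mul[of a "iv a"] abs_mult[of "Delta a" "Delta (iv a)"] by simp
qed

lemma unimodular_iff_Delta: "unimodular mul \<longleftrightarrow> (\<forall>a. \<bar>Delta a\<bar> = 1)"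
proof
  assume "\<forall>a. \<bar>Delta a\<bar> = 1"
  then show "unimodular mul"
    unfolding unimodular_def using left_haar_haar haar_right by (intro exI[of _ haar]) simp
qed (simp add: unimodular_imp_Delta)

theorem unimodular_iff_trace:
  assumes "connected (UNIV :: 'g set)" "\<And>i k. is_lie_bracket C (E i) (E k) (Z i k)"
  shows "unimodular mul \<longleftrightarrow> (\<forall>i p. (\<Sum>k\<in>UNIV. co p (Z i k p) $ k) = 0)"
proof -
  \<comment> \<open>The left side is free of \<open>p\<close>: the trace is the same number at every
    point.\<close>
  have D: "fder C Delta e (E i e) = - (\<Sum>k\<in>UNIV. co p (Z i k p) $ k)" for i p
    by (rule Delta_derivative(2)) (rule assms(2))
  have "fder C Delta e (E i e) = 0 \<longleftrightarrow> (\<Sum>k\<in>UNIV. co p (Z i k p) $ k) = 0" for i p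
    using D[of i p] by simp
  then have "(\<forall>i. fder C Delta e (E i e) = 0) \<longleftrightarrow> (\<forall>i p. (\<Sum>k\<in>UNIV. co p (Z i k p) $ k) = 0)"
    by blast
  then show ?thesis
    unfolding unimodular_iff_Delta Delta_abs_one_iff[OF assms(1)] .
qed

end

section \<open>The groups SU(2) and SU(1,1)\<close>

text \<open>General facts about the index type \<open>3\<close> use the indices 1, 2, 3, while the
  frame uses 0, 1, 2; both denote the same residues.\<close>

lemma three_eq_zero [simp]: "(3::3) = 0" by simp

lemma forall_3': "(\<forall>i::3. P i) \<longleftrightarrow> P 0 \<and> P 1 \<and> P 2"
  using forall_3[of P] by auto

lemma sum_3': "(\<Sum>i\<in>UNIV. f (i::3)) = f 0 + f 1 + f 2"
  using sum_3[of f] by (simp add: ac_simps)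

lemma vec3_eq_iff: "(x::'a^3) = y \<longleftrightarrow> x$0 = y$0 \<and> x$1 = y$1 \<and> x$2 = y$2"
  by (simp add: vec_eq_iff forall_3')

lemma mat2_eq_iff: "(A::'a^2^2) = B \<longleftrightarrow> A$1$1 = B$1$1 \<and> A$1$2 = B$1$2 \<and> A$2$1 = B$2$1 \<and> A$2$2 = B$2$2"
  by (simp add: vec_eq_iff forall_2)

lemma mat2_mult: "((A::'a::comm_semiring_1^2^2) ** B) $ i $ j = A$i$1 * B$1$j + A$i$2 * B$2$j"
  by (simp add: matrix_matrix_mult_def sum_2)

text \<open>The adjugate. It is the inverse on matrices of determinant 1 but linear on all matrices,
  so it can replace \<open>matrix_inv\<close> wherever a derivative is taken.\<close>

definition adj2 :: "mat2 \<Rightarrow> mat2" where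
  "adj2 M = vector [vector [M$2$2, - M$1$2], vector [- M$2$1, M$1$1]]"

lemma adj2_entries [simp]: "adj2 M $ 1 $ 1 = M$2$2" "adj2 M $ 1 $ 2 = - M$1$2"
  "adj2 M $ 2 $ 1 = - M$2$1" "adj2 M $ 2 $ 2 = M$1$1"
  by (simp_all add: adj2_def)

lemma adj2_mult: "adj2 (A ** B) = adj2 B ** adj2 A"
  by (simp add: mat2_eq_iff mat2_mult)

lemma adj2_adj2 [simp]: "adj2 (adj2 M) = M"
  by (simp add: mat2_eq_iff)

lemma adj2_mat_1 [simp]: "adj2 (mat 1) = mat 1"
  by (simp add: mat2_eq_iff mat_def)

lemma adj2_inverse:
  assumes "det M = 1"
  shows "M ** adj2 M = mat 1" "adj2 M ** M = mat 1" "matrix_inv M = adj2 M"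
proof -
  show 1: "M ** adj2 M = mat 1" "adj2 M ** M = mat 1"
    using assms by (simp_all add: mat2_eq_iff mat2_mult mat_def det_2 algebra_simps)
  then have *: "A = adj2 M" if "M ** A = mat 1" for A
    using that matrix_mul_assoc[of "adj2 M" M A] by simp
  then show "matrix_inv M = adj2 M"
    unfolding matrix_inv_def using 1 * by (metis (mono_tags, lifting) some_equality)
qed

lemma bounded_linear_adj2: "bounded_linear adj2"
  by (intro linear_conv_bounded_linear[THEN iffD1] linearI) (simp_all add: mat2_eq_iff)

lemma bounded_bilinear_mat2: "bounded_bilinear ((**) :: mat2 \<Rightarrow> mat2 \<Rightarrow> mat2)"
  by (intro bilinear_conv_bounded_bilinear[THEN iffD1] bilinear_def[THEN iffD2] conjI allI linearI)
    (simp_all add: mat2_eq_iff mat2_mult algebra_simps)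

lemma bounded_bilinear_mat2_vec: "bounded_bilinear ((*v) :: mat2 \<Rightarrow> complex^2 \<Rightarrow> complex^2)"
  by (intro bilinear_conv_bounded_bilinear[THEN iffD1] bilinear_def[THEN iffD2] conjI allI linearI)
    (simp_all add: vec_eq_iff forall_2 matrix_vector_mult_def sum_2 algebra_simps)

locale spin_signature =
  fixes r :: nat
  assumes r01: "r \<in> {0, 1}"
begin

abbreviation H where "H \<equiv> H_grp r"
abbreviation \<sigma> :: complex where "\<sigma> \<equiv> (-1)^r"

text \<open>Multiplying the defining equation on the right by the adjugate makes it linear in the
  entries of \<open>h\<close>, which can then be compared; the determinant supplies the quadratic
  equation.\<close>

lemma H_iff: "h \<in> H \<longleftrightarrow> h$2$2 = cnj (h$1$1) \<and> h$2$1 = - \<sigma> * cnj (h$1$2)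
    \<and> h$1$1 * cnj (h$1$1) + \<sigma> * (h$1$2 * cnj (h$1$2)) = 1" (is "_ \<longleftrightarrow> ?R")
proof
  assume h: "h \<in> H"
  then have d: "det h = 1" and a: "adjoint_mat h ** gamma0_pow r ** h = gamma0_pow r"
    by (auto simp: H_grp_def)
  have "adjoint_mat h ** gamma0_pow r ** h ** adj2 h = gamma0_pow r ** adj2 h"
    by (simp add: a)
  then have "adjoint_mat h ** gamma0_pow r = gamma0_pow r ** adj2 h"
    by (simp add: matrix_mul_assoc[symmetric] adj2_inverse[OF d])
  then have 1: "h$2$2 = cnj (h$1$1)" "h$2$1 = - \<sigma> * cnj (h$1$2)"
    using r01 by (auto simp: mat2_eq_iff mat2_mult adjoint_mat_def gamma0_pow_def gamma0_def mat_def)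
  then show ?R using d by (simp add: det_2 mult.left_commute)
next
  assume R: ?R
  then have d: "det h = 1" by (simp add: det_2 mult.left_commute)
  have "adjoint_mat h ** gamma0_pow r = gamma0_pow r ** adj2 h"
    using R r01 by (auto simp: mat2_eq_iff mat2_mult adjoint_mat_def gamma0_pow_def gamma0_def mat_def)
  then have "adjoint_mat h ** gamma0_pow r ** h = gamma0_pow r"
    by (simp add: matrix_mul_assoc[symmetric] adj2_inverse[OF d])
  then show "h \<in> H" using d by (simp add: H_grp_def)
qed

section \<open>Group structure and Lie algebra of \<open>H\<close>\<close>

lemma det_H: "h \<in> H \<Longrightarrow> det h = 1"
  by (simp add: H_grp_def)

lemma H_adj2 [simp]: "h \<in> H \<Longrightarrow> h ** adj2 h = mat 1" "h \<in> H \<Longrightarrow> adj2 h ** h = mat 1"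
  "h \<in> H \<Longrightarrow> matrix_inv h = adj2 h"
  using adj2_inverse det_H by blast+

lemma H_adj2_cancel [simp]: "h \<in> H \<Longrightarrow> h ** (adj2 h ** M) = M" "h \<in> H \<Longrightarrow> adj2 h ** (h ** M) = M"
  by (simp_all add: matrix_mul_assoc)

lemma H_one [simp]: "mat 1 \<in> H"
  by (simp add: H_iff mat_def)

lemma H_mult [simp]: "h \<in> H \<Longrightarrow> k \<in> H \<Longrightarrow> h ** k \<in> H"
proof -
  assume h: "h \<in> H" and k: "k \<in> H"
  then have "det (h ** k) = 1" by (simp add: det_mul det_H)
  then show ?thesis
    using h k r01 unfolding H_iff det_2 by (auto simp: mat2_mult algebra_simps)
qed

lemma H_adj2_mem [simp]: "h \<in> H \<Longrightarrow> adj2 h \<in> H"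
  using r01 by (auto simp: H_iff mult.commute)

lemma powers: "(\<i>^r = 1 \<and> (-\<i>)^r = 1 \<and> \<sigma> = 1 \<and> (-1::real)^r = 1)
    \<or> (\<i>^r = \<i> \<and> (-\<i>)^r = -\<i> \<and> \<sigma> = -1 \<and> (-1::real)^r = -1)"
  using r01 by auto

definition ell :: "real^3 \<Rightarrow> mat2" where
  "ell X = smat (\<i>^r / 2) (gam r X)"

lemma ell_entries: "ell X $ 1 $ 1 = \<i> * X$0 / 2" "ell X $ 1 $ 2 = \<i>^r * (X$1 + \<i> * X$2) / 2"
  "ell X $ 2 $ 1 = \<i>^r * (- X$1 + \<i> * X$2) / 2" "ell X $ 2 $ 2 = - (\<i> * X$0 / 2)"
  using r01 by (auto simp: ell_def smat_def gam_def gamma0_def gamma1_def gamma2_def scaleR_conv_of_real[where 'a=complex] algebra_simps)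

text \<open>A left inverse of \<open>ell\<close> that is linear on all matrices, so that it can be
  applied to a matrix curve and its derivative. The factors 2 and \<open>(-\<i>)^r\<close> undo
  \<open>\<i>^r / 2\<close>.\<close>

definition einv :: "mat2 \<Rightarrow> real^3" where
  "einv M = (\<chi> i. if i = 0 then 2 * Im (M$1$1) else if i = 1 then 2 * Re (M$1$2 * (-\<i>)^r)
    else 2 * Im (M$1$2 * (-\<i>)^r))"

lemma einv_ell [simp]: "einv (ell X) = X"
  using powers by (auto simp: vec3_eq_iff einv_def ell_entries)

lemma bounded_linear_ell: "bounded_linear ell"
  by (intro linear_conv_bounded_linear[THEN iffD1] linearI)
    (use powers in \<open>auto simp: mat2_eq_iff ell_entries complex_eq_iff algebra_simps\<close>)

lemma bounded_linear_einv: "bounded_linear einv"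
  by (intro linear_conv_bounded_linear[THEN iffD1] linearI)
    (use powers in \<open>auto simp: vec3_eq_iff einv_def algebra_simps\<close>)

lemma inj_ell: "inj ell"
  by (metis einv_ell injI)

lemma ell_eq_iff [simp]: "ell X = ell Y \<longleftrightarrow> X = Y"
  using inj_ell by (auto simp: inj_def)

lemma range_ell: "U \<in> range ell \<longleftrightarrow> U$2$2 = cnj (U$1$1) \<and> U$2$1 = - \<sigma> * cnj (U$1$2) \<and> Re (U$1$1) = 0"
proof
  assume "U$2$2 = cnj (U$1$1) \<and> U$2$1 = - \<sigma> * cnj (U$1$2) \<and> Re (U$1$1) = 0"
  then have "U = ell (einv U)"
    using powers by (auto simp: mat2_eq_iff ell_entries einv_def complex_eq_iff)
  then show "U \<in> range ell" by blast
qed (use powers in \<open>auto simp: ell_entries complex_eq_iff\<close>)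

text \<open>The first two equations of \<open>H_iff\<close> are real-linear and pass to derivatives;
  differentiating the determinant at the identity gives trace 0, hence an imaginary
  diagonal.\<close>

lemma H_lie_subset: "U \<in> H_lie r \<Longrightarrow> U \<in> range ell"
proof -
  assume "U \<in> H_lie r"
  then obtain c where c: "\<And>t. c t \<in> H" "c 0 = mat 1" "(c has_vector_derivative U) (at 0)"
    by (auto simp: H_lie_def H_tangent_def)
  have bl: "bounded_linear (\<lambda>M::mat2. M $ i $ j)" for i j
    by (intro bounded_linear_compose[OF bounded_linear_vec_nth bounded_linear_vec_nth])
  have d: "((\<lambda>t. c t $ i $ j) has_vector_derivative U $ i $ j) (at 0)" for i j
    using bounded_linear.has_vector_derivative[OF bl c(3)] .
  have 1: "U$2$2 = cnj (U$1$1)"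
  proof (rule vector_derivative_unique_at)
    show "((\<lambda>t. c t $ 2 $ 2) has_vector_derivative U $ 2 $ 2) (at 0)" by (rule d)
    have "(\<lambda>t. c t $ 2 $ 2) = (\<lambda>t. cnj (c t $ 1 $ 1))" using c(1) by (simp add: H_iff)
    then show "((\<lambda>t. c t $ 2 $ 2) has_vector_derivative cnj (U $ 1 $ 1)) (at 0)"
      using bounded_linear.has_vector_derivative[OF bounded_linear_cnj d] by simp
  qed
  have 2: "U$2$1 = - \<sigma> * cnj (U$1$2)"
  proof (rule vector_derivative_unique_at)
    show "((\<lambda>t. c t $ 2 $ 1) has_vector_derivative U $ 2 $ 1) (at 0)" by (rule d)
    have "(\<lambda>t. c t $ 2 $ 1) = (\<lambda>t. - \<sigma> * cnj (c t $ 1 $ 2))" using c(1) by (simp add: H_iff)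
    then show "((\<lambda>t. c t $ 2 $ 1) has_vector_derivative - \<sigma> * cnj (U $ 1 $ 2)) (at 0)"
      using bounded_linear.has_vector_derivative[OF bounded_linear_compose[OF bounded_linear_mult_right[of "- \<sigma>"] bounded_linear_cnj] d[of 1 2]] by simp
  qed
  have 3: "U$1$1 + U$2$2 = 0"
  proof (rule vector_derivative_unique_at)
    have "((\<lambda>t. c t $ 1 $ 1 * c t $ 2 $ 2 - c t $ 1 $ 2 * c t $ 2 $ 1) has_vector_derivative
       (c 0 $ 1 $ 1 * U $ 2 $ 2 + U $ 1 $ 1 * c 0 $ 2 $ 2)
         - (c 0 $ 1 $ 2 * U $ 2 $ 1 + U $ 1 $ 2 * c 0 $ 2 $ 1)) (at 0)"
      by (intro has_vector_derivative_diff has_vector_derivative_mult d)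
    then show "((\<lambda>t. c t $ 1 $ 1 * c t $ 2 $ 2 - c t $ 1 $ 2 * c t $ 2 $ 1) has_vector_derivative
       (U $ 1 $ 1 + U $ 2 $ 2)) (at 0)"
      by (simp add: c(2) mat_def add.commute)
    have "(\<lambda>t. c t $ 1 $ 1 * c t $ 2 $ 2 - c t $ 1 $ 2 * c t $ 2 $ 1) = (\<lambda>t. 1)"
      using det_H[OF c(1)] by (simp add: det_2)
    then show "((\<lambda>t. c t $ 1 $ 1 * c t $ 2 $ 2 - c t $ 1 $ 2 * c t $ 2 $ 1) has_vector_derivative 0) (at 0)"
      by simp
  qed
  have "Re (U$1$1) = 0" using 1 3 by (simp add: complex_eq_iff)
  with 1 2 show ?thesis by (simp add: range_ell)
qed

text \<open>The entry \<open>(1, 1)\<close> of a curve in \<open>H\<close> with entry \<open>(1, 2)\<close> equal to \<open>t b\<close> and with imaginary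
  part \<open>t s\<close> is determined by the determinant; this only makes sense for small \<open>t\<close>.\<close>

lemma ell_in_H_lie: "ell X \<in> H_lie r"
proof -
  define U where "U = ell X"
  have U: "U$2$2 = cnj (U$1$1)" "U$2$1 = - \<sigma> * cnj (U$1$2)" "Re (U$1$1) = 0"
    using range_ell[of U] by (auto simp: U_def)
  define b s where "b = U$1$2" and "s = Im (U$1$1)"
  \<comment> \<open>The value forced by \<open>H_iff\<close>: with radicand
    \<open>1 - t\<^sup>2 * k\<close>, the terms in \<open>t\<^sup>2\<close> cancel.\<close>
  define k where "k = (-1)^r * (cmod b)\<^sup>2 + s\<^sup>2"
  define a where "a = (\<lambda>t. Complex (sqrt (1 - t\<^sup>2 * k)) (t * s))"
  define \<Lambda> where "\<Lambda> = (\<lambda>(x, y). vector [vector [x, y], vector [- \<sigma> * cnj y, cnj x]] :: mat2)"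
  define m where "m = (\<lambda>t. \<Lambda> (a t, t *\<^sub>R b))"
  \<comment> \<open>Curves in \<open>H_tangent\<close> live on all of the reals. Where the radicand
    is not positive the curve is set to the identity, which leaves the derivative at 0
    unchanged.\<close>
  define c where "c = (\<lambda>t. if 1 - t\<^sup>2 * k > 0 then m t else mat 1)"
  have mH: "m t \<in> H" if "1 - t\<^sup>2 * k > 0" for t
  proof -
    have "a t * cnj (a t) = complex_of_real (1 - t\<^sup>2 * k + (t * s)\<^sup>2)"
      using that unfolding complex_mult_cnj by (simp add: a_def)
    moreover have "(t *\<^sub>R b) * cnj (t *\<^sub>R b) = complex_of_real (t\<^sup>2 * (cmod b)\<^sup>2)"
    proof -
      have "(t *\<^sub>R b) * cnj (t *\<^sub>R b) = complex_of_real ((cmod (t *\<^sub>R b))\<^sup>2)"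
        by (simp only: complex_norm_square)
      also have "(cmod (t *\<^sub>R b))\<^sup>2 = t\<^sup>2 * (cmod b)\<^sup>2"
        by (simp only: norm_scaleR power_mult_distrib power2_abs)
      finally show ?thesis .
    qed
    moreover have re: "(1 - t\<^sup>2 * k + (t * s)\<^sup>2) + (-1)^r * (t\<^sup>2 * (cmod b)\<^sup>2) = 1"
      by (simp add: k_def algebra_simps power_mult_distrib)
    have "complex_of_real (1 - t\<^sup>2 * k + (t * s)\<^sup>2) + \<sigma> * complex_of_real (t\<^sup>2 * (cmod b)\<^sup>2)
        = complex_of_real ((1 - t\<^sup>2 * k + (t * s)\<^sup>2) + (-1)^r * (t\<^sup>2 * (cmod b)\<^sup>2))"
      by simp
    then have "complex_of_real (1 - t\<^sup>2 * k + (t * s)\<^sup>2) + \<sigma> * complex_of_real (t\<^sup>2 * (cmod b)\<^sup>2) = 1"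
      unfolding re by simp
    ultimately show ?thesis unfolding H_iff by (simp add: m_def \<Lambda>_def)
  qed
  then have cH: "c t \<in> H" for t by (simp add: c_def)
  have c0: "c 0 = mat 1" by (simp add: c_def m_def \<Lambda>_def a_def mat2_eq_iff mat_def complex_eq_iff)
  have da: "(a has_vector_derivative U$1$1) (at 0)"
  proof -
    have 1: "((\<lambda>t. sqrt (1 - t\<^sup>2 * k)) has_real_derivative 0) (at 0)"
      by (auto intro!: derivative_eq_intros)
    have 2: "((\<lambda>t. t * s) has_real_derivative s) (at 0)"
      by (auto intro!: derivative_eq_intros)
    have "(a has_vector_derivative Complex 0 s) (at 0)"
      unfolding a_def
      using has_vector_derivative_add[OF
          bounded_linear.has_vector_derivative[OF bounded_linear_of_real 1[unfolded has_real_derivative_iff_has_vector_derivative]]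
          bounded_linear.has_vector_derivative[OF bounded_linear_const_mult[OF bounded_linear_of_real, of \<i>]
            2[unfolded has_real_derivative_iff_has_vector_derivative]]]
      by (simp add: Complex_eq)
    moreover have "Complex 0 s = U$1$1" using U(3) by (simp add: s_def complex_eq_iff)
    ultimately show ?thesis by simp
  qed
  have db: "((\<lambda>t. t *\<^sub>R b) has_vector_derivative b) (at 0)"
    by (auto intro!: derivative_eq_intros)
  have "bounded_linear \<Lambda>"
    by (intro linear_conv_bounded_linear[THEN iffD1] linearI)
      (auto simp: mat2_eq_iff \<Lambda>_def algebra_simps)
  from bounded_linear.has_vector_derivative[OF this has_vector_derivative_Pair[OF da db]]
  have dm: "(m has_vector_derivative \<Lambda> (U$1$1, b)) (at 0)"
    by (simp add: m_def)
  have "\<Lambda> (U$1$1, b) = U"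
    using U by (simp add: \<Lambda>_def mat2_eq_iff b_def)
  have "open {t. 0 < 1 - t\<^sup>2 * k}"
    by (intro open_Collect_less continuous_intros)
  then have "(c has_vector_derivative \<Lambda> (U$1$1, b)) (at 0)"
    by (rule has_vector_derivative_transform_within_open[OF dm]) (auto simp: c_def)
  then show ?thesis
    unfolding H_lie_def H_tangent_def using cH c0 \<open>\<Lambda> (U$1$1, b) = U\<close> by (auto simp: U_def)
qed

lemma H_lie_eq: "H_lie r = range ell"
  using H_lie_subset ell_in_H_lie by blast

lemma H_tangent_eq:
  assumes h: "h \<in> H"
  shows "H_tangent r h = (\<lambda>U. h ** U) ` H_lie r"
proof -
  have mult: "k ** \<xi> \<in> H_tangent r (k ** h')" if k: "k \<in> H" and x: "\<xi> \<in> H_tangent r h'" for k h' \<xi>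
  proof -
    obtain c where c: "\<And>t. c t \<in> H" "c 0 = h'" "(c has_vector_derivative \<xi>) (at 0)"
      using x by (auto simp: H_tangent_def)
    have "((\<lambda>t. k ** c t) has_vector_derivative k ** \<xi>) (at 0)"
      by (rule bounded_linear.has_vector_derivative[OF bounded_bilinear.bounded_linear_right[OF bounded_bilinear_mat2] c(3)])
    then show ?thesis
      unfolding H_tangent_def using c(1,2) k by (auto intro!: exI[of _ "\<lambda>t. k ** c t"])
  qed
  show ?thesis
  proof
    show "(\<lambda>U. h ** U) ` H_lie r \<subseteq> H_tangent r h"
      using mult[OF h, of _ "mat 1"] by (auto simp: H_lie_def)
    show "H_tangent r h \<subseteq> (\<lambda>U. h ** U) ` H_lie r"
    proof
      fix \<xi> assume "\<xi> \<in> H_tangent r h"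
      then have "adj2 h ** \<xi> \<in> H_lie r"
        using mult[of "adj2 h" \<xi> h] h by (simp add: H_lie_def)
      then show "\<xi> \<in> (\<lambda>U. h ** U) ` H_lie r"
        using h by (intro image_eqI[of _ _ "adj2 h ** \<xi>"]) simp_all
    qed
  qed
qed

text \<open>Conjugation by \<open>h\<close> maps curves in \<open>H\<close> through the identity to
  such curves, so it preserves the Lie algebra.\<close>

lemma conj_ell: "h \<in> H \<Longrightarrow> h ** ell X ** adj2 h \<in> range ell"
proof -
  assume h: "h \<in> H"
  obtain c where c: "\<And>t. c t \<in> H" "c 0 = mat 1" "(c has_vector_derivative ell X) (at 0)"
    using ell_in_H_lie[of X] by (auto simp: H_lie_def H_tangent_def)
  have "((\<lambda>t. h ** c t ** adj2 h) has_vector_derivative h ** ell X ** adj2 h) (at 0)"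
    by (intro bounded_linear.has_vector_derivative[OF bounded_bilinear.bounded_linear_left[OF bounded_bilinear_mat2]]
      bounded_linear.has_vector_derivative[OF bounded_bilinear.bounded_linear_right[OF bounded_bilinear_mat2]] c(3))
  then have "h ** ell X ** adj2 h \<in> H_lie r"
    unfolding H_lie_def H_tangent_def using c(1,2) h by (auto intro!: exI[of _ "\<lambda>t. h ** c t ** adj2 h"])
  then show ?thesis by (simp add: H_lie_eq)
qed

lemma smat_mult: "smat c A ** B = smat c (A ** B)" "A ** smat c B = smat c (A ** B)"
  by (simp_all add: smat_def mat2_eq_iff mat2_mult algebra_simps)

lemma ell_conj_iff: "h \<in> H \<Longrightarrow> ell Y = h ** ell X ** adj2 h \<longleftrightarrow> gam r Y = h ** gam r X ** matrix_inv h"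
  by (simp add: ell_def smat_mult) (simp add: smat_def mat2_eq_iff)

text \<open>The description in \<open>lam\<close> has a solution by \<open>conj_ell\<close> and only
  one because \<open>ell\<close> is injective; the scalar between \<open>ell\<close> and
  \<open>gam\<close> commutes with conjugation.\<close>

lemma ell_lam: "h \<in> H \<Longrightarrow> ell (lam r h X) = h ** ell X ** adj2 h"
  and lam_eq: "h \<in> H \<Longrightarrow> ell Y = h ** ell X ** adj2 h \<Longrightarrow> lam r h X = Y"
proof -
  assume h: "h \<in> H"
  have *: "lam r h X = Y" if "ell Y = h ** ell X ** adj2 h" for Y
    unfolding lam_def
  proof (rule the_equality)
    show "gam r Y = h ** gam r X ** matrix_inv h" using that ell_conj_iff[OF h] by blast
    show "Y' = Y" if "gam r Y' = h ** gam r X ** matrix_inv h" for Y'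
      using that ell_conj_iff[OF h] \<open>ell Y = _\<close> ell_eq_iff by metis
  qed
  then show "ell Y = h ** ell X ** adj2 h \<Longrightarrow> lam r h X = Y" .
  obtain Y where "ell Y = h ** ell X ** adj2 h" using conj_ell[OF h, of X] by auto
  then show "ell (lam r h X) = h ** ell X ** adj2 h" using * by simp
qed

lemma lam_einv: "h \<in> H \<Longrightarrow> lam r h X = einv (h ** ell X ** adj2 h)"
  by (metis ell_lam einv_ell)

lemma lam_one [simp]: "lam r (mat 1) X = X"
  by (rule lam_eq) simp_all

lemma lam_mult: "h \<in> H \<Longrightarrow> k \<in> H \<Longrightarrow> lam r (h ** k) X = lam r h (lam r k X)"
  by (rule lam_eq) (simp_all add: ell_lam adj2_mult matrix_mul_assoc)

lemma lam_adj2 [simp]: "h \<in> H \<Longrightarrow> lam r (adj2 h) (lam r h X) = X" "h \<in> H \<Longrightarrow> lam r h (lam r (adj2 h) X) = X"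
  by (simp_all flip: lam_mult)

lemma linear_lam: "h \<in> H \<Longrightarrow> linear (lam r h)"
proof -
  assume h: "h \<in> H"
  have "bounded_linear (\<lambda>X. einv (h ** ell X ** adj2 h))"
    by (intro bounded_linear_compose[OF bounded_linear_einv] bounded_linear_compose[OF bounded_linear_ell]
      bounded_linear_compose[OF bounded_bilinear.bounded_linear_left[OF bounded_bilinear_mat2]]
      bounded_linear_compose[OF bounded_bilinear.bounded_linear_right[OF bounded_bilinear_mat2]] bounded_linear_ell)
  then show ?thesis
    unfolding linear_conv_bounded_linear using lam_einv[OF h] by presburger
qed

lemma det_ell: "det (ell X) = \<sigma> / 4 * inner_m r X X"
  using powers by (auto simp: det_2 ell_entries inner_m_def field_simps)

text \<open>Up to a constant the quadratic form is the determinant of \<open>ell X\<close>, which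
  conjugation preserves; polarisation gives the bilinear form.\<close>

lemma inner_lam: "h \<in> H \<Longrightarrow> inner_m r (lam r h X) (lam r h Y) = inner_m r X Y"
proof -
  assume h: "h \<in> H"
  have sq: "inner_m r (lam r h Z) (lam r h Z) = inner_m r Z Z" for Z
  proof -
    have "det (ell (lam r h Z)) = det (ell Z)"
      using h by (simp add: ell_lam det_mul det_H)
    then show ?thesis by (simp add: det_ell)
  qed
  have pol: "inner_m r (V + W) (V + W) = inner_m r V V + 2 * inner_m r V W + inner_m r W W" for V W
    by (simp add: inner_m_def algebra_simps)
  have "inner_m r (lam r h (X + Y)) (lam r h (X + Y)) = inner_m r (X + Y) (X + Y)" by (rule sq)
  then show ?thesis
    by (simp add: linear_add[OF linear_lam[OF h]] pol sq)
qed

section \<open>The cross product and the Lie bracket\<close>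

definition cr :: "real^3 \<Rightarrow> real^3 \<Rightarrow> real^3" where
  "cr X Y = (\<chi> i. if i = 0 then (-1)^r * (X$1 * Y$2 - X$2 * Y$1)
     else if i = 1 then X$2 * Y$0 - X$0 * Y$2 else X$0 * Y$1 - X$1 * Y$0)"

lemma cr_entries [simp]: "cr X Y $ 0 = (-1)^r * (X$1 * Y$2 - X$2 * Y$1)"
  "cr X Y $ 1 = X$2 * Y$0 - X$0 * Y$2" "cr X Y $ 2 = X$0 * Y$1 - X$1 * Y$0"
  by (simp_all add: cr_def)

lemma inner_m_axis: "inner_m r W (axis 0 1) = (-1)^r * W$0" "inner_m r W (axis 1 1) = W$1"
  "inner_m r W (axis 2 1) = W$2"
  by (simp_all add: inner_m_def axis_def)

lemma cross_m_eq: "cross_m r X Y = cr X Y"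
  unfolding cross_m_def
proof (rule the_equality)
  show *: "\<forall>Z. inner_m r (cr X Y) Z = vol_m X Y Z"
    using powers by (auto simp: inner_m_def vol_m_def det_3 algebra_simps)
  show "W = cr X Y" if "\<forall>Z. inner_m r W Z = vol_m X Y Z" for W
  proof -
    have "inner_m r W Z = inner_m r (cr X Y) Z" for Z using that * by simp
    from this[of "axis 0 1"] this[of "axis 1 1"] this[of "axis 2 1"] show ?thesis
      using powers unfolding inner_m_axis vec3_eq_iff by auto
  qed
qed

text \<open>This identity accounts for the factor 1/2 in \<open>ell\<close>: with it, the cross
  product corresponds exactly to the commutator.\<close>

lemma commutator_ell: "ell X ** ell Y - ell Y ** ell X = ell (cr X Y)"
  using powers by (auto simp: mat2_eq_iff mat2_mult ell_entries complex_eq_iff field_simps)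

lemma adj2_ell [simp]: "adj2 (ell X) = - ell X"
  by (simp add: mat2_eq_iff ell_entries)

text \<open>Differentiating the conjugation of \<open>ell Y\<close> along a curve gives a
  commutator. A curve with velocity \<open>ell X\<close> exists by \<open>ell_in_H_lie\<close>, so
  the description is satisfied by one vector only.\<close>

lemma lam_star_ell: "lam_star r (ell X) Y = cr X Y"
  unfolding lam_star_def
proof (rule the_equality)
  show *: "\<forall>c. (\<forall>t. c t \<in> H) \<and> c 0 = mat 1 \<and> (c has_vector_derivative ell X) (at 0)
      \<longrightarrow> ((\<lambda>t. lam r (c t) Y) has_vector_derivative cr X Y) (at 0)"
  proof (intro allI impI, elim conjE)
    fix c :: "real \<Rightarrow> mat2"
    assume c: "\<forall>t. c t \<in> H" "c 0 = mat 1" "(c has_vector_derivative ell X) (at 0)"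
    have "((\<lambda>t. einv ((c t ** ell Y) ** adj2 (c t))) has_vector_derivative
        einv ((c 0 ** ell Y) ** adj2 (ell X) + (ell X ** ell Y) ** adj2 (c 0))) (at 0)"
      by (intro bounded_linear.has_vector_derivative[OF bounded_linear_einv]
        bounded_bilinear.has_vector_derivative[OF bounded_bilinear_mat2]
        bounded_linear.has_vector_derivative[OF bounded_bilinear.bounded_linear_left[OF bounded_bilinear_mat2]]
        bounded_linear.has_vector_derivative[OF bounded_linear_adj2] c(3))
    moreover have "(\<lambda>t. einv ((c t ** ell Y) ** adj2 (c t))) = (\<lambda>t. lam r (c t) Y)"
      using c(1) by (simp add: lam_einv)
    moreover have "(c 0 ** ell Y) ** adj2 (ell X) + (ell X ** ell Y) ** adj2 (c 0) = ell (cr X Y)"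
      by (simp add: c(2) bounded_bilinear.minus_right[OF bounded_bilinear_mat2] flip: commutator_ell)
    ultimately show "((\<lambda>t. lam r (c t) Y) has_vector_derivative cr X Y) (at 0)" by simp
  qed
  obtain c where c: "\<And>t. c t \<in> H" "c 0 = mat 1" "(c has_vector_derivative ell X) (at 0)"
    using ell_in_H_lie[of X] by (auto simp: H_lie_def H_tangent_def)
  show "Z = cr X Y" if "\<forall>c. (\<forall>t. c t \<in> H) \<and> c 0 = mat 1 \<and> (c has_vector_derivative ell X) (at 0)
      \<longrightarrow> ((\<lambda>t. lam r (c t) Y) has_vector_derivative Z) (at 0)" for Z
    using vector_derivative_unique_at[of "\<lambda>t. lam r (c t) Y" Z 0 "cr X Y"] that * c by blast
qed

lemma cr_inj: "(\<And>Y. cr X Y = cr X' Y) \<Longrightarrow> X = X'"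
proof -
  assume a: "\<And>Y. cr X Y = cr X' Y"
  show ?thesis
    using arg_cong[OF a[of "axis 0 1"], of "\<lambda>v. v$1"] arg_cong[OF a[of "axis 0 1"], of "\<lambda>v. v$2"]
      arg_cong[OF a[of "axis 1 1"], of "\<lambda>v. v$2"]
    by (simp add: vec3_eq_iff axis_def)
qed

lemma l_g_eq: "l_g r = ell"
proof
  fix X show "l_g r X = ell X"
    unfolding l_g_def
  proof (rule the_equality)
    show "ell X \<in> H_lie r \<and> (\<forall>Y. lam_star r (ell X) Y = cross_m r X Y)"
      by (simp add: ell_in_H_lie lam_star_ell cross_m_eq)
    show "U = ell X" if U: "U \<in> H_lie r \<and> (\<forall>Y. lam_star r U Y = cross_m r X Y)" for U
    proof -
      obtain X' where X': "U = ell X'" using U H_lie_eq by auto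
      then have "cr X' Y = cr X Y" for Y using U by (simp add: lam_star_ell cross_m_eq)
      then show ?thesis using X' cr_inj by metis
    qed
  qed
qed

text \<open>\<open>cr (b x) y - cr (b y) x\<close> is the bracket of \<open>x\<close> and \<open>y\<close> if \<open>b\<close> is the connection form of a
  torsion-free connection.\<close>

lemma symmetric_iff_trace:
  assumes b: "linear b"
  shows "(\<forall>x y. inner_m r x (b y) = inner_m r (b x) y) \<longleftrightarrow>
    (\<forall>i. (\<Sum>k\<in>UNIV. (cr (b (axis i 1)) (axis k 1) - cr (b (axis k 1)) (axis i 1)) $ k) = 0)"
proof -
  have bx: "b x = x$0 *\<^sub>R b (axis 0 1) + x$1 *\<^sub>R b (axis 1 1) + x$2 *\<^sub>R b (axis 2 1)" for x
  proof -
    have "x = x$0 *\<^sub>R axis 0 1 + x$1 *\<^sub>R axis 1 1 + x$2 *\<^sub>R axis 2 1"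
      by (simp add: vec3_eq_iff axis_def)
    then have "b x = b (x$0 *\<^sub>R axis 0 1 + x$1 *\<^sub>R axis 1 1 + x$2 *\<^sub>R axis 2 1)" by simp
    then show ?thesis by (simp only: linear_add[OF b] linear_cmul[OF b])
  qed
  \<comment> \<open>The vanishing of the three entries of the antisymmetric part of
    \<open>b\<close>. In the trace for index \<open>i\<close> the operator
    \<open>cr (b (axis i 1))\<close> contributes 0, and the other term yields exactly one of these
    equations.\<close>
  let ?s = "b (axis 1 1) $ 2 = b (axis 2 1) $ 1 \<and> b (axis 0 1) $ 1 = (-1)^r * b (axis 1 1) $ 0
     \<and> b (axis 0 1) $ 2 = (-1)^r * b (axis 2 1) $ 0"
  have 1: "(\<forall>x y. inner_m r x (b y) = inner_m r (b x) y) \<longleftrightarrow> ?s" (is "?L \<longleftrightarrow> _")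
  proof
    assume L: ?L
    from L[rule_format, of "axis 2 1" "axis 1 1"] L[rule_format, of "axis 1 1" "axis 0 1"]
      L[rule_format, of "axis 2 1" "axis 0 1"]
    show ?s by (simp add: inner_m_def axis_def)
  next
    assume ?s
    then show ?L
      using powers unfolding inner_m_def by (subst (1 2 3 4 5 6) bx) (auto simp: algebra_simps)
  qed
  have 2: "(\<forall>i. (\<Sum>k\<in>UNIV. (cr (b (axis i 1)) (axis k 1) - cr (b (axis k 1)) (axis i 1)) $ k) = 0) \<longleftrightarrow> ?s"
    using powers by (auto simp: forall_3' sum_3' axis_def)
  show ?thesis unfolding 1 2 ..
qed

section \<open>The Hermitian form and its behaviour under Clifford multiplication\<close>

lemma ell_zero [simp]: "ell 0 = 0"
  by (simp add: mat2_eq_iff ell_entries)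

lemma zero_in_H_lie [simp]: "0 \<in> H_lie r"
  unfolding H_lie_eq by (metis ell_zero rangeI)

lemma mat2_zero [simp]: "(M::mat2) ** 0 = 0" "0 ** (M::mat2) = 0"
  by (simp_all add: mat2_eq_iff mat2_mult)

lemma mat2_vec_assoc: "(M::mat2) *v (N *v v) = (M ** N) *v v"
  by (rule matrix_vector_mul_assoc)

lemma herm_eq: "herm r v w = cnj (v$1) * w$1 + \<sigma> * (cnj (v$2) * w$2)"
  using r01 by (auto simp: herm_def gamma0_pow_def gamma0_def matrix_vector_mult_def sum_2 mat_def)

lemma herm_H:
  assumes h: "h \<in> H" shows "herm r (h *v v) (h *v w) = herm r v w"
proof -
  have h': "h$2$2 = cnj (h$1$1)" "h$2$1 = - \<sigma> * cnj (h$1$2)"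
    "h$1$1 * cnj (h$1$1) + \<sigma> * (h$1$2 * cnj (h$1$2)) = 1"
    using h H_iff by blast+
  have "herm r (h *v v) (h *v w) = (h$1$1 * cnj (h$1$1) + \<sigma> * (h$1$2 * cnj (h$1$2))) * herm r v w"
    using powers by (auto simp: herm_eq matrix_vector_mult_def sum_2 h'(1,2) algebra_simps)
  then show ?thesis by (simp add: h'(3))
qed

lemma gam_conj: "h \<in> H \<Longrightarrow> gam r (lam r h X) ** h = h ** gam r X"
  using ell_lam[of h X] ell_conj_iff[of h "lam r h X" X]
  by (simp add: matrix_mul_assoc[symmetric])

text \<open>Clifford multiplication on a non-null spinor is injective on real vectors. For
  \<open>r = 1\<close>, \<open>ell Z\<close> is singular on null vectors \<open>Z\<close>, so
  \<open>v\<close> must be non-null and not merely nonzero.\<close>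

lemma ell_vec_inj:
  assumes v: "herm r v v \<noteq> 0" and eq: "ell X *v v = ell Y *v v"
  shows "X = Y"
proof -
  define Z where "Z = X - Y"
  have "ell Z *v v = 0"
    using eq linear_diff[OF bounded_linear.linear[OF bounded_linear_ell], of X Y]
    by (simp add: Z_def matrix_vector_mult_diff_rdistrib)
  then have e1: "ell Z $1$1 * v$1 + ell Z $1$2 * v$2 = 0" and e2: "ell Z $2$1 * v$1 + ell Z $2$2 * v$2 = 0"
    by (simp_all add: vec_eq_iff forall_2 matrix_vector_mult_def sum_2)
  define a b where "a = ell Z $1$1" and "b = ell Z $1$2"
  have ent: "ell Z $2$1 = - \<sigma> * cnj b" "ell Z $2$2 = - a" "cnj a = - a"
    using range_ell[of "ell Z"] by (auto simp: a_def b_def complex_eq_iff)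
  \<comment> \<open>The conjugated first row and the second row are two equations for
    \<open>cnj b\<close>; eliminating it leaves \<open>a * herm r v v = 0\<close>.\<close>
  have "cnj a * cnj (v$1) + cnj b * cnj (v$2) = 0"
    using arg_cong[OF e1, of cnj] by (simp add: a_def b_def)
  then have c1: "cnj b * cnj (v$2) = a * cnj (v$1)" by (simp add: ent(3) add_eq_0_iff)
  have c2: "cnj b * v$1 = - \<sigma> * (a * v$2)"
  proof -
    have "\<sigma> * (cnj b * v$1) = - (a * v$2)"
      using e2 by (simp add: ent algebra_simps add_eq_0_iff)
    then show ?thesis using powers by auto
  qed
  have "a * (cnj (v$1) * v$1) = - \<sigma> * (a * v$2) * cnj (v$2)"
    using c1 c2 by (metis mult.assoc mult.commute)
  then have "a * herm r v v = 0" by (simp add: herm_eq algebra_simps)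
  then have a0: "a = 0" using v by simp
  have "v$1 \<noteq> 0 \<or> v$2 \<noteq> 0" using v by (auto simp: herm_eq)
  then have "b = 0" using c1 c2 a0 by auto
  then have "ell Z = ell 0"
    using a0 ent by (simp add: mat2_eq_iff a_def b_def)
  then show ?thesis using ell_eq_iff[of Z 0] by (simp add: Z_def del: ell_zero)
qed

lemma eps_unit_exists: "\<epsilon> \<in> eps_set r \<Longrightarrow> \<exists>v. herm r v v = complex_of_real \<epsilon>"
proof -
  assume \<epsilon>: "\<epsilon> \<in> eps_set r"
  have "herm r (axis 1 1) (axis 1 1) = 1" "herm r (axis 2 1) (axis 2 1) = \<sigma>"
    by (simp_all add: herm_eq axis_def)
  then show ?thesis using \<epsilon> r01 by (auto simp: eps_set_def split: if_splits)
qed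

end

section \<open>Invariant sections and spinors\<close>

locale spin_lie_group = haar_group C mul e iv E + spin_signature r
  for r :: nat and C :: "'g::{t2_space,second_countable_topology} charts"
    and mul :: "'g \<Rightarrow> 'g \<Rightarrow> 'g" and e :: 'g and iv :: "'g \<Rightarrow> 'g" and E :: "3 \<Rightarrow> 'g vfield" +
  fixes g :: "'g \<Rightarrow> real^3 \<Rightarrow> real^3 \<Rightarrow> real"
    and D :: "'g vfield \<Rightarrow> 'g vfield \<Rightarrow> 'g vfield"
    and \<omega> :: "'g pform"
  assumes metric: "pseudo_metric r C g"
    and frame: "invariant_frame r C mul g E"
    and lc: "levi_civita C g D"
    and spin: "spin_connection_form r C E D \<omega>"
    and conn: "connected (UNIV :: 'g set)"
begin

section \<open>Frame coordinates and the connection form in the trivialisation\<close>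

lemma g_fr: "g p (fr p x) (fr p y) = inner_m r x y"
proof -
  have bl: "bilinear (g p)" using metric by (simp add: pseudo_metric_def)
  have gE: "g p (E i p) (E j p) = inner_m r (axis i 1) (axis j 1)" for i j
    using frame by (simp add: invariant_frame_def)
  have "g p (fr p x) (fr p y) = (\<Sum>i\<in>UNIV. \<Sum>j\<in>UNIV. x$i * (y$j * inner_m r (axis i 1) (axis j 1)))"
    unfolding fr_def sum.cartesian_product
    by (subst bilinear_sum[OF bl]) (simp add: bilinear_lmul[OF bl] bilinear_rmul[OF bl] gE case_prod_beta' mult.left_commute)
  also have "\<dots> = inner_m r x y"
    by (simp add: sum_3' inner_m_def axis_def algebra_simps)
  finally show ?thesis .
qed

lemma frm_eq: "frm r E (p, h) X = fr p (lam r h X)"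
  by (simp add: frm_def fr_def)

lemma fr_eq_iff: "fr p x = V \<longleftrightarrow> x = co p V"
  by (metis co_fr fr_co)

lemma frm_eq_iff: "h \<in> H \<Longrightarrow> frm r E (p, h) X = V \<longleftrightarrow> X = lam r (adj2 h) (co p V)"
  unfolding frm_eq fr_eq_iff by (metis lam_adj2)

lemma solder_eq: "h \<in> H \<Longrightarrow> solder r E (p, h) \<zeta> = lam r (adj2 h) (co p (fst \<zeta>))"
  by (simp add: solder_def frm_eq_iff)

text \<open>The connection form along the section \<open>q \<mapsto> (q, 1)\<close>, read as an endomorphism of the tangent
  spaces via \<open>l_g\<close>.\<close>

definition W :: "'g \<Rightarrow> real^3 \<Rightarrow> mat2" where
  "W p V = \<omega> (p, mat 1) (V, 0)"

definition beta :: "'g \<Rightarrow> real^3 \<Rightarrow> real^3" where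
  "beta p V = einv (W p V)"

lemma P_set_iff: "(p, h) \<in> P_set r \<longleftrightarrow> h \<in> H"
  by (simp add: P_set_def)

lemma P_tangent_iff: "h \<in> H \<Longrightarrow> (V, \<xi>) \<in> P_tangent r (p, h) \<longleftrightarrow> (\<exists>U\<in>H_lie r. \<xi> = h ** U)"
  by (auto simp: P_tangent_def H_tangent_eq)

lemma P_tangentI: "h \<in> H \<Longrightarrow> U \<in> H_lie r \<Longrightarrow> (V, h ** U) \<in> P_tangent r (p, h)"
  by (simp add: P_tangent_def H_tangent_eq)

lemma in_P_tangent: "h \<in> H \<Longrightarrow> (V, 0) \<in> P_tangent r (p, h)"
  using P_tangent_iff[of h V 0 p] zero_in_H_lie mat2_zero(1)[of h] by metis

lemma
  assumes h: "h \<in> H"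
  shows omega_H_lie: "\<zeta> \<in> P_tangent r (p, h) \<Longrightarrow> \<omega> (p, h) \<zeta> \<in> H_lie r"
    and omega_linear: "\<zeta> \<in> P_tangent r (p, h) \<Longrightarrow> \<eta> \<in> P_tangent r (p, h) \<Longrightarrow>
      \<omega> (p, h) (a *\<^sub>R \<zeta> + b *\<^sub>R \<eta>) = a *\<^sub>R \<omega> (p, h) \<zeta> + b *\<^sub>R \<omega> (p, h) \<eta>"
    and omega_fundamental: "U \<in> H_lie r \<Longrightarrow> \<omega> (p, h) (0, h ** U) = U"
    and omega_right: "\<zeta> \<in> P_tangent r (p, h) \<Longrightarrow> k \<in> H \<Longrightarrow>
      \<omega> (p, h ** k) (fst \<zeta>, snd \<zeta> ** k) = adj2 k ** \<omega> (p, h) \<zeta> ** k"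
  using spin[unfolded spin_connection_form_def, THEN conjunct1, rule_format, of "(p, h)"] h
  by (auto simp: P_set_iff fundamental_def P_right_def)

lemma W_ell: "W p V = ell (beta p V)"
proof -
  have "W p V \<in> range ell"
    using omega_H_lie[OF H_one in_P_tangent[OF H_one]] by (simp add: W_def H_lie_eq)
  then show ?thesis by (auto simp: beta_def)
qed

lemma linear_beta: "linear (beta p)"
proof (rule linearI)
  note lin = omega_linear[OF H_one in_P_tangent[OF H_one] in_P_tangent[OF H_one], of p]
  note ein = linear_conv_bounded_linear[THEN iffD2, OF bounded_linear_einv]
  show "beta p (V + V') = beta p V + beta p V'" for V V'
    using lin[of 1 V 1 V'] by (simp add: beta_def W_def linear_add[OF ein])
  show "beta p (c *\<^sub>R V) = c *\<^sub>R beta p V" for c V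
    using lin[of c V 0 V] by (simp add: beta_def W_def linear_cmul[OF ein])
qed

text \<open>A tangent vector at \<open>(p, h)\<close> is a right translate of a vector along the
  identity section plus a vertical one; equivariance and the value on fundamental fields determine
  the form from \<open>W\<close>.\<close>

lemma omega_eq:
  assumes h: "h \<in> H" and U: "U \<in> H_lie r"
  shows "\<omega> (p, h) (V, h ** U) = adj2 h ** W p V ** h + U"
proof -
  have 1: "\<omega> (p, h) (V, 0) = adj2 h ** W p V ** h"
    using omega_right[OF H_one in_P_tangent[OF H_one] h, of p V] by (simp add: W_def)
  have "\<omega> (p, h) (1 *\<^sub>R (V, 0) + 1 *\<^sub>R (0, h ** U)) = 1 *\<^sub>R \<omega> (p, h) (V, 0) + 1 *\<^sub>R \<omega> (p, h) (0, h ** U)"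
    by (rule omega_linear[OF h in_P_tangent[OF h] P_tangentI[OF h U]])
  then show ?thesis by (simp add: 1 omega_fundamental[OF h U])
qed

lemma fder_const [simp]: "fder C (\<lambda>q. c) p V = 0"
  by (simp add: fder_def o_def)

lemma push_const: "push C (\<lambda>q. (q, h)) p V = (V, 0)"
  by (simp add: push_def)

lemma smooth_section_const: "h \<in> H \<Longrightarrow> smooth_section r C (\<lambda>q. (q, h))"
  by (simp add: smooth_section_def P_set_iff smooth_fun_const)

text \<open>Along the identity section \<open>E k\<close> has the constant coefficient vector
  \<open>axis k 1\<close>, so only the connection term survives, and \<open>lam_star\<close> turns
  it into a cross product.\<close>

lemma D_E: "D (E i) (E k) = (\<lambda>p. fr p (cr (beta p (E i p)) (axis k 1)))"
proof -
  have "D (E i) (\<lambda>p. frm r E (p, mat 1) (axis k 1)) = (\<lambda>p. frm r E (p, mat 1)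
      (fder C (\<lambda>q. axis k 1 :: real^3) p (E i p)
        + lam_star r (\<omega> (p, mat 1) (push C (\<lambda>q. (q, mat 1)) p (E i p))) (axis k 1)))"
    using spin[unfolded spin_connection_form_def, THEN conjunct2, rule_format,
        OF conjI[OF smooth_section_const[OF H_one] smooth_E[of i]], THEN conjunct2, rule_format,
        OF smooth_fun_const[of UNIV "axis k 1 :: real^3"]] .
  then show ?thesis
    by (simp add: frm_eq push_const W_def[symmetric] W_ell lam_star_ell)
qed

definition sym_at :: "'g \<Rightarrow> bool" where
  "sym_at p \<longleftrightarrow> (\<forall>V V'. inner_m r (co p V) (beta p V') = inner_m r (beta p V) (co p V'))"

lemma sym_at_frame:
  "sym_at p \<longleftrightarrow> (\<forall>x y. inner_m r x (beta p (fr p y)) = inner_m r (beta p (fr p x)) y)"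
  unfolding sym_at_def by (metis co_fr fr_co)

lemma unimodular_iff_sym: "unimodular mul \<longleftrightarrow> (\<forall>p. sym_at p)"
proof -
  define Z where "Z = (\<lambda>i k p. D (E i) (E k) p - D (E k) (E i) p)"
  have Z: "is_lie_bracket C (E i) (E k) (Z i k)" for i k
    using lc smooth_E unfolding levi_civita_def Z_def by blast
  have co: "co p (Z i k p) = cr (beta p (E i p)) (axis k 1) - cr (beta p (E k p)) (axis i 1)" for i k p
    by (simp add: Z_def D_E linear_diff[OF linear_co])
  have "sym_at p \<longleftrightarrow> (\<forall>i. (\<Sum>k\<in>UNIV. co p (Z i k p) $ k) = 0)" for p
    unfolding sym_at_frame co
    using symmetric_iff_trace[of "\<lambda>x. beta p (fr p x)"]
      linear_compose[OF linear_fr[of p] linear_beta[of p]] by (simp add: o_def)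
  then show ?thesis using unimodular_iff_trace[OF conn Z] by blast
qed

section \<open>Horizontal lifts and \<open>Omega\<close> on equivariant sections\<close>

lemma horiz_eq:
  assumes h: "h \<in> H"
  shows "horiz r E \<omega> X (p, h) = (fr p (lam r h X), - (W p (fr p (lam r h X)) ** h))"
proof -
  let ?V = "fr p (lam r h X)"
  define U where "U = - (adj2 h ** W p ?V ** h)"
  have "adj2 h ** W p ?V ** h = ell (lam r (adj2 h) (beta p ?V))"
    using h by (simp add: ell_lam W_ell)
  then have "U = ell (- lam r (adj2 h) (beta p ?V))"
    using bounded_linear.linear[OF bounded_linear_ell] by (simp add: U_def linear_neg)
  then have U: "U \<in> H_lie r" by (simp add: H_lie_eq)
  have hU: "h ** U = - (W p ?V ** h)"
    using h by (simp add: U_def bounded_bilinear.minus_right[OF bounded_bilinear_mat2] matrix_mul_assoc)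
  have "horiz r E \<omega> X (p, h) = (?V, h ** U)"
    unfolding horiz_def
  proof (rule the_equality)
    have "solder r E (p, h) (?V, h ** U) = X" using h by (simp add: solder_eq)
    moreover have "\<omega> (p, h) (?V, h ** U) = 0" unfolding omega_eq[OF h U] by (simp add: U_def)
    ultimately show "(?V, h ** U) \<in> P_tangent r (p, h) \<and> solder r E (p, h) (?V, h ** U) = X \<and> \<omega> (p, h) (?V, h ** U) = 0"
      by (intro conjI P_tangentI[OF h U])
    fix \<zeta> assume z: "\<zeta> \<in> P_tangent r (p, h) \<and> solder r E (p, h) \<zeta> = X \<and> \<omega> (p, h) \<zeta> = 0"
    obtain V' \<xi> where zeta: "\<zeta> = (V', \<xi>)" by fastforce
    obtain U' where U': "U' \<in> H_lie r" "\<xi> = h ** U'" using z by (auto simp: zeta P_tangent_iff[OF h])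
    have "lam r (adj2 h) (co p V') = X" using z h by (simp add: zeta solder_eq)
    then have "V' = ?V" using h by auto
    moreover have "adj2 h ** W p V' ** h + U' = 0"
      using z omega_eq[OF h U'(1), of p V'] by (simp add: zeta U'(2))
    then have "U' = - (adj2 h ** W p V' ** h)" by (simp add: add_eq_0_iff)
    ultimately show "\<zeta> = (?V, h ** U)" by (simp add: zeta U'(2) U_def)
  qed
  then show ?thesis by (simp add: hU)
qed

text \<open>In the splitting at \<open>(p, h)\<close> both components are the ones at the identity
  rotated by the inverse of \<open>h\<close>. Since \<open>lam\<close> is isometric,
  \<open>h\<close> disappears from the value.\<close>

lemma Omega_eq:
  assumes h: "h \<in> H"
  shows "Omega r E \<omega> (p, h) (V, 0) (V', 0)
    = inner_m r (co p V) (beta p V') - inner_m r (beta p V) (co p V')"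
proof -
  let ?k = "adj2 h"
  define X0 where "X0 = (\<lambda>V. lam r ?k (co p V))"
  define U0 where "U0 = (\<lambda>V. lam r ?k (beta p V))"
  have dec: "(V, 0) = horiz r E \<omega> X (p, h) + fundamental U (p, h) \<longleftrightarrow> X = X0 V \<and> U = ell (U0 V)" for V X U
  proof -
    have "(V, 0) = horiz r E \<omega> X (p, h) + fundamental U (p, h)
        \<longleftrightarrow> V = fr p (lam r h X) \<and> h ** U = W p V ** h"
      by (auto simp: horiz_eq[OF h] fundamental_def)
    also have "V = fr p (lam r h X) \<longleftrightarrow> X = X0 V"
      using frm_eq_iff[OF h, of p X V] by (auto simp: frm_eq X0_def)
    also have "h ** U = W p V ** h \<longleftrightarrow> U = ell (U0 V)"
    proof -
      have "ell (U0 V) = ?k ** (W p V ** h)"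
        using h by (simp add: U0_def ell_lam W_ell matrix_mul_assoc)
      then show ?thesis using h by (metis H_adj2_cancel)
    qed
    finally show ?thesis .
  qed
  have "Omega r E \<omega> (p, h) (V, 0) (V', 0) = inner_m r (X0 V) (U0 V') - inner_m r (U0 V) (X0 V')"
    unfolding Omega_def dec l_g_eq
    by (rule the_equality) (auto simp: inv_f_f[OF inj_ell] H_lie_eq)
  then show ?thesis using h by (simp add: X0_def U0_def inner_lam)
qed

lemma equivariant_section_const:
  assumes "equivariant_section r C mul s"
  obtains h where "h \<in> H" "s = (\<lambda>q. (q, h))"
proof -
  have s: "s q \<in> P_set r" "fst (s q) = q" "P_left mul a (s q) = s (mul a q)" for a q
    using assms by (auto simp: equivariant_section_def smooth_section_def)
  have "s q = (q, snd (s e))" for q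
    using s(3)[of q e] s(2)[of e] by (simp add: P_left_def)
  moreover have "snd (s e) \<in> H" using s(1)[of e] by (auto simp: P_set_def)
  ultimately show thesis using that by blast
qed

lemma equivariant_const: "h \<in> H \<Longrightarrow> equivariant_section r C mul (\<lambda>q. (q, h))"
  by (simp add: equivariant_section_def smooth_section_const P_left_def)

lemma lagrangian_iff_sym:
  assumes "equivariant_section r C mul s"
  shows "lagrangian_section r C E \<omega> s \<longleftrightarrow> (\<forall>p. sym_at p)"
proof -
  obtain h where h: "h \<in> H" "s = (\<lambda>q. (q, h))" using equivariant_section_const[OF assms] .
  then show ?thesis
    by (simp add: lagrangian_section_def smooth_section_const push_const Omega_eq sym_at_def)
qed

section \<open>Invariant spinors and their covariant derivative\<close>

lemma assoc_iff: "h \<in> H \<Longrightarrow> y \<in> assoc r (p, h) v \<longleftrightarrow> (\<exists>k\<in>H. y = ((p, k), adj2 k *v (h *v v)))"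
proof
  assume h: "h \<in> H"
  show "y \<in> assoc r (p, h) v \<Longrightarrow> \<exists>k\<in>H. y = ((p, k), adj2 k *v (h *v v))"
  proof -
    assume "y \<in> assoc r (p, h) v"
    then obtain k where k: "k \<in> H" "y = ((p, h ** k), adj2 k *v v)"
      by (auto simp: assoc_def P_right_def)
    then show ?thesis
      using h by (intro bexI[of _ "h ** k"]) (simp_all add: adj2_mult mat2_vec_assoc matrix_mul_assoc[symmetric])
  qed
  assume "\<exists>k\<in>H. y = ((p, k), adj2 k *v (h *v v))"
  then obtain k where k: "k \<in> H" "y = ((p, k), adj2 k *v (h *v v))" by blast
  have "y = (P_right (p, h) (adj2 h ** k), matrix_inv (adj2 h ** k) *v v) \<and> adj2 h ** k \<in> H"
    using h k by (simp add: P_right_def adj2_mult mat2_vec_assoc)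
  then show "y \<in> assoc r (p, h) v" unfolding assoc_def by blast
qed

lemma assoc_eq_one: "h \<in> H \<Longrightarrow> assoc r (p, h) v = assoc r (p, mat 1) (h *v v)"
  by (rule set_eqI) (simp add: assoc_iff)

text \<open>Each class has exactly one representative over the identity of \<open>H\<close>;
  together with \<open>assoc_eq_one\<close> this makes the descriptions on the spinor bundle
  computable.\<close>

lemma assoc_one_eq_iff: "assoc r (p, mat 1) v = assoc r (q, mat 1) w \<longleftrightarrow> p = q \<and> v = w"
proof
  assume a: "assoc r (p, mat 1) v = assoc r (q, mat 1) w"
  have "((p, mat 1), v) \<in> assoc r (p, mat 1) v"
    unfolding assoc_iff[OF H_one] by (intro bexI[of _ "mat 1"]) simp_all
  then show "p = q \<and> v = w"
    unfolding a assoc_iff[OF H_one] by auto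
qed simp

lemma assoc_image: "assoc r (p, mat 1) v = (\<lambda>k. ((p, k), adj2 k *v v)) ` H"
  by (rule set_eqI) (auto simp: assoc_iff[OF H_one])

lemma P_left_assoc:
  "(\<lambda>(u, v). (P_left mul a u, v)) ` assoc r (p, mat 1) v = assoc r (mul a p, mat 1) v"
  by (simp add: assoc_image image_image P_left_def)

lemma spinor_field_const: "spinor_field r C (\<lambda>q. assoc r (q, mat 1) v)"
  unfolding spinor_field_def
  by (intro exI[of _ "\<lambda>q. (q, mat 1)"] exI[of _ "\<lambda>q. v"] conjI smooth_section_const H_one smooth_fun_const) simp

lemma invariant_spinor_iff:
  "invariant_spinor r C mul \<psi> \<longleftrightarrow> (\<exists>v. \<psi> = (\<lambda>q. assoc r (q, mat 1) v))"
proof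
  assume i: "invariant_spinor r C mul \<psi>"
  then obtain s v where sv: "smooth_section r C s" "\<psi> e = assoc r (s e) (v e)"
    unfolding invariant_spinor_def spinor_field_def by blast
  obtain h where h: "h \<in> H" "s e = (e, h)"
    using sv(1) by (auto simp: smooth_section_def P_set_def) (metis prod.collapse mem_Times_iff)
  have "\<psi> q = assoc r (q, mat 1) (h *v v e)" for q
  proof -
    have "\<psi> (mul q e) = (\<lambda>(u, v). (P_left mul q u, v)) ` \<psi> e"
      using i unfolding invariant_spinor_def by blast
    then show ?thesis
      by (simp add: sv(2) h(2) assoc_eq_one[OF h(1)] P_left_assoc)
  qed
  then show "\<exists>v. \<psi> = (\<lambda>q. assoc r (q, mat 1) v)" by blast
next
  assume "\<exists>v. \<psi> = (\<lambda>q. assoc r (q, mat 1) v)"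
  then obtain v where "\<psi> = (\<lambda>q. assoc r (q, mat 1) v)" by blast
  then show "invariant_spinor r C mul \<psi>"
    by (simp add: invariant_spinor_def spinor_field_const P_left_assoc)
qed

lemma spinor_inner_eq: "spinor_inner r (assoc r (p, mat 1) v) (assoc r (p, mat 1) w) = herm r v w"
  unfolding spinor_inner_def
proof (rule the_equality)
  show "\<exists>u\<in>P_set r. \<exists>v' w'. assoc r (p, mat 1) v = assoc r u v' \<and> assoc r (p, mat 1) w = assoc r u w'
      \<and> herm r v w = herm r v' w'"
    by (intro bexI[of _ "(p, mat 1)"]) (auto simp: P_set_iff)
  fix c assume "\<exists>u\<in>P_set r. \<exists>v' w'. assoc r (p, mat 1) v = assoc r u v'
      \<and> assoc r (p, mat 1) w = assoc r u w' \<and> c = herm r v' w'"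
  then obtain q h v' w' where h: "h \<in> H" and *: "assoc r (p, mat 1) v = assoc r (q, h) v'"
    "assoc r (p, mat 1) w = assoc r (q, h) w'" "c = herm r v' w'"
    by (auto simp: P_set_def)
  then show "c = herm r v w"
    by (simp add: assoc_eq_one[OF h] assoc_one_eq_iff herm_H[OF h])
qed

lemma eps_unit_iff: "eps_unit r \<epsilon> (\<lambda>q. assoc r (q, mat 1) v) \<longleftrightarrow> herm r v v = complex_of_real \<epsilon>"
  by (simp add: eps_unit_def spinor_inner_eq)

lemma clifford_eq:
  "clifford r E V (assoc r (p, mat 1) v) = assoc r (p, mat 1) (gam r (co p V) *v v)"
  unfolding clifford_def
proof (rule the_equality)
  show "\<exists>u\<in>P_set r. \<exists>X v'. V = frm r E u X \<and> assoc r (p, mat 1) v = assoc r u v'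
      \<and> assoc r (p, mat 1) (gam r (co p V) *v v) = assoc r u (gam r X *v v')"
    by (intro bexI[of _ "(p, mat 1)"] exI[of _ "co p V"] exI[of _ v]) (simp_all add: P_set_iff frm_eq)
  fix y assume "\<exists>u\<in>P_set r. \<exists>X v'. V = frm r E u X \<and> assoc r (p, mat 1) v = assoc r u v'
      \<and> y = assoc r u (gam r X *v v')"
  then obtain q h X v' where h: "h \<in> H" and *: "V = frm r E (q, h) X"
    "assoc r (p, mat 1) v = assoc r (q, h) v'" "y = assoc r (q, h) (gam r X *v v')"
    by (auto simp: P_set_def)
  then have "q = p" "v = h *v v'" by (simp_all add: assoc_eq_one[OF h] assoc_one_eq_iff)
  moreover have "co p V = lam r h X" using *(1) \<open>q = p\<close> by (simp add: frm_eq)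
  ultimately show "y = assoc r (p, mat 1) (gam r (co p V) *v v)"
    by (simp add: *(3) assoc_eq_one[OF h] mat2_vec_assoc gam_conj[OF h])
qed

lemma spinor_scale_eq: "spinor_scale c (assoc r (p, mat 1) v) = assoc r (p, mat 1) (c *s v)"
proof -
  have "adj2 k *v (c *s v) = c *s (adj2 k *v v)" for k
    by (simp add: vec_eq_iff forall_2 matrix_vector_mult_def sum_2 algebra_simps)
  then show ?thesis
    by (simp add: spinor_scale_def assoc_image image_image)
qed

text \<open>The 2 undoes the 1/2 in \<open>ell\<close>; it is the origin of the factor in
  \<open>A0\<close>.\<close>

lemma scaled_clifford_eq:
  "spinor_scale (\<i>^r) (clifford r E V (assoc r (p, mat 1) v)) = assoc r (p, mat 1) (ell (2 *\<^sub>R co p V) *v v)"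
proof -
  have "\<i>^r *s (gam r X *v v) = ell (2 *\<^sub>R X) *v v" for X
  proof -
    have "ell (2 *\<^sub>R X) = smat (\<i>^r) (gam r X)"
      by (simp add: ell_def mat2_eq_iff smat_def gam_def)
        (simp add: scaleR_conv_of_real[where 'a=complex] algebra_simps)
    then show ?thesis
      by (simp add: vec_eq_iff forall_2 matrix_vector_mult_def sum_2 smat_def algebra_simps)
  qed
  then show ?thesis by (simp add: clifford_eq spinor_scale_eq)
qed

text \<open>The description admits every representation of the spinor. Along another section
  \<open>q \<mapsto> (q, h q)\<close> the coefficient is the inverse of \<open>h q\<close> applied
  to \<open>v0\<close>, and its derivative cancels the vertical term \<open>U\<close> that
  \<open>omega_eq\<close> adds.\<close>

lemma spinor_nabla_eq:
  "spinor_nabla r C \<omega> (\<lambda>q. assoc r (q, mat 1) v0) p V = assoc r (p, mat 1) (W p V *v v0)"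
  unfolding spinor_nabla_def
proof (rule the_equality)
  let ?P = "\<lambda>s v y. smooth_section r C s \<and> smooth_fun C UNIV v
      \<and> (\<forall>q. assoc r (q, mat 1) v0 = assoc r (s q) (v q))
      \<and> y = assoc r (s p) (fder C v p V + \<omega> (s p) (push C s p V) *v v p)"
  show "\<exists>s v. ?P s v (assoc r (p, mat 1) (W p V *v v0))"
    by (intro exI[of _ "\<lambda>q. (q, mat 1)"] exI[of _ "\<lambda>q. v0"])
      (simp add: smooth_section_const smooth_fun_const push_const W_def)
  fix y assume "\<exists>s v. ?P s v y"
  then obtain s v where s: "smooth_section r C s" and v: "\<And>q. assoc r (q, mat 1) v0 = assoc r (s q) (v q)"
    and y: "y = assoc r (s p) (fder C v p V + \<omega> (s p) (push C s p V) *v v p)" by blast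
  define h where "h = (\<lambda>q. snd (s q))"
  have sq: "s q = (q, h q)" and hH: "h q \<in> H" for q
    using s by (auto simp: smooth_section_def h_def P_set_def mem_Times_iff prod_eq_iff)
  have hs: "smooth_fun C UNIV h" using s by (simp add: smooth_section_def h_def)
  have dh: "((h \<circ> pt C p) has_derivative fder C h p) (at (coord C p p))"
    by (rule smooth_fun_fder[OF hs]) simp
  have "h q *v v q = v0" for q
    using v[of q] by (simp add: sq assoc_eq_one[OF hH] assoc_one_eq_iff)
  then have vq: "v q = adj2 (h q) *v v0" for q
    using hH[of q] by (metis H_adj2(2) mat2_vec_assoc matrix_vector_mul_lid)
  \<comment> \<open>The line through \<open>coord C p p\<close> may leave the chart, but
    \<open>pt\<close> is total and \<open>h\<close> always takes values in \<open>H\<close>, so the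
    curve stays in \<open>H\<close> for all \<open>t\<close>.\<close>
  have "fder C h p V \<in> H_tangent r (h p)"
  proof -
    have "((\<lambda>t. (h \<circ> pt C p) (coord C p p + t *\<^sub>R V)) has_derivative (\<lambda>t. fder C h p (t *\<^sub>R V))) (at 0)"
      by (rule has_derivative_compose[where f="\<lambda>t. coord C p p + t *\<^sub>R V"])
        (auto intro!: derivative_eq_intros simp: dh[unfolded o_def])
    then have "((\<lambda>t. (h \<circ> pt C p) (coord C p p + t *\<^sub>R V)) has_vector_derivative fder C h p V) (at 0)"
      by (simp add: has_vector_derivative_def linear_cmul[OF has_derivative_linear[OF dh]])
    then show ?thesis
      unfolding H_tangent_def using hH
      by (auto intro!: exI[of _ "\<lambda>t. (h \<circ> pt C p) (coord C p p + t *\<^sub>R V)"])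
  qed
  then obtain U where U: "U \<in> H_lie r" "fder C h p V = h p ** U"
    using H_tangent_eq[OF hH] by auto
  have adjU: "adj2 U = - U" using U(1) by (auto simp: H_lie_eq)
  have "fder C v p V = adj2 (fder C h p V) *v v0"
  proof (rule fder_eqI)
    have bl: "bounded_linear (\<lambda>M. adj2 M *v v0)"
      by (rule bounded_linear_compose[OF bounded_bilinear.bounded_linear_left[OF bounded_bilinear_mat2_vec] bounded_linear_adj2])
    have "((\<lambda>x. adj2 ((h \<circ> pt C p) x) *v v0) has_derivative (\<lambda>V. adj2 (fder C h p V) *v v0)) (at (coord C p p))"
      by (rule bounded_linear.has_derivative[OF bl dh])
    then show "((v \<circ> pt C p) has_derivative (\<lambda>V. adj2 (fder C h p V) *v v0)) (at (coord C p p))"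
      by (simp add: o_def vq)
  qed
  then have dv: "fder C v p V = - (U *v v p)"
    by (simp add: U(2) adj2_mult adjU vq mat2_vec_assoc bounded_bilinear.minus_left[OF bounded_bilinear_mat2]
        bounded_bilinear.minus_left[OF bounded_bilinear_mat2_vec])
  have "push C s p V = (V, h p ** U)"
    using U(2) by (simp add: push_def sq)
  then have "fder C v p V + \<omega> (s p) (push C s p V) *v v p = (adj2 (h p) ** W p V ** h p) *v v p"
    by (simp add: sq omega_eq[OF hH U(1)] dv matrix_vector_mult_add_rdistrib)
  also have "\<dots> = adj2 (h p) *v (W p V *v v0)"
    using hH[of p] by (simp add: vq mat2_vec_assoc matrix_mul_assoc[symmetric])
  finally show "y = assoc r (p, mat 1) (W p V *v v0)"
    using hH[of p] by (simp add: y sq assoc_eq_one[OF hH] mat2_vec_assoc)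
qed

definition A0 :: "'g \<Rightarrow> real^3 \<Rightarrow> real^3" where
  "A0 p V = fr p ((1/2) *\<^sub>R beta p V)"

text \<open>Smoothness of \<open>\<omega>\<close> is given along smooth sections; the identity
  section supplies the smooth frame coefficients.\<close>

lemma tensor_field_A0: "tensor_field C A0"
  unfolding tensor_field_def
proof (intro conjI allI impI)
  fix p
  show "linear (A0 p)"
    unfolding A0_def[abs_def] using linear_compose[OF linear_compose_scale_right[OF linear_beta] linear_fr]
    by (simp add: o_def)
next
  fix X assume X: "smooth_vf C X"
  have "smooth_fun C UNIV (\<lambda>p. \<omega> (p, mat 1) (push C (\<lambda>q. (q, mat 1)) p (X p)))"
    using spin[unfolded spin_connection_form_def, THEN conjunct2, rule_format,
        OF conjI[OF smooth_section_const[OF H_one] X]] by simp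
  then have "smooth_fun C UNIV (\<lambda>p. W p (X p))" by (simp add: push_const W_def)
  moreover have "bounded_linear (\<lambda>M. (1/2) * einv M $ k)" for k
    by (intro bounded_linear_const_mult bounded_linear_compose[OF bounded_linear_vec_nth bounded_linear_einv])
  ultimately have "smooth_fun C UNIV (\<lambda>p. (1/2) * einv (W p (X p)) $ k)" for k
    by (intro smooth_fun_bounded_linear[where L="\<lambda>M. (1/2) * einv M $ k"]) auto
  then have "smooth_vf C (\<lambda>p. \<Sum>k\<in>UNIV. ((1/2) * einv (W p (X p)) $ k) *\<^sub>R E k p)"
    by (intro smooth_vf_sum smooth_vf_scaleR smooth_E) auto
  then show "smooth_vf C (\<lambda>p. A0 p (X p))"
    by (simp add: A0_def fr_def beta_def)
qed

text \<open>By injectivity of Clifford multiplication the Killing equation has the solution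
  \<open>A0\<close> only, whichever \<open>v\<close> and \<open>\<epsilon>\<close> are taken; the
  remaining condition is symmetry and does not involve the spinor.\<close>

lemma gen_killing_with_iff:
  assumes v: "herm r v v = complex_of_real \<epsilon>" and \<epsilon>: "\<epsilon> \<in> eps_set r"
  shows "gen_killing_with r C g E \<omega> \<epsilon> (\<lambda>q. assoc r (q, mat 1) v) B \<longleftrightarrow> B = A0 \<and> (\<forall>p. sym_at p)"
proof -
  have nz: "herm r v v \<noteq> 0" using v \<epsilon> by (auto simp: eps_set_def split: if_splits)
  have eq: "spinor_nabla r C \<omega> (\<lambda>q. assoc r (q, mat 1) v) p V
      = spinor_scale (\<i>^r) (clifford r E (B p V) (assoc r (p, mat 1) v)) \<longleftrightarrow> B p V = A0 p V" for p V
  proof -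
    have "spinor_nabla r C \<omega> (\<lambda>q. assoc r (q, mat 1) v) p V
        = spinor_scale (\<i>^r) (clifford r E (B p V) (assoc r (p, mat 1) v))
      \<longleftrightarrow> ell (beta p V) *v v = ell (2 *\<^sub>R co p (B p V)) *v v"
      by (simp add: spinor_nabla_eq scaled_clifford_eq assoc_one_eq_iff W_ell)
    also have "\<dots> \<longleftrightarrow> beta p V = 2 *\<^sub>R co p (B p V)" using ell_vec_inj[OF nz, of "beta p V" "2 *\<^sub>R co p (B p V)"] by metis
    also have "\<dots> \<longleftrightarrow> (1/2) *\<^sub>R beta p V = co p (B p V)"
      by (auto simp: vec_eq_iff field_simps)
    also have "\<dots> \<longleftrightarrow> B p V = A0 p V" unfolding A0_def using fr_eq_iff[of p] by metis
    finally show ?thesis .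
  qed
  have sym: "(\<forall>p V V'. g p (A0 p V) V' = g p V (A0 p V')) \<longleftrightarrow> (\<forall>p. sym_at p)"
  proof -
    have "g p (A0 p V) V' = g p V (A0 p V') \<longleftrightarrow> inner_m r (co p V) (beta p V') = inner_m r (beta p V) (co p V')" for p V V'
    proof -
      have "g p (A0 p V) V' = g p (fr p ((1/2) *\<^sub>R beta p V)) (fr p (co p V'))"
        "g p V (A0 p V') = g p (fr p (co p V)) (fr p ((1/2) *\<^sub>R beta p V'))" by (simp_all add: A0_def)
      then show ?thesis unfolding g_fr by (auto simp: inner_m_def)
    qed
    then show ?thesis by (simp add: sym_at_def)
  qed
  have BA: "(\<forall>p V. B p V = A0 p V) \<longleftrightarrow> B = A0" by (auto simp: fun_eq_iff)
  show ?thesis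
    unfolding gen_killing_with_def eq BA
    using sym tensor_field_A0 spinor_field_const eps_unit_iff v by auto
qed

lemma gen_killing_iff_sym:
  assumes "invariant_spinor r C mul \<psi>" "eps_unit r \<epsilon> \<psi>" "\<epsilon> \<in> eps_set r"
  shows "gen_killing r C g E \<omega> \<epsilon> \<psi> \<longleftrightarrow> (\<forall>p. sym_at p)"
proof -
  obtain v where v: "\<psi> = (\<lambda>q. assoc r (q, mat 1) v)" using assms(1) invariant_spinor_iff by blast
  then have "herm r v v = complex_of_real \<epsilon>" using assms(2) unfolding v eps_unit_iff by simp
  from gen_killing_with_iff[OF this assms(3)] show ?thesis by (simp add: gen_killing_def v)
qed

lemma invariant_eps_unit_exists:
  assumes "\<epsilon> \<in> eps_set r"
  obtains \<psi> where "invariant_spinor r C mul \<psi>" "eps_unit r \<epsilon> \<psi>"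
proof -
  obtain v where "herm r v v = complex_of_real \<epsilon>" using eps_unit_exists[OF assms] by blast
  then show thesis
    using that[of "\<lambda>q. assoc r (q, mat 1) v"] invariant_spinor_iff eps_unit_iff by blast
qed

lemma killing_endomorphism_unique:
  assumes "invariant_spinor r C mul \<psi>" "gen_killing_with r C g E \<omega> \<epsilon> \<psi> B" "\<epsilon> \<in> eps_set r"
  shows "B = A0"
proof -
  obtain v where v: "\<psi> = (\<lambda>q. assoc r (q, mat 1) v)" using assms(1) invariant_spinor_iff by blast
  then have "herm r v v = complex_of_real \<epsilon>"
    using assms(2) unfolding v gen_killing_with_def eps_unit_iff by simp
  from gen_killing_with_iff[OF this assms(3)] assms(2) show ?thesis by (simp add: v)
qed

end

theorem theorem4p1:
  fixes r :: nat
    and C :: "'g::{t2_space, second_countable_topology} charts"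
    and mul :: "'g \<Rightarrow> 'g \<Rightarrow> 'g" and e :: 'g and iv :: "'g \<Rightarrow> 'g"
    and g :: "'g \<Rightarrow> real^3 \<Rightarrow> real^3 \<Rightarrow> real"
    and E :: "3 \<Rightarrow> 'g vfield"
    and D :: "'g vfield \<Rightarrow> 'g vfield \<Rightarrow> 'g vfield"
    and \<omega> :: "'g pform"
    and \<epsilon> :: real
  assumes "r \<in> {0, 1}"
    and "lie_group C mul e iv"
    and "connected (UNIV :: 'g set)"
    and "pseudo_metric r C g"
    and "left_invariant_metric C mul g"
    and "invariant_frame r C mul g E"
    and "levi_civita C g D"
    and "spin_connection_form r C E D \<omega>"
    and "\<epsilon> \<in> eps_set r"
  shows "(unimodular mul \<longleftrightarrow>
            (\<exists>\<psi>. invariant_spinor r C mul \<psi> \<and> eps_unit r \<epsilon> \<psi> \<and> gen_killing r C g E \<omega> \<epsilon> \<psi>))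
       \<and> (unimodular mul \<longleftrightarrow>
            (\<forall>\<psi>. invariant_spinor r C mul \<psi> \<and> eps_unit r \<epsilon> \<psi> \<longrightarrow> gen_killing r C g E \<omega> \<epsilon> \<psi>))
       \<and> (unimodular mul \<longleftrightarrow>
            (\<exists>s. equivariant_section r C mul s \<and> lagrangian_section r C E \<omega> s))
       \<and> (unimodular mul \<longleftrightarrow>
            (\<forall>s. equivariant_section r C mul s \<longrightarrow> lagrangian_section r C E \<omega> s))
       \<and> (unimodular mul \<longrightarrow>
            (\<exists>A. \<forall>\<epsilon>'\<in>eps_set r. \<forall>\<psi> B.
               invariant_spinor r C mul \<psi> \<and> gen_killing_with r C g E \<omega> \<epsilon>' \<psi> B \<longrightarrow> B = A))"
proof -
  \<comment> \<open>Pairing with each frame vector: the Gram matrix is diagonal with entries 1 or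
    -1.\<close>
  have inj: "x = 0" if x: "(\<Sum>k\<in>UNIV. x $ k *\<^sub>R E k p) = 0" for x :: "real^3" and p
  proof -
    have bl: "bilinear (g p)" using assms(4) by (simp add: pseudo_metric_def)
    have gE: "g p (E i p) (E j p) = inner_m r (axis i 1) (axis j 1)" for i j
      using assms(6) by (simp add: invariant_frame_def)
    have lin: "linear (\<lambda>V. g p V (E j p))" for j using bl by (simp add: bilinear_def)
    have "(\<Sum>k\<in>UNIV. x $ k * inner_m r (axis k 1) (axis j 1)) = 0" for j
      using arg_cong[OF x, of "\<lambda>V. g p V (E j p)"]
      by (simp add: linear_sum[OF lin] linear_cmul[OF lin] linear_0[OF lin] gE)
    from this[of 0] this[of 1] this[of 2] show ?thesis
      by (simp add: sum_3' inner_m_def axis_def vec3_eq_iff)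
  qed
  interpret haar_group C mul e iv E
    by unfold_locales
      (use assms(2,6) inj in \<open>auto simp: lie_group_def invariant_frame_def\<close>)
  interpret spin_lie_group r C mul e iv E g D \<omega>
    by unfold_locales (use assms in auto)
  \<comment> \<open>A witness, here and in \<open>s\<close>, is what lets each universal condition
    imply the existential one.\<close>
  obtain \<psi> where \<psi>: "invariant_spinor r C mul \<psi>" "eps_unit r \<epsilon> \<psi>"
    using invariant_eps_unit_exists[OF assms(9)] .
  note killing = gen_killing_iff_sym[OF _ _ assms(9)]
  have s: "equivariant_section r C mul (\<lambda>q. (q, mat 1))" by (rule equivariant_const[OF H_one])
  show ?thesis
    unfolding unimodular_iff_sym
    using \<psi> s killing lagrangian_iff_sym killing_endomorphism_unique by metis
qed

end
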